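(* Let $(\mathcal{C},\cdot,n)$ be a Cayley algebra over a field $\mathbb{F}$ of characteristic $3$, and let $\tau$ be an order $3$ automorphism of $(\mathcal{C},\cdot,n)$. Then $(\mathcal{C},\cdot,n)$ is the split Cayley algebra and one of the following conditions holds: (1) $(\tau-\mathrm{id})^2=0$. In this case, the Petersson algebra $\mathcal{C}_\tau$ is the split Okubo algebra, $1$ is its (unique) quaternionic idempotent, and there exists a canonical basis of $\mathcal{C}$ such that $\tau(u_i)=u_i$ for $i=1,2$ and $\tau(u_3)=u_3+u_2$. In other words, $\tau=\exp(\delta)$, where $\delta=[L_{u_2},R_{v_3}]$, which is a derivation in the root space $\mathrm{Der}(\mathcal{C},\cdot,n)_{\varepsilon_2-\varepsilon_3}$ ($\varepsilon_2-\varepsilon_3$ is a long root). In particular, up to conjugacy, there is a unique such automorphism $\tau$. The Segre symbol of the nilpotent endomorphism $\tau-\mathrm{id}$ is $(2^2,1^4)$. (2) $(\tau-\mathrm{id})^2\neq 0$ and there is a quadratic étale subalgebra $\mathcal{K}$ of $\mathcal{C}$ fixed elementwise by $\tau$. In this case, the Petersson algebra $\mathcal{C}_\tau$ is an Okubo algebra, $1$ is a quadratic idempotent of $\mathcal{C}_\tau$, and the Segre symbol of $\tau-\mathrm{id}$ is $(3^2,1^2)$. If $\mathbb{F}$ is algebraically closed, then there is a canonical basis of $\mathcal{C}$ such that $\tau(u_i)=u_{i+1}$ (indices modulo $3$), so $\tau$ fixes $e_1$ and $e_2$, and it belongs to the normalizer of the associated maximal torus. (3) There is a canonical basis such that $\tau(u_i)=u_i$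 for $i=1,2$ and $\tau(u_3)=u_3+v_3-(e_1-e_2)$. In this case, $\tau(x)=w\cdot x\cdot w^2$ for all $x$, with $w=1-v_3$. Hence the Petersson algebra $\mathcal{C}_\tau$ is a para-Cayley algebra with para-unit $w$. Also, $\tau=\exp(\delta)$, where $\delta=-\mathrm{ad}\,v_3: x\mapsto -[v_3,x]=x\cdot v_3-v_3\cdot x$ is a derivation in the root space $\mathrm{Der}(\mathcal{C},\cdot,n)_{-\varepsilon_3}$ ($-\varepsilon_3$ is a short root). In particular, up to conjugacy, there is a unique such automorphism $\tau$. The Segre symbol of $\tau-\mathrm{id}$ is $(3,2^2,1)$. (4) There is a canonical basis such that $\tau(u_i)=u_i$ for $i=1,2$ and $\tau(u_3)=u_3+u_2+v_3-(e_1-e_2)$. In this case, the Petersson algebra $\mathcal{C}_\tau$ is the split Okubo algebra, and $1$ is a singular idempotent of $\mathcal{C}_\tau$. Such an automorphism $\tau$ is unique, up to conjugacy, and it is the composition of the (commuting) automorphisms given by the formulas in (1) and (3) (relative to the same canonical basis). The Segre symbol of $\tau-\mathrm{id}$ is again $(3,2^2,1)$.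
   Context: A composition algebra over $\mathbb{F}$ is a triple $(\mathcal{C},*,n)$ with $(\mathcal{C},* )$ a not necessarily associative algebra and $n$ a nonsingular quadratic form with $n(x*y)=n(x)n(y)$; polar form $n(x,y)=n(x+y)-n(x)-n(y)$. Hurwitz algebras are the unital ones (dimension $2$: quadratic étale, $4$: quaternion, $8$: Cayley), with conjugation $\bar x=n(x,1)1-x$. Given a Hurwitz algebra $(\mathcal{C},\cdot,n)$ and an automorphism $\tau$ with $\tau^3=\mathrm{id}$, the Petersson algebra $\mathcal{C}_\tau=(\mathcal{C},*,n)$ has product $x*y=\tau(\bar x)\cdot\tau^2(\bar y)$. For $\tau=\mathrm{id}$ it is the para-Hurwitz algebra (para-quadratic, para-quaternion, para-Cayley in dimensions $2,4,8$). A para-unit is an idempotent $e$ with $e*x=x*e=n(e,x)e-x$ for all $x$. Idempotents are always nonzero. The split Cayley algebra is the Cayley algebra having a canonical basis, i.e. a basis $e_1,e_2,u_1,u_2,u_3,v_1,v_2,v_3$ where $e_1,e_2$ are orthogonal idempotents with $e_1+e_2=1$, $e_1u_i=u_i=u_ie_2$, $e_2v_i=v_i=v_ie_1$, $e_2u_i=u_ie_1=e_1v_i=v_ie_2=0$, $u_iu_{i+1}=v_{i+2}=-u_{i+1}u_i$, $v_iv_{i+1}=u_{i+2}=-v_{i+1}v_i$ (indices modulo $3$), $u_i^2=v_i^2=0$, $u_iv_i=-e_1$, $v_iu_i=-e_2$, $u_iv_j=v_iu_j=0$ for $i\ne j$. The elements $u_1,u_2,u_3$ generate the algebra, so an automorphism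 is determined by its action on them. The automorphism $\tau_{st}$ fixes $e_1,e_2$ and maps $u_i\mapsto u_{i+1}$, $v_i\mapsto v_{i+1}$; the split Okubo algebra is the Petersson algebra $\mathcal{C}_{\tau_{st}}$, and an Okubo algebra is an algebra becoming isomorphic to it after an extension of scalars. An idempotent $f$ of an Okubo algebra in characteristic $3$ is quaternionic if its centralizer $\{x:f*x=x*f\}$ contains a para-quaternion subalgebra; quadratic if its centralizer contains a para-quadratic subalgebra and no para-quaternion subalgebra; singular otherwise. Given a canonical basis, the associated maximal torus $\mathbf{T}$ of the algebraic group of automorphisms consists of the automorphisms fixing $e_1,e_2$ and acting as $u_i\mapsto\alpha_iu_i$, $v_i\mapsto\alpha_i^{-1}v_i$ with $\alpha_1\alpha_2\alpha_3=1$; $\varepsilon_i$ is the character $\alpha\mapsto\alpha_i$ (written additively, so $\varepsilon_1+\varepsilon_2+\varepsilon_3=0$). The roots on $\mathrm{Der}(\mathcal{C},\cdot,n)$ are $\pm\varepsilon_i$ (short) and $\varepsilon_i-\varepsilon_j$, $i\neq j$ (long); the root space for $\alpha$ is the $\alpha$-weight space of $\mathbf{T}$ acting by conjugation. $L_x,R_x$ are left and right multiplications by $x$. For these derivations $\delta^3=0$ and $\exp(\delta)=\mathrm{id}+\delta+\frac12\delta^2$. The Segre symbol of a nilpotent endomorphism lists the sizes of its Jordan blocks, exponents denoting multiplicities. *)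

theory Defs
  imports
    "HOL-Algebra.Algebraic_Closure_Type"
    "HOL-Analysis.Cartesian_Space"
begin

text \<open>
  An algebra is given by a scalar multiplication, a product and (usually) a quadratic form \<open>n\<close>
  on the type \<open>'v\<close>. The notions that are also needed for subalgebras are relative to a carrier
  \<open>A\<close>; the full algebra is the case \<open>A = UNIV\<close>.
\<close>

definition polar :: "('v::ab_group_add \<Rightarrow> 'f::field) \<Rightarrow> 'v \<Rightarrow> 'v \<Rightarrow> 'f" where
  "polar n x y = n (x + y) - n x - n y"

text \<open>
  Nonsingularity is nondegeneracy of the polar form. This is the usual meaning in
  characteristic different from 2, which is the only case of interest here.
\<close>

locale composition_algebra = vector_space scale
  for scale :: "'f::field \<Rightarrow> 'v::ab_group_add \<Rightarrow> 'v" +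
  fixes A :: "'v set"
    and mul :: "'v \<Rightarrow> 'v \<Rightarrow> 'v"
    and n :: "'v \<Rightarrow> 'f"
  assumes carrier_subspace: "subspace A"
    and mul_closed: "x \<in> A \<Longrightarrow> y \<in> A \<Longrightarrow> mul x y \<in> A"
    and mul_add_left: "x \<in> A \<Longrightarrow> y \<in> A \<Longrightarrow> z \<in> A \<Longrightarrow> mul (x + y) z = mul x z + mul y z"
    and mul_add_right: "x \<in> A \<Longrightarrow> y \<in> A \<Longrightarrow> z \<in> A \<Longrightarrow> mul x (y + z) = mul x y + mul x z"
    and mul_scale_left: "x \<in> A \<Longrightarrow> y \<in> A \<Longrightarrow> mul (scale a x) y = scale a (mul x y)"
    and mul_scale_right: "x \<in> A \<Longrightarrow> y \<in> A \<Longrightarrow> mul x (scale a y) = scale a (mul x y)"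
    and norm_scale: "x \<in> A \<Longrightarrow> n (scale a x) = a\<^sup>2 * n x"
    and polar_add: "x \<in> A \<Longrightarrow> y \<in> A \<Longrightarrow> z \<in> A \<Longrightarrow> polar n (x + y) z = polar n x z + polar n y z"
    and polar_scale: "x \<in> A \<Longrightarrow> y \<in> A \<Longrightarrow> polar n (scale a x) y = a * polar n x y"
    and nonsingular: "x \<in> A \<Longrightarrow> (\<And>y. y \<in> A \<Longrightarrow> polar n x y = 0) \<Longrightarrow> x = 0"
    and norm_mul: "x \<in> A \<Longrightarrow> y \<in> A \<Longrightarrow> n (mul x y) = n x * n y"

locale hurwitz_algebra = composition_algebra scale A mul n
  for scale :: "'f::field \<Rightarrow> 'v::ab_group_add \<Rightarrow> 'v" and A mul one' n +
  assumes one_closed: "one' \<in> A"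
    and one_mul: "x \<in> A \<Longrightarrow> mul one' x = x"
    and mul_one: "x \<in> A \<Longrightarrow> mul x one' = x"

definition cayley_algebra ::
    "('f::field \<Rightarrow> 'v::ab_group_add \<Rightarrow> 'v) \<Rightarrow> ('v \<Rightarrow> 'v \<Rightarrow> 'v) \<Rightarrow> 'v \<Rightarrow> ('v \<Rightarrow> 'f) \<Rightarrow> bool" where
  "cayley_algebra s mul one' n \<longleftrightarrow>
     hurwitz_algebra s UNIV mul one' n \<and> vector_space.dim s UNIV = 8"

definition quadratic_etale_subalgebra ::
    "('f::field \<Rightarrow> 'v::ab_group_add \<Rightarrow> 'v) \<Rightarrow> ('v \<Rightarrow> 'v \<Rightarrow> 'v) \<Rightarrow> 'v \<Rightarrow> ('v \<Rightarrow> 'f) \<Rightarrow> 'v set \<Rightarrow> bool" where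
  "quadratic_etale_subalgebra s mul one' n K \<longleftrightarrow>
     hurwitz_algebra s K mul one' n \<and> vector_space.dim s K = 2"

definition conjugation ::
    "('f::field \<Rightarrow> 'v::ab_group_add \<Rightarrow> 'v) \<Rightarrow> 'v \<Rightarrow> ('v \<Rightarrow> 'f) \<Rightarrow> 'v \<Rightarrow> 'v" where
  "conjugation s one' n x = s (polar n x one') one' - x"

definition automorphism ::
    "('f::field \<Rightarrow> 'v::ab_group_add \<Rightarrow> 'v) \<Rightarrow> ('v \<Rightarrow> 'v \<Rightarrow> 'v) \<Rightarrow> ('v \<Rightarrow> 'f) \<Rightarrow> ('v \<Rightarrow> 'v) \<Rightarrow> bool" where
  "automorphism s mul n \<phi> \<longleftrightarrow> Vector_Spaces.linear s s \<phi> \<and> bij \<phi> \<and>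
     (\<forall>x y. \<phi> (mul x y) = mul (\<phi> x) (\<phi> y)) \<and> (\<forall>x. n (\<phi> x) = n x)"

definition order3_automorphism ::
    "('f::field \<Rightarrow> 'v::ab_group_add \<Rightarrow> 'v) \<Rightarrow> ('v \<Rightarrow> 'v \<Rightarrow> 'v) \<Rightarrow> ('v \<Rightarrow> 'f) \<Rightarrow> ('v \<Rightarrow> 'v) \<Rightarrow> bool" where
  "order3_automorphism s mul n \<tau> \<longleftrightarrow> automorphism s mul n \<tau> \<and> \<tau> \<circ> \<tau> \<circ> \<tau> = id \<and> \<tau> \<noteq> id"

definition unique_up_to_conjugacy ::
    "('f::field \<Rightarrow> 'v::ab_group_add \<Rightarrow> 'v) \<Rightarrow> ('v \<Rightarrow> 'v \<Rightarrow> 'v) \<Rightarrow> ('v \<Rightarrow> 'f) \<Rightarrow> (('v \<Rightarrow> 'v) \<Rightarrow> bool) \<Rightarrow> bool" where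
  "unique_up_to_conjugacy s mul n P \<longleftrightarrow>
     (\<exists>\<sigma>. P \<sigma>) \<and>
     (\<forall>\<sigma> \<sigma>'. P \<sigma> \<longrightarrow> P \<sigma>' \<longrightarrow> (\<exists>\<phi>. automorphism s mul n \<phi> \<and> \<sigma>' = \<phi> \<circ> \<sigma> \<circ> inv_into UNIV \<phi>))"


subsection \<open>Petersson, para-Hurwitz and Okubo algebras\<close>

definition petersson ::
    "('f::field \<Rightarrow> 'v::ab_group_add \<Rightarrow> 'v) \<Rightarrow> ('v \<Rightarrow> 'v \<Rightarrow> 'v) \<Rightarrow> 'v \<Rightarrow> ('v \<Rightarrow> 'f) \<Rightarrow> ('v \<Rightarrow> 'v) \<Rightarrow>
      'v \<Rightarrow> 'v \<Rightarrow> 'v" where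
  "petersson s mul one' n \<tau> x y =
     mul (\<tau> (conjugation s one' n x)) (\<tau> (\<tau> (conjugation s one' n y)))"

text \<open>
  The carrier \<open>A\<close> with the restricted product and norm is a para-Hurwitz algebra of dimension
  \<open>d\<close>: para-quadratic, para-quaternion, para-Cayley for \<open>d = 2, 4, 8\<close>.
\<close>

definition para_hurwitz ::
    "('f::field \<Rightarrow> 'v::ab_group_add \<Rightarrow> 'v) \<Rightarrow> 'v set \<Rightarrow> ('v \<Rightarrow> 'v \<Rightarrow> 'v) \<Rightarrow> ('v \<Rightarrow> 'f) \<Rightarrow> nat \<Rightarrow> bool" where
  "para_hurwitz s A star n d \<longleftrightarrow>
     (\<exists>mul one'. hurwitz_algebra s A mul one' n \<and> vector_space.dim s A = d \<and>
        (\<forall>x\<in>A. \<forall>y\<in>A. star x y = petersson s mul one' n id x y))"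

definition para_unit ::
    "('f::field \<Rightarrow> 'v::ab_group_add \<Rightarrow> 'v) \<Rightarrow> ('v \<Rightarrow> 'v \<Rightarrow> 'v) \<Rightarrow> ('v \<Rightarrow> 'f) \<Rightarrow> 'v \<Rightarrow> bool" where
  "para_unit s star n e \<longleftrightarrow> e \<noteq> 0 \<and> star e e = e \<and>
     (\<forall>x. star e x = s (polar n e x) e - x \<and> star x e = s (polar n e x) e - x)"

text \<open>
  Indices live in the type \<open>3\<close> of integers modulo 3, so that \<open>i + 1\<close> and \<open>i + 2\<close> are
  automatically taken modulo 3. The indices \<open>1, 2, 3\<close> exhaust this type, with \<open>3 = 0\<close>.
\<close>

definition canonical_basis ::
    "('f::field \<Rightarrow> 'v::ab_group_add \<Rightarrow> 'v) \<Rightarrow> ('v \<Rightarrow> 'v \<Rightarrow> 'v) \<Rightarrow> 'v \<Rightarrow>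
      'v \<Rightarrow> 'v \<Rightarrow> (3 \<Rightarrow> 'v) \<Rightarrow> (3 \<Rightarrow> 'v) \<Rightarrow> bool" where
  "canonical_basis s mul one' e1 e2 u v \<longleftrightarrow>
     (let B = {e1, e2} \<union> range u \<union> range v
      in card B = 8 \<and> \<not> Modules.module.dependent s B \<and> Modules.module.span s B = UNIV) \<and>
     mul e1 e1 = e1 \<and> mul e2 e2 = e2 \<and> mul e1 e2 = 0 \<and> mul e2 e1 = 0 \<and> e1 + e2 = one' \<and>
     (\<forall>i. mul e1 (u i) = u i \<and> mul (u i) e2 = u i \<and>
          mul e2 (v i) = v i \<and> mul (v i) e1 = v i \<and>
          mul e2 (u i) = 0 \<and> mul (u i) e1 = 0 \<and>
          mul e1 (v i) = 0 \<and> mul (v i) e2 = 0) \<and>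
     (\<forall>i. mul (u i) (u (i + 1)) = v (i + 2) \<and> mul (u (i + 1)) (u i) = - v (i + 2) \<and>
          mul (v i) (v (i + 1)) = u (i + 2) \<and> mul (v (i + 1)) (v i) = - u (i + 2)) \<and>
     (\<forall>i. mul (u i) (u i) = 0 \<and> mul (v i) (v i) = 0 \<and>
          mul (u i) (v i) = - e1 \<and> mul (v i) (u i) = - e2) \<and>
     (\<forall>i j. i \<noteq> j \<longrightarrow> mul (u i) (v j) = 0 \<and> mul (v i) (u j) = 0)"

definition split_cayley_algebra ::
    "('f::field \<Rightarrow> 'v::ab_group_add \<Rightarrow> 'v) \<Rightarrow> ('v \<Rightarrow> 'v \<Rightarrow> 'v) \<Rightarrow> 'v \<Rightarrow> ('v \<Rightarrow> 'f) \<Rightarrow> bool" where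
  "split_cayley_algebra s mul one' n \<longleftrightarrow>
     cayley_algebra s mul one' n \<and> (\<exists>e1 e2 u v. canonical_basis s mul one' e1 e2 u v)"

text \<open>
  Being the split Okubo algebra (up to isomorphism) means being the Petersson algebra of
  \<open>\<tau>\<^sub>s\<^sub>t\<close> for some split Cayley structure on the underlying space: an isomorphism
  onto the Petersson algebra of the split Cayley algebra transports that structure.
\<close>

definition split_okubo_algebra ::
    "('f::field \<Rightarrow> 'v::ab_group_add \<Rightarrow> 'v) \<Rightarrow> ('v \<Rightarrow> 'v \<Rightarrow> 'v) \<Rightarrow> ('v \<Rightarrow> 'f) \<Rightarrow> bool" where
  "split_okubo_algebra s star n \<longleftrightarrow>
     (\<exists>mul one' e1 e2 u v \<tau>st.
        cayley_algebra s mul one' n \<and> canonical_basis s mul one' e1 e2 u v \<and>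
        automorphism s mul n \<tau>st \<and> \<tau>st e1 = e1 \<and> \<tau>st e2 = e2 \<and>
        (\<forall>i. \<tau>st (u i) = u (i + 1) \<and> \<tau>st (v i) = v (i + 1)) \<and>
        star = petersson s mul one' n \<tau>st)"

text \<open>
  Extension of scalars along a field embedding \<open>\<iota>\<close> from \<open>'f\<close> to \<open>'k\<close>, for an 8-dimensional
  algebra with basis \<open>b\<close> indexed by the type \<open>8\<close>. The extended space is \<open>'k ^ 8\<close>, the standard
  basis vector with index \<open>i\<close> being \<open>b i \<otimes> 1\<close>; \<open>ext_vec\<close> is the map \<open>x \<mapsto> x \<otimes> 1\<close>.
\<close>

definition field_embedding :: "('f::field \<Rightarrow> 'k::field) \<Rightarrow> bool" where
  "field_embedding \<iota> \<longleftrightarrow> \<iota> 1 = 1 \<and> (\<forall>x y. \<iota> (x + y) = \<iota> x + \<iota> y) \<and> (\<forall>x y. \<iota> (x * y) = \<iota> x * \<iota> y)"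

definition basis_family ::
    "('f::field \<Rightarrow> 'v::ab_group_add \<Rightarrow> 'v) \<Rightarrow> (8 \<Rightarrow> 'v) \<Rightarrow> bool" where
  "basis_family s b \<longleftrightarrow>
     inj b \<and> \<not> Modules.module.dependent s (range b) \<and> Modules.module.span s (range b) = UNIV"

definition ext_vec ::
    "('f::field \<Rightarrow> 'v::ab_group_add \<Rightarrow> 'v) \<Rightarrow> (8 \<Rightarrow> 'v) \<Rightarrow> ('f \<Rightarrow> 'k::field) \<Rightarrow> 'v \<Rightarrow> 'k ^ 8" where
  "ext_vec s b \<iota> x = (\<chi> k. \<iota> (Modules.module.representation s (range b) x (b k)))"

definition ext_mul ::
    "('f::field \<Rightarrow> 'v::ab_group_add \<Rightarrow> 'v) \<Rightarrow> (8 \<Rightarrow> 'v) \<Rightarrow> ('f \<Rightarrow> 'k::field) \<Rightarrow> ('v \<Rightarrow> 'v \<Rightarrow> 'v) \<Rightarrow>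
      'k ^ 8 \<Rightarrow> 'k ^ 8 \<Rightarrow> 'k ^ 8" where
  "ext_mul s b \<iota> mul x y =
     (\<Sum>i\<in>UNIV. \<Sum>j\<in>UNIV. (x $ i * y $ j) *s ext_vec s b \<iota> (mul (b i) (b j)))"

definition ext_norm ::
    "(8 \<Rightarrow> 'v::ab_group_add) \<Rightarrow> ('f::field \<Rightarrow> 'k::field) \<Rightarrow> ('v \<Rightarrow> 'f) \<Rightarrow> 'k ^ 8 \<Rightarrow> 'k" where
  "ext_norm b \<iota> n x =
     (\<Sum>i\<in>UNIV. \<iota> (n (b i)) * (x $ i)\<^sup>2) +
     (\<Sum>i\<in>UNIV. \<Sum>j\<in>{i<..}. \<iota> (polar n (b i) (b j)) * (x $ i * x $ j))"

definition ext_endo ::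
    "('f::field \<Rightarrow> 'v::ab_group_add \<Rightarrow> 'v) \<Rightarrow> (8 \<Rightarrow> 'v) \<Rightarrow> ('f \<Rightarrow> 'k::field) \<Rightarrow> ('v \<Rightarrow> 'v) \<Rightarrow>
      'k ^ 8 \<Rightarrow> 'k ^ 8" where
  "ext_endo s b \<iota> \<delta> x = (\<Sum>i\<in>UNIV. x $ i *s ext_vec s b \<iota> (\<delta> (b i)))"

text \<open>
  The extension field is taken on the type \<open>'f alg_closure\<close>, since HOL cannot quantify
  existentially over types. Nothing is lost: an 8-dimensional algebra that becomes the split
  Okubo algebra over some extension field also does so over the algebraic closure.
\<close>

definition okubo_algebra ::
    "('f::field \<Rightarrow> 'v::ab_group_add \<Rightarrow> 'v) \<Rightarrow> ('v \<Rightarrow> 'v \<Rightarrow> 'v) \<Rightarrow> ('v \<Rightarrow> 'f) \<Rightarrow> bool" where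
  "okubo_algebra s star n \<longleftrightarrow>
     (\<exists>(\<iota> :: 'f \<Rightarrow> 'f alg_closure) b. field_embedding \<iota> \<and> basis_family s b \<and>
        split_okubo_algebra (*s) (ext_mul s b \<iota> star) (ext_norm b \<iota> n))"


subsection \<open>Idempotents of Okubo algebras in characteristic 3\<close>

definition idempotent :: "('v::zero \<Rightarrow> 'v \<Rightarrow> 'v) \<Rightarrow> 'v \<Rightarrow> bool" where
  "idempotent star f \<longleftrightarrow> f \<noteq> 0 \<and> star f f = f"

definition centralizer :: "('v \<Rightarrow> 'v \<Rightarrow> 'v) \<Rightarrow> 'v \<Rightarrow> 'v set" where
  "centralizer star f = {x. star f x = star x f}"

definition centralizer_contains_para_hurwitz ::
    "('f::field \<Rightarrow> 'v::ab_group_add \<Rightarrow> 'v) \<Rightarrow> ('v \<Rightarrow> 'v \<Rightarrow> 'v) \<Rightarrow> ('v \<Rightarrow> 'f) \<Rightarrow> 'v \<Rightarrow> nat \<Rightarrow> bool" where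
  "centralizer_contains_para_hurwitz s star n f d \<longleftrightarrow>
     (\<exists>A \<subseteq> centralizer star f. para_hurwitz s A star n d)"

definition quaternionic_idempotent ::
    "('f::field \<Rightarrow> 'v::ab_group_add \<Rightarrow> 'v) \<Rightarrow> ('v \<Rightarrow> 'v \<Rightarrow> 'v) \<Rightarrow> ('v \<Rightarrow> 'f) \<Rightarrow> 'v \<Rightarrow> bool" where
  "quaternionic_idempotent s star n f \<longleftrightarrow> idempotent star f \<and>
     centralizer_contains_para_hurwitz s star n f 4"

definition quadratic_idempotent ::
    "('f::field \<Rightarrow> 'v::ab_group_add \<Rightarrow> 'v) \<Rightarrow> ('v \<Rightarrow> 'v \<Rightarrow> 'v) \<Rightarrow> ('v \<Rightarrow> 'f) \<Rightarrow> 'v \<Rightarrow> bool" where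
  "quadratic_idempotent s star n f \<longleftrightarrow> idempotent star f \<and>
     centralizer_contains_para_hurwitz s star n f 2 \<and>
     \<not> centralizer_contains_para_hurwitz s star n f 4"

definition singular_idempotent ::
    "('f::field \<Rightarrow> 'v::ab_group_add \<Rightarrow> 'v) \<Rightarrow> ('v \<Rightarrow> 'v \<Rightarrow> 'v) \<Rightarrow> ('v \<Rightarrow> 'f) \<Rightarrow> 'v \<Rightarrow> bool" where
  "singular_idempotent s star n f \<longleftrightarrow> idempotent star f \<and>
     \<not> quaternionic_idempotent s star n f \<and> \<not> quadratic_idempotent s star n f"


subsection \<open>The maximal torus, its normalizer and root spaces\<close>

text \<open>
  The rational points of the maximal torus attached to a canonical basis: \<open>torus_point\<close> relates
  the parameters \<open>\<alpha>\<close> to the automorphism they define.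
\<close>

definition torus_point ::
    "('f::field \<Rightarrow> 'v::ab_group_add \<Rightarrow> 'v) \<Rightarrow> ('v \<Rightarrow> 'v \<Rightarrow> 'v) \<Rightarrow> ('v \<Rightarrow> 'f) \<Rightarrow>
      'v \<Rightarrow> 'v \<Rightarrow> (3 \<Rightarrow> 'v) \<Rightarrow> (3 \<Rightarrow> 'v) \<Rightarrow> (3 \<Rightarrow> 'f) \<Rightarrow> ('v \<Rightarrow> 'v) \<Rightarrow> bool" where
  "torus_point s mul n e1 e2 u v \<alpha> t \<longleftrightarrow>
     \<alpha> 1 * \<alpha> 2 * \<alpha> 3 = 1 \<and> automorphism s mul n t \<and> t e1 = e1 \<and> t e2 = e2 \<and>
     (\<forall>i. t (u i) = s (\<alpha> i) (u i) \<and> t (v i) = s (inverse (\<alpha> i)) (v i))"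

definition torus ::
    "('f::field \<Rightarrow> 'v::ab_group_add \<Rightarrow> 'v) \<Rightarrow> ('v \<Rightarrow> 'v \<Rightarrow> 'v) \<Rightarrow> ('v \<Rightarrow> 'f) \<Rightarrow>
      'v \<Rightarrow> 'v \<Rightarrow> (3 \<Rightarrow> 'v) \<Rightarrow> (3 \<Rightarrow> 'v) \<Rightarrow> ('v \<Rightarrow> 'v) set" where
  "torus s mul n e1 e2 u v = {t. \<exists>\<alpha>. torus_point s mul n e1 e2 u v \<alpha> t}"

text \<open>
  This is the normalizer of the group of rational points of the torus; it is used over
  algebraically closed fields only, where it is the normalizer in the algebraic group.
\<close>

definition torus_normalizer ::
    "('f::field \<Rightarrow> 'v::ab_group_add \<Rightarrow> 'v) \<Rightarrow> ('v \<Rightarrow> 'v \<Rightarrow> 'v) \<Rightarrow> ('v \<Rightarrow> 'f) \<Rightarrow>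
      'v \<Rightarrow> 'v \<Rightarrow> (3 \<Rightarrow> 'v) \<Rightarrow> (3 \<Rightarrow> 'v) \<Rightarrow> ('v \<Rightarrow> 'v) set" where
  "torus_normalizer s mul n e1 e2 u v =
     {\<phi>. automorphism s mul n \<phi> \<and>
        (\<lambda>t. \<phi> \<circ> t \<circ> inv_into UNIV \<phi>) ` torus s mul n e1 e2 u v = torus s mul n e1 e2 u v}"

text \<open>
  Characters of the torus, written additively, are represented by integer vectors; vectors that
  differ by a multiple of \<open>(1, 1, 1)\<close> give the same character since \<open>\<alpha> 1 * \<alpha> 2 * \<alpha> 3 = 1\<close>.
\<close>

definition eps :: "3 \<Rightarrow> int ^ 3" where
  "eps i = axis i 1"

definition char_value :: "int ^ 3 \<Rightarrow> (3 \<Rightarrow> 'k::field) \<Rightarrow> 'k" where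
  "char_value w \<alpha> = (\<Prod>i\<in>UNIV. \<alpha> i powi (w $ i))"

definition short_roots :: "(int ^ 3) set" where
  "short_roots = range eps \<union> range (\<lambda>i. - eps i)"

definition long_roots :: "(int ^ 3) set" where
  "long_roots = {eps i - eps j | i j. i \<noteq> j}"

definition Der ::
    "('f::field \<Rightarrow> 'v::ab_group_add \<Rightarrow> 'v) \<Rightarrow> ('v \<Rightarrow> 'v \<Rightarrow> 'v) \<Rightarrow> ('v \<Rightarrow> 'f) \<Rightarrow> ('v \<Rightarrow> 'v) set" where
  "Der s mul n = {\<delta>. Vector_Spaces.linear s s \<delta> \<and>
     (\<forall>x y. \<delta> (mul x y) = mul (\<delta> x) y + mul x (\<delta> y)) \<and>
     (\<forall>x y. polar n (\<delta> x) y + polar n x (\<delta> y) = 0)}"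

text \<open>
  The weight space of the algebraic group \<open>T\<close>. Over a small field the rational points of \<open>T\<close> do
  not separate the characters, so the weight condition is imposed for all points of \<open>T\<close> over the
  algebraic closure, on the derivation extended to the algebraic closure.
\<close>

definition root_space ::
    "('f::field \<Rightarrow> 'v::ab_group_add \<Rightarrow> 'v) \<Rightarrow> ('v \<Rightarrow> 'v \<Rightarrow> 'v) \<Rightarrow> ('v \<Rightarrow> 'f) \<Rightarrow>
      'v \<Rightarrow> 'v \<Rightarrow> (3 \<Rightarrow> 'v) \<Rightarrow> (3 \<Rightarrow> 'v) \<Rightarrow> int ^ 3 \<Rightarrow> ('v \<Rightarrow> 'v) set" where
  "root_space s mul n e1 e2 u v w = {\<delta> \<in> Der s mul n.
     \<exists>b. basis_family s b \<and>
       (let j = ext_vec s b (to_ac :: 'f \<Rightarrow> 'f alg_closure); \<delta>' = ext_endo s b to_ac \<delta>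
        in \<forall>\<alpha> t. torus_point (*s) (ext_mul s b to_ac mul) (ext_norm b to_ac n)
                   (j e1) (j e2) (j \<circ> u) (j \<circ> v) \<alpha> t \<longrightarrow>
                 t \<circ> \<delta>' \<circ> inv_into UNIV t = (\<lambda>x. char_value w \<alpha> *s \<delta>' x))}"

text \<open>The exponential of an endomorphism \<open>\<delta>\<close> with \<open>\<delta> \<circ> \<delta> \<circ> \<delta> = 0\<close>.\<close>

definition exp_nilp :: "('f::field \<Rightarrow> 'v::ab_group_add \<Rightarrow> 'v) \<Rightarrow> ('v \<Rightarrow> 'v) \<Rightarrow> 'v \<Rightarrow> 'v" where
  "exp_nilp s \<delta> x = x + \<delta> x + s (1 / 2) (\<delta> (\<delta> x))"

text \<open>The commutator of \<open>L\<^sub>a\<close> and \<open>R\<^sub>c\<close>.\<close>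

definition comm_LR :: "('v \<Rightarrow> 'v \<Rightarrow> 'v::ab_group_add) \<Rightarrow> 'v \<Rightarrow> 'v \<Rightarrow> 'v \<Rightarrow> 'v" where
  "comm_LR mul a c x = mul a (mul x c) - mul (mul a x) c"

definition ad :: "('v \<Rightarrow> 'v \<Rightarrow> 'v::ab_group_add) \<Rightarrow> 'v \<Rightarrow> 'v \<Rightarrow> 'v" where
  "ad mul a x = mul a x - mul x a"

text \<open>
  The list \<open>ks\<close> is the Segre symbol of \<open>N\<close> if there is a basis consisting of the Jordan chains
  \<open>x\<^sub>i, N x\<^sub>i, \<dots>, N\<^sup>k\<^sup>-\<^sup>1 x\<^sub>i\<close> with \<open>k = ks ! i\<close> and \<open>N\<^sup>k x\<^sub>i = 0\<close>.
\<close>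

definition segre_symbol ::
    "('f::field \<Rightarrow> 'v::ab_group_add \<Rightarrow> 'v) \<Rightarrow> ('v \<Rightarrow> 'v) \<Rightarrow> nat list \<Rightarrow> bool" where
  "segre_symbol s N ks \<longleftrightarrow> Vector_Spaces.linear s s N \<and> (\<forall>k\<in>set ks. k > 0) \<and>
     (\<exists>x :: nat \<Rightarrow> 'v.
        (let I = {(i, j). i < length ks \<and> j < ks ! i}; c = (\<lambda>(i, j). (N ^^ j) (x i))
         in inj_on c I \<and> \<not> Modules.module.dependent s (c ` I) \<and>
            Modules.module.span s (c ` I) = UNIV) \<and>
        (\<forall>i < length ks. (N ^^ (ks ! i)) (x i) = 0))"

definition algebraically_closed_field :: "'f::field itself \<Rightarrow> bool" where
  "algebraically_closed_field _ \<longleftrightarrow> (\<forall>p :: 'f poly. degree p > 0 \<longrightarrow> (\<exists>x. poly p x = 0))"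


subsection \<open>The normal forms\<close>

definition long_root_form :: "(3 \<Rightarrow> 'v::ab_group_add) \<Rightarrow> ('v \<Rightarrow> 'v) \<Rightarrow> bool" where
  "long_root_form u \<tau> \<longleftrightarrow> \<tau> (u 1) = u 1 \<and> \<tau> (u 2) = u 2 \<and> \<tau> (u 3) = u 3 + u 2"

definition short_root_form ::
    "'v::ab_group_add \<Rightarrow> 'v \<Rightarrow> (3 \<Rightarrow> 'v) \<Rightarrow> (3 \<Rightarrow> 'v) \<Rightarrow> ('v \<Rightarrow> 'v) \<Rightarrow> bool" where
  "short_root_form e1 e2 u v \<tau> \<longleftrightarrow>
     \<tau> (u 1) = u 1 \<and> \<tau> (u 2) = u 2 \<and> \<tau> (u 3) = u 3 + v 3 - (e1 - e2)"

definition mixed_form ::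
    "'v::ab_group_add \<Rightarrow> 'v \<Rightarrow> (3 \<Rightarrow> 'v) \<Rightarrow> (3 \<Rightarrow> 'v) \<Rightarrow> ('v \<Rightarrow> 'v) \<Rightarrow> bool" where
  "mixed_form e1 e2 u v \<tau> \<longleftrightarrow>
     \<tau> (u 1) = u 1 \<and> \<tau> (u 2) = u 2 \<and> \<tau> (u 3) = u 3 + u 2 + v 3 - (e1 - e2)"

end

theory Submission
  imports Defs
begin

text \<open>
  Put \<open>N = \<tau> - 1\<close>. In characteristic \<open>3\<close>, \<open>N\<^sup>3 = 0\<close> and \<open>N\<^sup>2 = 1 + \<tau> + \<tau>\<^sup>2\<close> is self-adjoint, so that
  \<open>B(x, y) = \<langle>N\<^sup>2 x, y\<rangle>\<close> is a symmetric bilinear form. If \<open>N\<^sup>2 = 0\<close>, the image of \<open>N\<close> is totally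
  isotropic with trivial multiplication, and suitable \<open>u\<^sub>3\<close>, \<open>u\<^sub>2 = N u\<^sub>3\<close> and a fixed \<open>u\<^sub>1\<close> generate a canonical basis.
  If \<open>B\<close> has rank at least two, two Jordan blocks of size \<open>3\<close> span a nondegenerate subspace whose
  complement is fixed, and a quadratic etale subalgebra appears there. If \<open>B\<close> has rank one, a vector
  \<open>u\<^sub>3\<close> can be normalized so that \<open>u\<^sub>3\<close> and \<open>v\<^sub>3 = - N\<^sup>2 u\<^sub>3\<close> extend to a canonical basis with
  \<open>N u\<^sub>3 = v\<^sub>3 - (e\<^sub>1 - e\<^sub>2) + p\<^sub>1 u\<^sub>1 + p\<^sub>2 u\<^sub>2\<close>, which is the third or the fourth normal form.

  The Petersson algebra is a symmetric composition algebra, so every idempotent \<open>f\<close> presents it as the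
  Petersson algebra of another Cayley algebra, with unit \<open>f\<close>, for the automorphism \<open>x \<mapsto> f * (f * x)\<close>.
  The split Okubo and para-Cayley claims come from a good choice of \<open>f\<close>. An idempotent is quaternionic only
  if this automorphism again satisfies \<open>N\<^sup>2 = 0\<close>, which forces \<open>f = 1\<close> in the first case.
\<close>

section \<open>Composition identities\<close>

text \<open>In characteristic \<open>3\<close> an automorphism of order three is unipotent, so no
  eigenspace decomposition is available; the Jordan structure of \<open>N\<close> and the norm form
  have to replace it. For \<open>N\<^sup>2 \<noteq> 0\<close> the cases are separated not by the
  rank of \<open>B\<close> but by whether a fixed traceless vector of nonzero norm exists, which
  amounts to a fixed quadratic etale subalgebra; if there is none, two \<open>B\<close>-orthogonal
  anisotropic vectors cannot exist either. All bases come from one device: three traceless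
  isotropic, pairwise orthogonal vectors with \<open>\<langle>x \<cdot> y, z\<rangle> = 1\<close>
  generate a canonical basis. So a normal form is found by finding three vectors, an automorphism is
  prescribed by their images, and automorphisms with the same formulas in two canonical bases are
  conjugate. In the rank one case the scalar needed for normalization is supplied by the algebra
  itself, without extracting a root. The cyclic basis of the etale case does take a square root and
  a cube root, which is why the Okubo property is verified there over the algebraic closure.\<close>

locale octonion_algebra = hurwitz_algebra s UNIV mul one' n
  for s :: "'f::field \<Rightarrow> 'v::ab_group_add \<Rightarrow> 'v" and mul (infixl "\<cdot>" 70) and one' n +
  assumes dim8: "dim UNIV = 8" and char3: "CHAR('f) = 3"
begin

abbreviation ip :: "'v \<Rightarrow> 'v \<Rightarrow> 'f" ("\<langle>_, _\<rangle>") where "\<langle>x, y\<rangle> \<equiv> polar n x y"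
abbreviation cnj :: "'v \<Rightarrow> 'v" where "cnj \<equiv> conjugation s one' n"

lemma three: "(3::'f) = 0"
  using of_nat_CHAR[where 'a='f] char3 by simp

lemma two: "(2::'f) = - 1"
proof -
  have "(2::'f) + 1 = 0" using three by simp
  thus ?thesis by (simp only: eq_neg_iff_add_eq_0)
qed

lemma two_neq_0 [simp]: "(2::'f) \<noteq> 0"
  by (simp add: two)

lemma add_self: "x + x = - x" "x + (x + y) = y - x" for x y :: 'f
proof -
  have "x + x = 2 * x" for x :: 'f by simp
  thus *: "x + x = - x" for x :: 'f by (simp add: two)
  show "x + (x + y) = y - x" for x y :: 'f
    using *[of x] by (simp add: add.assoc[symmetric])
qed

text \<open>Since \<open>2 = - 1\<close>, doubling is negation. The doubled terms that every
  polarization produces are removed with this rule.\<close>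

lemma scale_add_self: "x + x = - x" for x :: 'v
proof -
  have "x + x = s 1 x + s 1 x" by simp
  also have "\<dots> = s (1 + 1) x" by (simp only: scale_left_distrib)
  finally show ?thesis by (simp add: two)
qed

lemma polar_comm: "\<langle>x, y\<rangle> = \<langle>y, x\<rangle>"
  by (simp add: polar_def add.commute)

lemma polar_add': "\<langle>x + y, z\<rangle> = \<langle>x, z\<rangle> + \<langle>y, z\<rangle>" "\<langle>z, x + y\<rangle> = \<langle>z, x\<rangle> + \<langle>z, y\<rangle>"
  using polar_add[of x y z] by (simp_all add: polar_comm)

lemma polar_scale': "\<langle>s a x, y\<rangle> = a * \<langle>x, y\<rangle>" "\<langle>y, s a x\<rangle> = a * \<langle>y, x\<rangle>"
  using polar_scale[of x y a] by (simp_all add: polar_comm)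

lemma polar_uminus: "\<langle>- x, y\<rangle> = - \<langle>x, y\<rangle>" "\<langle>y, - x\<rangle> = - \<langle>y, x\<rangle>"
  using polar_scale'(1)[of "- 1" x y] polar_scale'(2)[of y "- 1" x] by simp_all

lemma polar_zero [simp]: "\<langle>0, y\<rangle> = 0" "\<langle>y, 0\<rangle> = 0"
  using polar_scale'(1)[of 0 0 y] polar_scale'(2)[of y 0 0] by simp_all

lemma polar_diff: "\<langle>x - y, z\<rangle> = \<langle>x, z\<rangle> - \<langle>y, z\<rangle>" "\<langle>z, x - y\<rangle> = \<langle>z, x\<rangle> - \<langle>z, y\<rangle>"
  using polar_add'(1)[of x "- y" z] polar_add'(2)[of z x "- y"] by (simp_all add: polar_uminus)

lemma mul_add: "(x + y) \<cdot> z = x \<cdot> z + y \<cdot> z" "z \<cdot> (x + y) = z \<cdot> x + z \<cdot> y"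
  by (simp_all add: mul_add_left mul_add_right)

lemma mul_scale: "s a x \<cdot> y = s a (x \<cdot> y)" "x \<cdot> s a y = s a (x \<cdot> y)"
  by (simp_all add: mul_scale_left mul_scale_right)

lemma mul_uminus: "- x \<cdot> y = - (x \<cdot> y)" "x \<cdot> - y = - (x \<cdot> y)"
  using mul_scale(1)[of "- 1" x y] mul_scale(2)[of x "- 1" y] by simp_all

lemma mul_zero [simp]: "0 \<cdot> x = 0" "x \<cdot> 0 = 0"
  using mul_scale(1)[of 0 0 x] mul_scale(2)[of x 0 0] by simp_all

lemma mul_diff: "(x - y) \<cdot> z = x \<cdot> z - y \<cdot> z" "z \<cdot> (x - y) = z \<cdot> x - z \<cdot> y"
  using mul_add(1)[of x "- y" z] mul_add(2)[of z x "- y"] by (simp_all add: mul_uminus)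

lemma mul_one_simps [simp]: "one' \<cdot> x = x" "x \<cdot> one' = x"
  by (simp_all add: one_mul mul_one)

lemmas bilin = polar_add' polar_scale' polar_uminus polar_diff mul_add mul_scale mul_uminus mul_diff
  scale_right_distrib scale_left_distrib scale_right_diff_distrib scale_left_diff_distrib

lemma norm_add: "n (x + y) = n x + n y + \<langle>x, y\<rangle>"
  by (simp add: polar_def)

lemma norm_zero [simp]: "n 0 = 0"
  using norm_scale[of 0 0] by simp

lemma norm_uminus [simp]: "n (- x) = n x"
  using norm_scale[of x "- 1"] by simp

lemma norm_diff: "n (x - y) = n x + n y - \<langle>x, y\<rangle>"
  using norm_add[of x "- y"] by (simp add: polar_uminus)

lemma norm_scale': "n (s a x) = a * a * n x"
  by (simp add: norm_scale power2_eq_square)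

text \<open>The norm is minus the diagonal of its polar form, so identities for \<open>n\<close> may
  be derived from bilinear ones.\<close>

lemma polar_self: "\<langle>x, x\<rangle> = - n x"
proof -
  have "\<langle>x, x\<rangle> = n (s 2 x) - 2 * n x"
    using scale_left_distrib[of 1 1 x] by (simp add: polar_def algebra_simps)
  thus ?thesis by (simp add: norm_scale two)
qed

lemma norm_mult: "n (x \<cdot> y) = n x * n y"
  by (simp add: norm_mul)

lemma polar_eqI: "(\<And>z. \<langle>x, z\<rangle> = \<langle>y, z\<rangle>) \<Longrightarrow> x = y"
  using nonsingular[of "x - y"] by (simp add: polar_diff)

lemma polar_neq_0: "x \<noteq> 0 \<Longrightarrow> \<exists>z. \<langle>x, z\<rangle> = 1"
proof -
  assume "x \<noteq> 0"
  then obtain z where "\<langle>x, z\<rangle> \<noteq> 0" using nonsingular[of x] by auto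
  hence "\<langle>x, s (1 / \<langle>x, z\<rangle>) z\<rangle> = 1" by (simp add: polar_scale')
  thus ?thesis ..
qed

lemma one_neq_0: "one' \<noteq> 0"
proof
  assume "one' = 0"
  hence "x = 0" for x :: 'v using mul_one_simps(1)[of x] by simp
  hence "UNIV = {0::'v}" by auto
  hence "dim UNIV \<le> card ({}::'v set)" by (intro dim_le_card) auto
  thus False using dim8 by simp
qed

text \<open>Multiplicativity gives only \<open>n one' * n x = n x\<close>. A value other than
  \<open>1\<close> would make \<open>n\<close> vanish identically, against nonsingularity.\<close>

lemma norm_one [simp]: "n one' = 1"
proof (rule ccontr)
  assume 1: "n one' \<noteq> 1"
  have "n one' * n x = n x" for x using norm_mult[of one' x] by simp
  hence "n x = 0" for x using 1 norm_mult[of one' one'] by fastforce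
  thus False using one_neq_0 polar_neq_0[of one'] by (auto simp: polar_def)
qed

lemma polar_mul_left: "\<langle>x \<cdot> y, x \<cdot> z\<rangle> = n x * \<langle>y, z\<rangle>"
  by (simp add: polar_def norm_mult mul_add[symmetric] algebra_simps)

lemma polar_mul_right: "\<langle>y \<cdot> x, z \<cdot> x\<rangle> = n x * \<langle>y, z\<rangle>"
  by (simp add: polar_def norm_mult mul_add[symmetric] algebra_simps)

text \<open>Full linearization of the multiplicative norm. Setting its third or fourth argument to
  \<open>one'\<close> yields the adjoints of left and right multiplication, and from these all
  properties of conjugation.\<close>

lemma polar_exchange: "\<langle>x \<cdot> y, z \<cdot> w\<rangle> + \<langle>x \<cdot> w, z \<cdot> y\<rangle> = \<langle>x, z\<rangle> * \<langle>y, w\<rangle>"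
  using polar_mul_left[of "x + z" y w] polar_mul_left[of x y w] polar_mul_left[of z y w]
  by (simp add: bilin norm_add algebra_simps polar_comm)

lemma polar_one_one: "\<langle>one', one'\<rangle> = - 1"
  by (simp add: polar_self)

lemma adjoint_left: "\<langle>x \<cdot> y, z\<rangle> = \<langle>y, cnj x \<cdot> z\<rangle>"
  using polar_exchange[of x y one' z]
  by (simp add: conjugation_def bilin algebra_simps polar_comm)

lemma adjoint_right: "\<langle>x \<cdot> y, z\<rangle> = \<langle>x, z \<cdot> cnj y\<rangle>"
  using polar_exchange[of x y z one']
  by (simp add: conjugation_def bilin algebra_simps polar_comm)

text \<open>The substitute for associativity: pairing with an arbitrary \<open>z\<close> moves
  \<open>cnj x\<close> to the other side, where \<open>polar_mul_left\<close> applies.\<close>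

lemma cnj_mul_mul: "cnj x \<cdot> (x \<cdot> y) = s (n x) y"
proof (rule polar_eqI)
  fix z
  have "\<langle>cnj x \<cdot> (x \<cdot> y), z\<rangle> = \<langle>x \<cdot> z, x \<cdot> y\<rangle>"
    using adjoint_left[of x z "x \<cdot> y"] by (simp add: polar_comm)
  thus "\<langle>cnj x \<cdot> (x \<cdot> y), z\<rangle> = \<langle>s (n x) y, z\<rangle>"
    by (simp add: polar_mul_left polar_scale' polar_comm)
qed

lemma mul_mul_cnj: "(y \<cdot> x) \<cdot> cnj x = s (n x) y"
proof (rule polar_eqI)
  fix z
  have "\<langle>(y \<cdot> x) \<cdot> cnj x, z\<rangle> = \<langle>z \<cdot> x, y \<cdot> x\<rangle>"
    using adjoint_right[of z x "y \<cdot> x"] by (simp add: polar_comm)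
  thus "\<langle>(y \<cdot> x) \<cdot> cnj x, z\<rangle> = \<langle>s (n x) y, z\<rangle>"
    by (simp add: polar_mul_right polar_scale' polar_comm)
qed

lemma cnj_add: "cnj (x + y) = cnj x + cnj y"
  by (simp add: conjugation_def bilin)

lemma cnj_scale: "cnj (s a x) = s a (cnj x)"
  by (simp add: conjugation_def bilin)

lemma cnj_one [simp]: "cnj one' = one'"
  by (simp add: conjugation_def polar_one_one scale_add_self[symmetric])

lemma cnj_cnj [simp]: "cnj (cnj x) = x"
  by (simp add: conjugation_def polar_diff polar_scale' polar_one_one two)

lemma polar_cnj: "\<langle>cnj x, cnj y\<rangle> = \<langle>x, y\<rangle>"
  by (simp add: conjugation_def bilin polar_one_one polar_comm algebra_simps three)

lemma norm_cnj [simp]: "n (cnj x) = n x"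
  using polar_cnj[of x x] by (simp add: polar_self)

lemma cnj_mul: "cnj (x \<cdot> y) = cnj y \<cdot> cnj x"
proof (rule polar_eqI)
  fix z
  have "\<langle>cnj (x \<cdot> y), z\<rangle> = \<langle>x \<cdot> y, cnj z\<rangle>" using polar_cnj[of "x \<cdot> y" "cnj z"] by simp
  also have "\<dots> = \<langle>y, cnj x \<cdot> cnj z\<rangle>" by (rule adjoint_left)
  also have "\<dots> = \<langle>cnj x \<cdot> cnj z, y\<rangle>" by (rule polar_comm)
  also have "\<dots> = \<langle>cnj x, y \<cdot> z\<rangle>" by (simp add: adjoint_right)
  also have "\<dots> = \<langle>y \<cdot> z, cnj x\<rangle>" by (rule polar_comm)
  also have "\<dots> = \<langle>cnj y \<cdot> cnj x, z\<rangle>" using adjoint_left[of y z "cnj x"] by (simp add: polar_comm)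
  finally show "\<langle>cnj (x \<cdot> y), z\<rangle> = \<langle>cnj y \<cdot> cnj x, z\<rangle>" .
qed

lemma cnj_traceless: "\<langle>x, one'\<rangle> = 0 \<Longrightarrow> cnj x = - x"
  by (simp add: conjugation_def)

lemma left_square: "\<langle>x, one'\<rangle> = 0 \<Longrightarrow> x \<cdot> (x \<cdot> y) = s (- n x) y"
  using cnj_mul_mul[of x y] by (simp add: cnj_traceless mul_uminus minus_equation_iff[of "x \<cdot> (x \<cdot> y)"])

lemma right_square: "\<langle>x, one'\<rangle> = 0 \<Longrightarrow> (y \<cdot> x) \<cdot> x = s (- n x) y"
  using mul_mul_cnj[of y x] by (simp add: cnj_traceless mul_uminus minus_equation_iff[of "y \<cdot> x \<cdot> x"])

lemma square: "\<langle>x, one'\<rangle> = 0 \<Longrightarrow> x \<cdot> x = s (- n x) one'"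
  using left_square[of x one'] by simp

text \<open>Polarized \<open>left_square\<close>. Left multiplications by orthogonal traceless
  vectors anticommute, as in a Clifford algebra; this is the main means of rearranging
  brackets.\<close>

lemma left_swap:
  assumes "\<langle>x, one'\<rangle> = 0" "\<langle>y, one'\<rangle> = 0"
  shows "x \<cdot> (y \<cdot> z) = - (y \<cdot> (x \<cdot> z)) - s \<langle>x, y\<rangle> z"
proof -
  have "(x + y) \<cdot> ((x + y) \<cdot> z) = s (- n (x + y)) z" using assms by (intro left_square) (simp add: bilin)
  thus ?thesis using left_square[of x z] left_square[of y z] assms
    by (simp add: bilin norm_add eq_neg_iff_add_eq_0 algebra_simps)
qed

lemma right_swap:
  assumes "\<langle>x, one'\<rangle> = 0" "\<langle>y, one'\<rangle> = 0"
  shows "(z \<cdot> x) \<cdot> y = - ((z \<cdot> y) \<cdot> x) - s \<langle>x, y\<rangle> z"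
proof -
  have "(z \<cdot> (x + y)) \<cdot> (x + y) = s (- n (x + y)) z" using assms by (intro right_square) (simp add: bilin)
  thus ?thesis using right_square[of x z] right_square[of y z] assms
    by (simp add: bilin norm_add eq_neg_iff_add_eq_0 algebra_simps)
qed

lemma anticommute:
  "\<langle>x, one'\<rangle> = 0 \<Longrightarrow> \<langle>y, one'\<rangle> = 0 \<Longrightarrow> x \<cdot> y = - (y \<cdot> x) - s \<langle>x, y\<rangle> one'"
  using left_swap[of x y one'] by simp

lemma adjoint_left0: "\<langle>x, one'\<rangle> = 0 \<Longrightarrow> \<langle>x \<cdot> y, z\<rangle> = - \<langle>y, x \<cdot> z\<rangle>"
  by (simp add: adjoint_left cnj_traceless bilin)

lemma adjoint_right0: "\<langle>y, one'\<rangle> = 0 \<Longrightarrow> \<langle>x \<cdot> y, z\<rangle> = - \<langle>x, z \<cdot> y\<rangle>"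
  by (simp add: adjoint_right cnj_traceless bilin)

lemma isotropic_traceless_partner:
  assumes "y \<noteq> 0" "n y = 0" "\<langle>y, one'\<rangle> = 0"
  shows "\<exists>x. \<langle>x, one'\<rangle> = 0 \<and> n x = 0 \<and> \<langle>x, y\<rangle> = 1"
proof -
  obtain w where w: "\<langle>y, w\<rangle> = 1" using polar_neq_0 assms by blast
  \<comment> \<open>The trace is removed with a plus sign because
    \<open>\<langle>one', one'\<rangle> = - 1\<close>. Subtracting \<open>n w'\<close> times the
    isotropic \<open>y\<close> then removes the norm, as
    \<open>\<langle>w', y\<rangle> = 1\<close>.\<close>
  define w' where "w' = w + s \<langle>w, one'\<rangle> one'"
  define x where "x = w' - s (n w') y"
  have "\<langle>w', y\<rangle> = 1" "\<langle>w', one'\<rangle> = 0" using w assms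
    by (simp_all add: w'_def bilin polar_comm polar_one_one)
  hence "\<langle>x, one'\<rangle> = 0 \<and> n x = 0 \<and> \<langle>x, y\<rangle> = 1" using assms
    by (simp add: x_def bilin norm_diff norm_scale' polar_self)
  thus ?thesis ..
qed

end


section \<open>Linear algebra of the norm form\<close>

context vector_space
begin

lemma linear_endoI:
  assumes "\<And>x y. T (x + y) = T x + T y" "\<And>a x. T (scale a x) = scale a (T x)"
  shows "Vector_Spaces.linear scale scale T"
  by unfold_locales (use assms in simp_all)

text \<open>Coefficients are attached to indices, so no distinctness has to be known beforehand:
  equal vectors at \<open>i\<close> and \<open>j\<close> would give a relation with coefficients
  \<open>1\<close> and \<open>- 1\<close>.\<close>

lemma family_independent:
  assumes fin: "finite I" and ind: "\<And>a. (\<Sum>i\<in>I. scale (a i) (c i)) = 0 \<Longrightarrow> \<forall>i\<in>I. a i = 0"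
  shows "inj_on c I" and "independent (c ` I)"
proof -
  show inj: "inj_on c I"
  proof (rule inj_onI, rule ccontr)
    fix i j assume ij: "i \<in> I" "j \<in> I" "c i = c j" "i \<noteq> j"
    define a where "a k = (if k = i then 1 else 0) - (if k = j then 1 else (0::'a))" for k
    have "(\<Sum>k\<in>I. scale (a k) (c k)) =
        (\<Sum>k\<in>I. if k = i then c k else 0) - (\<Sum>k\<in>I. if k = j then c k else 0)"
      unfolding sum_subtractf[symmetric] by (rule sum.cong) (auto simp: a_def)
    also have "\<dots> = 0" using ij fin by simp
    finally have "a i = 0" using ind ij(1) by blast
    thus False using ij by (simp add: a_def)
  qed
  show "independent (c ` I)"
  proof (rule independent_if_scalars_zero)
    fix f x assume f: "(\<Sum>x\<in>c ` I. scale (f x) x) = 0" and x: "x \<in> c ` I"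
    have "(\<Sum>i\<in>I. scale (f (c i)) (c i)) = 0" using f by (simp add: sum.reindex[OF inj])
    thus "f x = 0" using ind[of "\<lambda>i. f (c i)"] x by auto
  qed (use fin in simp)
qed

end

context octonion_algebra
begin

definition some_basis :: "'v set" where
  "some_basis = (SOME B. independent B \<and> span B = UNIV)"

lemma some_basis: "independent some_basis" "span some_basis = UNIV" "finite some_basis"
proof -
  have "\<exists>B. independent B \<and> span B = UNIV"
    using basis_exists[of UNIV] by (metis top.extremum_uniqueI)
  hence *: "independent some_basis \<and> span some_basis = UNIV"
    unfolding some_basis_def by (rule someI_ex)
  thus "independent some_basis" "span some_basis = UNIV" by auto
  have "card some_basis = 8" using * dim8 basis_card_eq_dim[of some_basis UNIV] by simp
  thus "finite some_basis" using card.infinite by fastforce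
qed

sublocale finite_dimensional_vector_space s some_basis
  by unfold_locales (use some_basis in auto)

lemma family_card_le:
  assumes "finite I" and "\<And>a. (\<Sum>i\<in>I. s (a i) (c i)) = 0 \<Longrightarrow> \<forall>i\<in>I. a i = 0"
  shows "card I \<le> 8"
  using family_independent[OF assms] independent_card_le_dim[of "c ` I" UNIV] dim8
  by (simp add: card_image)

lemma family_span:
  assumes "finite I" and "\<And>a. (\<Sum>i\<in>I. s (a i) (c i)) = 0 \<Longrightarrow> \<forall>i\<in>I. a i = 0"
    and "card I = 8"
  shows "span (c ` I) = UNIV"
  using family_independent[OF assms(1,2)] card_ge_dim_independent[of "c ` I" UNIV] dim8 assms(3)
  by (auto simp: card_image)

lemma polar_sum: "\<langle>sum f A, y\<rangle> = (\<Sum>i\<in>A. \<langle>f i, y\<rangle>)" "\<langle>y, sum f A\<rangle> = (\<Sum>i\<in>A. \<langle>y, f i\<rangle>)"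
  by (induction A rule: infinite_finite_induct) (simp_all add: polar_add')

lemma polar_span:
  assumes "x \<in> span S" "\<And>y. y \<in> S \<Longrightarrow> \<langle>y, z\<rangle> = 0"
  shows "\<langle>x, z\<rangle> = 0"
  using assms(1) by (induction rule: span_induct_alt) (use assms(2) in \<open>simp_all add: bilin\<close>)

text \<open>\<open>T z\<close> records the values of the pairing with \<open>z\<close> on a basis.
  It is injective by nonsingularity, hence surjective by finite dimension; a preimage of the vector
  recording the values of \<open>\<phi>\<close> represents \<open>\<phi>\<close>.\<close>

lemma functional_eq_polar:
  assumes add: "\<And>x y. \<phi> (x + y) = \<phi> x + \<phi> y" and scale: "\<And>a x. \<phi> (s a x) = a * \<phi> x"
  shows "\<exists>z. \<forall>x. \<phi> x = \<langle>z, x\<rangle>"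
proof -
  define T where "T z = (\<Sum>b\<in>some_basis. s \<langle>z, b\<rangle> b)" for z
  have coeff: "\<langle>z, b\<rangle> = f b" if "T z = (\<Sum>b\<in>some_basis. s (f b) b)" "b \<in> some_basis" for z f b
  proof -
    have "(\<Sum>b\<in>some_basis. s (\<langle>z, b\<rangle> - f b) b) = 0"
      using that(1) by (simp add: T_def scale_left_diff_distrib sum_subtractf)
    thus ?thesis using independentD[OF some_basis(1,3) order.refl _ that(2)] by fastforce
  qed
  have add_T: "T (x + y) = T x + T y" and scale_T: "T (s a x) = s a (T x)" for x y a
    by (simp_all add: T_def bilin sum.distrib scale_sum_right)
  have "x = y" if "T x = T y" for x y
  proof (rule polar_eqI)
    fix z
    have "\<langle>z, x - y\<rangle> = 0"
      by (rule polar_span[of _ some_basis])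
        (use coeff[of x "\<lambda>b. \<langle>y, b\<rangle>"] that in \<open>simp_all add: some_basis T_def bilin polar_comm\<close>)
    thus "\<langle>x, z\<rangle> = \<langle>y, z\<rangle>" by (simp add: polar_comm polar_diff)
  qed
  hence "surj T"
    by (intro linear_inj_imp_surj linear_endoI injI) (auto simp: add_T scale_T)
  then obtain z where z: "T z = (\<Sum>b\<in>some_basis. s (\<phi> b) b)" by (metis surjD)
  have "\<phi> x = \<langle>z, x\<rangle>" for x
  proof -
    have "x \<in> span some_basis" by (simp add: some_basis)
    thus ?thesis
    proof (induction rule: span_induct_alt)
      case base
      show ?case using scale[of 0 0] by simp
    qed (simp add: add scale bilin coeff[OF z])
  qed
  thus ?thesis by blast
qed

text \<open>The vector represents the coordinate functional of \<open>z\<close> in a basis that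
  extends \<open>z\<close> and a basis of the span of \<open>S\<close>.\<close>

lemma separating_vector:
  assumes "z \<notin> span S"
  shows "\<exists>u. (\<forall>y\<in>S. \<langle>u, y\<rangle> = 0) \<and> \<langle>u, z\<rangle> = 1"
proof -
  obtain B where B: "B \<subseteq> S" "independent B" "S \<subseteq> span B" using basis_exists by metis
  have zB: "z \<notin> span B" using assms B(1) span_mono by blast
  hence ind: "independent (insert z B)" using B(2) by (rule independent_insertI)
  define E where "E = extend_basis (insert z B)"
  have E: "independent E" "span E = UNIV" "insert z B \<subseteq> E"
    unfolding E_def using extend_basis_superset[OF ind] independent_extend_basis[OF ind]
      span_extend_basis[OF ind] by auto
  obtain u where u: "representation E x z = \<langle>u, x\<rangle>" for x
    using functional_eq_polar[of "\<lambda>x. representation E x z"] E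
    by (auto simp: representation_add representation_scale)
  have "\<langle>y, u\<rangle> = 0" if "y \<in> B" for y
  proof -
    have "y \<noteq> z" using that zB span_base by blast
    thus ?thesis using representation_basis[of E y] E that u[of y] by (auto simp: polar_comm)
  qed
  hence "\<langle>y, u\<rangle> = 0" if "y \<in> S" for y using polar_span B(3) that by blast
  moreover have "\<langle>u, z\<rangle> = 1" using representation_basis[of E z] E u[of z] by auto
  ultimately show ?thesis by (metis polar_comm)
qed

lemma dim_orthogonal:
  assumes "subspace A"
  shows "dim A \<le> dim (A \<inter> {x. \<langle>x, b\<rangle> = 0}) + 1"
proof (cases "\<forall>x\<in>A. \<langle>x, b\<rangle> = 0")
  case True
  hence "A \<inter> {x. \<langle>x, b\<rangle> = 0} = A" by auto
  thus ?thesis by simp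
next
  case False
  then obtain a where a: "a \<in> A" "\<langle>a, b\<rangle> \<noteq> 0" by auto
  let ?W = "A \<inter> {x. \<langle>x, b\<rangle> = 0}"
  have "A \<subseteq> span (insert a ?W)"
  proof
    fix x assume x: "x \<in> A"
    define c where "c = \<langle>x, b\<rangle> / \<langle>a, b\<rangle>"
    have "x - s c a \<in> ?W" using assms x a
      by (auto simp: bilin c_def intro: subspace_diff subspace_scale)
    hence "s c a + (x - s c a) \<in> span (insert a ?W)"
      by (intro span_add span_scale span_base) auto
    thus "x \<in> span (insert a ?W)" by simp
  qed
  hence "dim A \<le> dim (insert a ?W)" by (rule dim_mono)
  also have "\<dots> \<le> dim ?W + 1" by (simp add: dim_insert)
  finally show ?thesis .
qed

lemma subspace_orthogonal: "subspace A \<Longrightarrow> subspace (A \<inter> {x. \<langle>x, b\<rangle> = 0})"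
  by (auto simp: subspace_def bilin)

lemma exists_orthogonal:
  assumes "finite T" "subspace A" "card T < dim A"
  shows "\<exists>x\<in>A. x \<noteq> 0 \<and> (\<forall>t\<in>T. \<langle>x, t\<rangle> = 0)"
  using assms
proof (induction T arbitrary: A rule: finite_induct)
  case empty
  hence "\<not> A \<subseteq> {0}" using dim_eq_0[of A, THEN iffD2] by (metis card.empty less_irrefl)
  thus ?case by auto
next
  case (insert t T)
  have "card T < dim (A \<inter> {x. \<langle>x, t\<rangle> = 0})"
    using dim_orthogonal[of A t] insert.prems insert.hyps by simp
  from insert.IH[OF subspace_orthogonal this] insert.prems show ?case by auto
qed

text \<open>Block sizes adding up to \<open>8\<close> make spanning a consequence of
  independence.\<close>

lemma segre_symbolI:
  assumes "Vector_Spaces.linear s s N" "\<And>k. k \<in> set ks \<Longrightarrow> 0 < k" "sum_list ks = 8"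
    and "\<And>i. i < length ks \<Longrightarrow> (N ^^ (ks ! i)) (x i) = 0"
    and ind: "\<And>a. (\<Sum>i<length ks. \<Sum>j<ks ! i. s (a i j) ((N ^^ j) (x i))) = 0 \<Longrightarrow>
          \<forall>i<length ks. \<forall>j<ks ! i. a i j = 0"
  shows "segre_symbol s N ks"
proof -
  define I where "I = {(i, j). i < length ks \<and> j < ks ! i}"
  define c where "c = (\<lambda>(i, j). (N ^^ j) (x i))"
  have I: "I = Sigma {..<length ks} (\<lambda>i. {..<ks ! i})" by (auto simp: I_def)
  have fin: "finite I" by (simp add: I)
  have "card I = (\<Sum>i<length ks. ks ! i)" by (simp add: I)
  also have "\<dots> = 8" using assms(3) by (simp add: sum_list_sum_nth atLeast0LessThan)
  finally have card: "card I = 8" .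
  have *: "\<forall>p\<in>I. a p = 0" if "(\<Sum>p\<in>I. s (a p) (c p)) = 0" for a
  proof -
    have "(\<Sum>i<length ks. \<Sum>j<ks ! i. s (a (i, j)) ((N ^^ j) (x i))) = 0"
      using that by (simp add: I sum.Sigma c_def split_def)
    from ind[OF this] show ?thesis by (auto simp: I_def)
  qed
  show ?thesis
    unfolding segre_symbol_def Let_def using assms(1,2,4)
      family_independent[OF fin *] family_span[OF fin * card]
    by (auto intro!: exI[of _ x] simp flip: I_def c_def)
qed

end


section \<open>Canonical bases and coordinates\<close>

lemma index3:
  "(1::3) + 1 = 2" "(2::3) + 1 = 3" "(3::3) + 1 = 1" "(1::3) + 2 = 3" "(2::3) + 2 = 1" "(3::3) + 2 = 2"
  "(1::3) \<noteq> 2" "(1::3) \<noteq> 3" "(2::3) \<noteq> 1" "(2::3) \<noteq> 3" "(3::3) \<noteq> 1" "(3::3) \<noteq> 2"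
  "(4::3) = 1" "(5::3) = 2"
  by simp_all

text \<open>
  The coordinate map \<open>oct\<close> is a parameter rather than a definition so that it stays opaque: as an
  abbreviation depending on \<open>e1\<close>, \<open>e2\<close>, \<open>u\<close>, \<open>v\<close> it would make the rewrite rules \<open>oct_basis\<close> loop.
\<close>

locale octonion_frame = octonion_algebra s mul one' n
  for s :: "'f::field \<Rightarrow> 'v::ab_group_add \<Rightarrow> 'v" and mul (infixl "\<cdot>" 70) and one' n +
  fixes e1 e2 :: 'v and u v :: "3 \<Rightarrow> 'v" and oct :: "'f \<Rightarrow> 'f \<Rightarrow> 'f \<Rightarrow> 'f \<Rightarrow> 'f \<Rightarrow> 'f \<Rightarrow> 'f \<Rightarrow> 'f \<Rightarrow> 'v"
  assumes canonical: "canonical_basis s mul one' e1 e2 u v"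
    and oct_def: "oct a b p1 p2 p3 q1 q2 q3 = s a e1 + s b e2 + s p1 (u 1) + s p2 (u 2) + s p3 (u 3) +
      s q1 (v 1) + s q2 (v 2) + s q3 (v 3)"
begin

lemma one_eq: "one' = e1 + e2"
  using canonical by (auto simp: canonical_basis_def)

lemma basis_mul:
  "e1 \<cdot> e1 = e1" "e2 \<cdot> e2 = e2" "e1 \<cdot> e2 = 0" "e2 \<cdot> e1 = 0"
  "e1 \<cdot> u 1 = u 1" "e1 \<cdot> u 2 = u 2" "e1 \<cdot> u 3 = u 3" "u 1 \<cdot> e2 = u 1" "u 2 \<cdot> e2 = u 2" "u 3 \<cdot> e2 = u 3"
  "e2 \<cdot> v 1 = v 1" "e2 \<cdot> v 2 = v 2" "e2 \<cdot> v 3 = v 3" "v 1 \<cdot> e1 = v 1" "v 2 \<cdot> e1 = v 2" "v 3 \<cdot> e1 = v 3"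
  "e2 \<cdot> u 1 = 0" "e2 \<cdot> u 2 = 0" "e2 \<cdot> u 3 = 0" "u 1 \<cdot> e1 = 0" "u 2 \<cdot> e1 = 0" "u 3 \<cdot> e1 = 0"
  "e1 \<cdot> v 1 = 0" "e1 \<cdot> v 2 = 0" "e1 \<cdot> v 3 = 0" "v 1 \<cdot> e2 = 0" "v 2 \<cdot> e2 = 0" "v 3 \<cdot> e2 = 0"
  "u 1 \<cdot> u 2 = v 3" "u 2 \<cdot> u 3 = v 1" "u 3 \<cdot> u 1 = v 2"
  "u 2 \<cdot> u 1 = - v 3" "u 3 \<cdot> u 2 = - v 1" "u 1 \<cdot> u 3 = - v 2"
  "v 1 \<cdot> v 2 = u 3" "v 2 \<cdot> v 3 = u 1" "v 3 \<cdot> v 1 = u 2"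
  "v 2 \<cdot> v 1 = - u 3" "v 3 \<cdot> v 2 = - u 1" "v 1 \<cdot> v 3 = - u 2"
  "u 1 \<cdot> u 1 = 0" "u 2 \<cdot> u 2 = 0" "u 3 \<cdot> u 3 = 0" "v 1 \<cdot> v 1 = 0" "v 2 \<cdot> v 2 = 0" "v 3 \<cdot> v 3 = 0"
  "u 1 \<cdot> v 1 = - e1" "u 2 \<cdot> v 2 = - e1" "u 3 \<cdot> v 3 = - e1"
  "v 1 \<cdot> u 1 = - e2" "v 2 \<cdot> u 2 = - e2" "v 3 \<cdot> u 3 = - e2"
  "u 1 \<cdot> v 2 = 0" "u 1 \<cdot> v 3 = 0" "u 2 \<cdot> v 1 = 0" "u 2 \<cdot> v 3 = 0" "u 3 \<cdot> v 1 = 0" "u 3 \<cdot> v 2 = 0"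
  "v 1 \<cdot> u 2 = 0" "v 1 \<cdot> u 3 = 0" "v 2 \<cdot> u 1 = 0" "v 2 \<cdot> u 3 = 0" "v 3 \<cdot> u 1 = 0" "v 3 \<cdot> u 2 = 0"
  using canonical unfolding canonical_basis_def forall_3 index3 by (simp_all add: index3)

lemma oct_zero: "0 = oct 0 0 0 0 0 0 0 0"
  and oct_one: "one' = oct 1 1 0 0 0 0 0 0"
  and oct_basis:
    "e1 = oct 1 0 0 0 0 0 0 0" "e2 = oct 0 1 0 0 0 0 0 0"
    "u 1 = oct 0 0 1 0 0 0 0 0" "u 2 = oct 0 0 0 1 0 0 0 0" "u 3 = oct 0 0 0 0 1 0 0 0"
    "v 1 = oct 0 0 0 0 0 1 0 0" "v 2 = oct 0 0 0 0 0 0 1 0" "v 3 = oct 0 0 0 0 0 0 0 1"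
  by (simp_all add: oct_def one_eq)

lemma oct_add: "oct a b p1 p2 p3 q1 q2 q3 + oct a' b' p1' p2' p3' q1' q2' q3' =
    oct (a + a') (b + b') (p1 + p1') (p2 + p2') (p3 + p3') (q1 + q1') (q2 + q2') (q3 + q3')"
  by (simp add: oct_def bilin ac_simps)

lemma oct_uminus: "- oct a b p1 p2 p3 q1 q2 q3 = oct (- a) (- b) (- p1) (- p2) (- p3) (- q1) (- q2) (- q3)"
  by (simp add: oct_def)

lemma oct_diff: "oct a b p1 p2 p3 q1 q2 q3 - oct a' b' p1' p2' p3' q1' q2' q3' =
    oct (a - a') (b - b') (p1 - p1') (p2 - p2') (p3 - p3') (q1 - q1') (q2 - q2') (q3 - q3')"
  using oct_add[of a b p1 p2 p3 q1 q2 q3 "- a'" "- b'" "- p1'" "- p2'" "- p3'" "- q1'" "- q2'" "- q3'"]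
  by (simp flip: oct_uminus)

lemma oct_scale: "s c (oct a b p1 p2 p3 q1 q2 q3) =
    oct (c * a) (c * b) (c * p1) (c * p2) (c * p3) (c * q1) (c * q2) (c * q3)"
  by (simp add: oct_def bilin)

lemma oct_mul: "oct a b p1 p2 p3 q1 q2 q3 \<cdot> oct a' b' p1' p2' p3' q1' q2' q3' =
    oct (a * a' - p1 * q1' - p2 * q2' - p3 * q3') (b * b' - q1 * p1' - q2 * p2' - q3 * p3')
      (a * p1' + b' * p1 + q2 * q3' - q3 * q2') (a * p2' + b' * p2 + q3 * q1' - q1 * q3')
      (a * p3' + b' * p3 + q1 * q2' - q2 * q1') (b * q1' + a' * q1 + p2 * p3' - p3 * p2')
      (b * q2' + a' * q2 + p3 * p1' - p1 * p3') (b * q3' + a' * q3 + p1 * p2' - p2 * p1')"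
  unfolding oct_def by (simp add: bilin basis_mul ac_simps)

lemma basis_distinct: "distinct [e1, e2, u 1, u 2, u 3, v 1, v 2, v 3]"
  and basis_independent: "independent {e1, e2, u 1, u 2, u 3, v 1, v 2, v 3}"
  and basis_span: "span {e1, e2, u 1, u 2, u 3, v 1, v 2, v 3} = UNIV"
proof -
  have *: "{e1, e2} \<union> range u \<union> range v = {e1, e2, u 1, u 2, u 3, v 1, v 2, v 3}"
    by (auto simp: UNIV_3)
  show "distinct [e1, e2, u 1, u 2, u 3, v 1, v 2, v 3]"
    using canonical unfolding canonical_basis_def Let_def * by (intro card_distinct) simp
  show "independent {e1, e2, u 1, u 2, u 3, v 1, v 2, v 3}"
    and "span {e1, e2, u 1, u 2, u 3, v 1, v 2, v 3} = UNIV"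
    using canonical unfolding canonical_basis_def Let_def * by auto
qed

lemma oct_eq_0D:
  assumes "oct a b p1 p2 p3 q1 q2 q3 = 0"
  shows "a = 0 \<and> b = 0 \<and> p1 = 0 \<and> p2 = 0 \<and> p3 = 0 \<and> q1 = 0 \<and> q2 = 0 \<and> q3 = 0"
proof -
  let ?B = "{e1, e2, u 1, u 2, u 3, v 1, v 2, v 3}"
  define f where "f x = (if x = e1 then a else if x = e2 then b else if x = u 1 then p1
    else if x = u 2 then p2 else if x = u 3 then p3 else if x = v 1 then q1 else if x = v 2 then q2 else q3)" for x
  have f: "f e1 = a" "f e2 = b" "f (u 1) = p1" "f (u 2) = p2" "f (u 3) = p3"
      "f (v 1) = q1" "f (v 2) = q2" "f (v 3) = q3"
    using basis_distinct by (auto simp: f_def)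
  have "(\<Sum>x\<in>?B. s (f x) x) = oct a b p1 p2 p3 q1 q2 q3"
    using basis_distinct by (simp add: f oct_def add.assoc)
  hence "f x = 0" if "x \<in> ?B" for x
    using independentD[OF basis_independent _ order.refl _ that, of f] assms by simp
  thus ?thesis using f by (metis insertCI)
qed

lemma oct_eq_iff: "oct a b p1 p2 p3 q1 q2 q3 = oct a' b' p1' p2' p3' q1' q2' q3' \<longleftrightarrow>
    a = a' \<and> b = b' \<and> p1 = p1' \<and> p2 = p2' \<and> p3 = p3' \<and> q1 = q1' \<and> q2 = q2' \<and> q3 = q3'"
  using oct_eq_0D[of "a - a'" "b - b'" "p1 - p1'" "p2 - p2'" "p3 - p3'" "q1 - q1'" "q2 - q2'" "q3 - q3'"]
  by (auto simp flip: oct_diff)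

lemma oct_cases: obtains a b p1 p2 p3 q1 q2 q3 where "x = oct a b p1 p2 p3 q1 q2 q3"
proof -
  have "x \<in> span {e1, e2, u 1, u 2, u 3, v 1, v 2, v 3}" by (simp add: basis_span)
  hence "\<exists>a b p1 p2 p3 q1 q2 q3. x = oct a b p1 p2 p3 q1 q2 q3"
  proof (induction rule: span_induct_alt)
    case base
    show ?case using oct_zero by blast
  next
    case (step c x y)
    have "\<exists>a b p1 p2 p3 q1 q2 q3. x = oct a b p1 p2 p3 q1 q2 q3"
      using step.hyps oct_basis by blast
    with step.IH show ?case by (fastforce simp: oct_scale oct_add)
  qed
  thus thesis using that by blast
qed

text \<open>The norm is recovered from the product. The table gives
  \<open>(s (a + b) one' - x) \<cdot> x = s q one'\<close>, and conjugation gives the same shape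
  with the true trace and norm; unless the traces agree, \<open>x\<close> is a multiple of
  \<open>one'\<close>, whose norm is known.\<close>

lemma oct_norm: "n (oct a b p1 p2 p3 q1 q2 q3) = a * b + p1 * q1 + p2 * q2 + p3 * q3"
proof -
  define x where "x = oct a b p1 p2 p3 q1 q2 q3"
  define q where "q = a * b + p1 * q1 + p2 * q2 + p3 * q3"
  have "(s (a + b) one' - x) \<cdot> x = s q one'"
    by (simp add: x_def q_def oct_one oct_scale oct_diff oct_mul oct_eq_iff algebra_simps)
  moreover have "(s \<langle>x, one'\<rangle> one' - x) \<cdot> x = s (n x) one'"
    using cnj_mul_mul[of x one'] by (simp add: conjugation_def)
  ultimately have eq: "s (a + b - \<langle>x, one'\<rangle>) x = s (q - n x) one'"
    by (simp add: bilin algebra_simps)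
  show ?thesis
  proof (cases "a + b = \<langle>x, one'\<rangle>")
    case True
    hence "q = n x" using eq one_neq_0 by simp
    thus ?thesis by (simp add: x_def q_def)
  next
    case False
    define c where "c = (q - n x) / (a + b - \<langle>x, one'\<rangle>)"
    have "s (1 / (a + b - \<langle>x, one'\<rangle>)) (s (a + b - \<langle>x, one'\<rangle>) x) = s c one'"
      unfolding eq by (simp add: c_def)
    hence x: "x = s c one'" using False by simp
    hence "a = c \<and> b = c \<and> p1 = 0 \<and> p2 = 0 \<and> p3 = 0 \<and> q1 = 0 \<and> q2 = 0 \<and> q3 = 0"
      by (simp add: x_def oct_one oct_scale oct_eq_iff)
    moreover have "n x = c * c" using x by (simp add: norm_scale')
    ultimately show ?thesis by (simp add: x_def)
  qed
qed

lemma oct_polar: "\<langle>oct a b p1 p2 p3 q1 q2 q3, oct a' b' p1' p2' p3' q1' q2' q3'\<rangle> =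
    a * b' + b * a' + p1 * q1' + q1 * p1' + p2 * q2' + q2 * p2' + p3 * q3' + q3 * p3'"
  by (simp add: polar_def oct_add oct_norm algebra_simps)

lemma oct_cnj: "cnj (oct a b p1 p2 p3 q1 q2 q3) = oct b a (- p1) (- p2) (- p3) (- q1) (- q2) (- q3)"
  by (simp add: conjugation_def oct_one oct_polar oct_scale oct_diff)

lemmas oct_simps = oct_add oct_uminus oct_diff oct_scale oct_mul oct_eq_iff oct_norm oct_polar oct_cnj

end

lemma (in octonion_algebra) frame_exists:
  assumes "canonical_basis s mul one' e1 e2 u v"
  shows "\<exists>oct. octonion_frame s mul one' n e1 e2 u v oct"
  by (rule exI[of _ "\<lambda>a b p1 p2 p3 q1 q2 q3. s a e1 + s b e2 + s p1 (u 1) + s p2 (u 2) + s p3 (u 3) +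
      s q1 (v 1) + s q2 (v 2) + s q3 (v 3)"]) (unfold_locales, fact assms, rule refl)


section \<open>Automorphisms and their action on canonical bases\<close>

context octonion_algebra
begin

lemma automorphismD:
  assumes "automorphism s mul n \<phi>"
  shows "\<phi> (x + y) = \<phi> x + \<phi> y" "\<phi> (s a x) = s a (\<phi> x)" "\<phi> (x \<cdot> y) = \<phi> x \<cdot> \<phi> y"
    "n (\<phi> x) = n x" "bij \<phi>" "\<phi> (- x) = - \<phi> x" "\<phi> (x - y) = \<phi> x - \<phi> y" "\<phi> 0 = 0"
    "\<langle>\<phi> x, \<phi> y\<rangle> = \<langle>x, y\<rangle>" "\<phi> one' = one'" "cnj (\<phi> x) = \<phi> (cnj x)" "Vector_Spaces.linear s s \<phi>"
proof -
  from assms interpret Vector_Spaces.linear s s \<phi> by (simp add: automorphism_def)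
  show add: "\<phi> (x + y) = \<phi> x + \<phi> y" and sc: "\<phi> (s a x) = s a (\<phi> x)" and "\<phi> (- x) = - \<phi> x"
    and diff: "\<phi> (x - y) = \<phi> x - \<phi> y" and "\<phi> 0 = 0" for x y a
    by (rule add scale neg diff zero)+
  show mul: "\<phi> (x \<cdot> y) = \<phi> x \<cdot> \<phi> y" and norm: "n (\<phi> x) = n x" and bij: "bij \<phi>"
    and "Vector_Spaces.linear s s \<phi>" for x y
    using assms by (auto simp: automorphism_def)
  show polar: "\<langle>\<phi> x, \<phi> y\<rangle> = \<langle>x, y\<rangle>" for x y by (simp add: polar_def norm flip: add)
  have "\<phi> one' \<cdot> \<phi> x = \<phi> x" for x by (simp flip: mul)
  hence "\<phi> one' \<cdot> one' = one'" using bij by (metis bij_pointE)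
  thus one: "\<phi> one' = one'" by simp
  have "\<langle>\<phi> x, one'\<rangle> = \<langle>x, one'\<rangle>" by (metis polar one)
  thus "cnj (\<phi> x) = \<phi> (cnj x)" by (simp add: conjugation_def diff sc one)
qed

lemma automorphismI:
  assumes "\<And>x y. \<phi> (x + y) = \<phi> x + \<phi> y" "\<And>a x. \<phi> (s a x) = s a (\<phi> x)"
    "\<And>x y. \<phi> (x \<cdot> y) = \<phi> x \<cdot> \<phi> y" "\<And>x. n (\<phi> x) = n x" "bij \<phi>"
  shows "automorphism s mul n \<phi>"
  unfolding automorphism_def using assms by (auto intro: linear_endoI)

lemma automorphism_comp:
  assumes "automorphism s mul n \<phi>" "automorphism s mul n \<psi>"
  shows "automorphism s mul n (\<phi> \<circ> \<psi>)"
  using automorphismD[OF assms(1)] automorphismD[OF assms(2)] by (intro automorphismI) (auto intro: bij_comp)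

lemma automorphism_inv:
  assumes "automorphism s mul n \<phi>"
  shows "automorphism s mul n (inv_into UNIV \<phi>)"
proof -
  note \<phi> = automorphismD[OF assms]
  have [simp]: "inv_into UNIV \<phi> (\<phi> x) = x" "\<phi> (inv_into UNIV \<phi> x) = x" for x
    using \<phi>(5) by (simp_all add: bij_is_inj bij_is_surj surj_f_inv_f)
  have eq: "inv_into UNIV \<phi> x = y" if "x = \<phi> y" for x y using that by simp
  show ?thesis
  proof (rule automorphismI)
    show "n (inv_into UNIV \<phi> x) = n x" for x using \<phi>(4)[of "inv_into UNIV \<phi> x"] by simp
  qed (auto intro!: eq bij_imp_bij_inv simp: \<phi>)
qed

end

text \<open>The basis is dual to itself up to exchanging \<open>e1\<close> with \<open>e2\<close>
  and \<open>u i\<close> with \<open>v i\<close>, hence the order of the pairings.\<close>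

lemma (in octonion_frame) coordinates:
  "x = oct \<langle>x, e2\<rangle> \<langle>x, e1\<rangle> \<langle>x, v 1\<rangle> \<langle>x, v 2\<rangle> \<langle>x, v 3\<rangle> \<langle>x, u 1\<rangle> \<langle>x, u 2\<rangle> \<langle>x, u 3\<rangle>"
  by (cases x rule: oct_cases) (simp add: oct_basis oct_polar)

lemma (in octonion_frame) linear_oct:
  assumes "\<And>x y. \<phi> (x + y) = \<phi> x + \<phi> y" "\<And>a x. \<phi> (s a x) = s a (\<phi> x)"
  shows "\<phi> (oct a b p1 p2 p3 q1 q2 q3) = s a (\<phi> e1) + s b (\<phi> e2) + s p1 (\<phi> (u 1)) +
    s p2 (\<phi> (u 2)) + s p3 (\<phi> (u 3)) + s q1 (\<phi> (v 1)) + s q2 (\<phi> (v 2)) + s q3 (\<phi> (v 3))"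
  by (simp add: oct_def assms)

lemma (in octonion_frame) automorphism_oct:
  assumes "automorphism s mul n \<phi>"
  shows "\<phi> (oct a b p1 p2 p3 q1 q2 q3) = s a (\<phi> e1) + s b (\<phi> e2) + s p1 (\<phi> (u 1)) +
    s p2 (\<phi> (u 2)) + s p3 (\<phi> (u 3)) + s q1 (\<phi> (v 1)) + s q2 (\<phi> (v 2)) + s q3 (\<phi> (v 3))"
  by (intro linear_oct automorphismD[OF assms])

lemma (in octonion_frame) automorphism_basis:
  assumes "automorphism s mul n \<phi>"
  shows "\<phi> (v 1) = \<phi> (u 2) \<cdot> \<phi> (u 3)" "\<phi> (v 2) = \<phi> (u 3) \<cdot> \<phi> (u 1)" "\<phi> (v 3) = \<phi> (u 1) \<cdot> \<phi> (u 2)"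
    "\<phi> e1 = - (\<phi> (u 3) \<cdot> \<phi> (v 3))" "\<phi> e2 = - (\<phi> (v 3) \<cdot> \<phi> (u 3))"
  using automorphismD[OF assms] by (simp_all add: basis_mul flip: automorphismD(3)[OF assms])

lemma (in octonion_frame) automorphism_eqI:
  assumes "automorphism s mul n \<phi>" "automorphism s mul n \<psi>"
    and "\<phi> (u 1) = \<psi> (u 1)" "\<phi> (u 2) = \<psi> (u 2)" "\<phi> (u 3) = \<psi> (u 3)"
  shows "\<phi> = \<psi>"
proof
  fix x
  show "\<phi> x = \<psi> x"
    by (cases x rule: oct_cases)
      (simp add: automorphism_oct[OF assms(1)] automorphism_oct[OF assms(2)] assms(3-5)
        automorphism_basis[OF assms(1)] automorphism_basis[OF assms(2)])
qed

context octonion_algebra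
begin

text \<open>Products and norms have the same coordinate formulas in every canonical basis, so the
  change of coordinates is an automorphism. Existence of the normal forms and all conjugacy claims
  rest on this transitivity.\<close>

lemma frame_transport:
  assumes "canonical_basis s mul one' e1 e2 u v" "canonical_basis s mul one' e1' e2' u' v'"
  shows "\<exists>\<phi>. automorphism s mul n \<phi> \<and> \<phi> e1 = e1' \<and> \<phi> e2 = e2' \<and> (\<forall>i. \<phi> (u i) = u' i \<and> \<phi> (v i) = v' i)"
proof -
  obtain oct where "octonion_frame s mul one' n e1 e2 u v oct" using frame_exists assms by blast
  then interpret F: octonion_frame s mul one' n e1 e2 u v oct .
  obtain oct' where "octonion_frame s mul one' n e1' e2' u' v' oct'" using frame_exists assms by blast
  then interpret F': octonion_frame s mul one' n e1' e2' u' v' oct' .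
  define \<phi> where "\<phi> x = oct' \<langle>x, e2\<rangle> \<langle>x, e1\<rangle> \<langle>x, v 1\<rangle> \<langle>x, v 2\<rangle> \<langle>x, v 3\<rangle> \<langle>x, u 1\<rangle> \<langle>x, u 2\<rangle> \<langle>x, u 3\<rangle>" for x
  have \<phi>: "\<phi> (oct a b p1 p2 p3 q1 q2 q3) = oct' a b p1 p2 p3 q1 q2 q3" for a b p1 p2 p3 q1 q2 q3
    by (simp add: \<phi>_def F.oct_basis F.oct_polar)
  have "automorphism s mul n \<phi>"
  proof (rule automorphismI)
    fix x y a
    show "\<phi> (x + y) = \<phi> x + \<phi> y" "\<phi> (x \<cdot> y) = \<phi> x \<cdot> \<phi> y"
      by (cases x rule: F.oct_cases; cases y rule: F.oct_cases;
          simp add: \<phi> F.oct_add F.oct_mul F'.oct_add F'.oct_mul)+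
    show "\<phi> (s a x) = s a (\<phi> x)" "n (\<phi> x) = n x"
      by (cases x rule: F.oct_cases; simp add: \<phi> F.oct_scale F.oct_norm F'.oct_scale F'.oct_norm)+
    show "bij \<phi>"
    proof (rule bijI)
      show "inj \<phi>"
      proof (rule injI)
        fix x y assume "\<phi> x = \<phi> y"
        thus "x = y"
          by (cases x rule: F.oct_cases; cases y rule: F.oct_cases) (simp add: \<phi> F.oct_eq_iff F'.oct_eq_iff)
      qed
      show "surj \<phi>"
        by (rule surjI[of \<phi> "\<lambda>y. oct \<langle>y, e2'\<rangle> \<langle>y, e1'\<rangle> \<langle>y, v' 1\<rangle> \<langle>y, v' 2\<rangle> \<langle>y, v' 3\<rangle> \<langle>y, u' 1\<rangle> \<langle>y, u' 2\<rangle> \<langle>y, u' 3\<rangle>"])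
          (simp only: \<phi> F'.coordinates[symmetric])
    qed
  qed
  thus ?thesis by (intro exI[of _ \<phi>]) (simp add: forall_3 F.oct_basis F'.oct_basis \<phi>)
qed

text \<open>What \<open>u 1\<close>, \<open>u 2\<close>, \<open>u 3\<close> of a canonical basis
  satisfy, without reference to the other five vectors. The last condition normalizes the trilinear
  form \<open>\<langle>x \<cdot> y, z\<rangle>\<close>.\<close>

definition triad :: "'v \<Rightarrow> 'v \<Rightarrow> 'v \<Rightarrow> bool" where
  "triad x y z \<longleftrightarrow> \<langle>x, one'\<rangle> = 0 \<and> \<langle>y, one'\<rangle> = 0 \<and> \<langle>z, one'\<rangle> = 0 \<and> n x = 0 \<and> n y = 0 \<and> n z = 0 \<and>
     \<langle>x, y\<rangle> = 0 \<and> \<langle>y, z\<rangle> = 0 \<and> \<langle>z, x\<rangle> = 0 \<and> \<langle>x \<cdot> y, z\<rangle> = 1"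

lemma triad_anticommute: "triad x y z \<Longrightarrow> y \<cdot> x = - (x \<cdot> y)"
  using anticommute[of y x] by (simp add: triad_def polar_comm)

text \<open>The trilinear form is cyclic here because left multiplication by a traceless vector is
  skew. Thus one index of the table below is enough.\<close>

lemma triad_rotate: assumes "triad x y z" shows "triad y z x"
proof -
  have "\<langle>y \<cdot> z, x\<rangle> = - \<langle>z, y \<cdot> x\<rangle>" using assms by (intro adjoint_left0) (simp add: triad_def)
  thus ?thesis using assms triad_anticommute[OF assms]
    by (simp add: triad_def polar_uminus polar_comm)
qed

text \<open>The table of a canonical basis with \<open>y \<cdot> z\<close> for \<open>v 1\<close>,
  \<open>z \<cdot> x\<close> for \<open>v 2\<close> and \<open>- (x \<cdot> (y \<cdot> z))\<close>
  for \<open>e1\<close>; rotation yields the other indices. The facts are later picked by position,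
  so their order matters.\<close>

lemma triad_mul:
  assumes "triad x y z"
  shows "x \<cdot> x = 0" "(y \<cdot> z) \<cdot> (y \<cdot> z) = 0" "x \<cdot> (z \<cdot> x) = 0" "x \<cdot> (x \<cdot> y) = 0"
    "(y \<cdot> z) \<cdot> y = 0" "(y \<cdot> z) \<cdot> z = 0" "x \<cdot> (y \<cdot> z) = y \<cdot> (z \<cdot> x)" "(y \<cdot> z) \<cdot> x = - one' - x \<cdot> (y \<cdot> z)"
    "(x \<cdot> (y \<cdot> z)) \<cdot> x = - x" "x \<cdot> (x \<cdot> (y \<cdot> z)) = 0"
    "(x \<cdot> (y \<cdot> z)) \<cdot> (y \<cdot> z) = 0" "(y \<cdot> z) \<cdot> (x \<cdot> (y \<cdot> z)) = - (y \<cdot> z)"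
    "(y \<cdot> z) \<cdot> (z \<cdot> x) = z" "(z \<cdot> x) \<cdot> (y \<cdot> z) = - z" "(x \<cdot> (y \<cdot> z)) \<cdot> (x \<cdot> (y \<cdot> z)) = - (x \<cdot> (y \<cdot> z))"
    "\<langle>x, y \<cdot> z\<rangle> = 1" "\<langle>y, y \<cdot> z\<rangle> = 0" "\<langle>z, y \<cdot> z\<rangle> = 0" "\<langle>y \<cdot> z, one'\<rangle> = 0"
proof -
  have t: "\<langle>x, one'\<rangle> = 0" "\<langle>y, one'\<rangle> = 0" "\<langle>z, one'\<rangle> = 0" "n x = 0" "n y = 0" "n z = 0"
    "\<langle>x, y\<rangle> = 0" "\<langle>y, z\<rangle> = 0" "\<langle>z, x\<rangle> = 0" "\<langle>y \<cdot> z, x\<rangle> = 1" "\<langle>z \<cdot> x, y\<rangle> = 1"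
    "\<langle>y, x\<rangle> = 0" "\<langle>z, y\<rangle> = 0" "\<langle>x, z\<rangle> = 0"
    using assms triad_rotate[OF assms] triad_rotate[OF triad_rotate[OF assms]] by (auto simp: triad_def polar_comm)
  have ac: "y \<cdot> x = - (x \<cdot> y)" "z \<cdot> y = - (y \<cdot> z)" "x \<cdot> z = - (z \<cdot> x)"
    using assms triad_rotate triad_anticommute by metis+
  show xx: "x \<cdot> x = 0" using t by (simp add: square)
  have zz: "z \<cdot> z = 0" and yy: "y \<cdot> y = 0" using t by (simp_all add: square)
  show tv: "\<langle>y \<cdot> z, one'\<rangle> = 0" using t adjoint_left0[of y z one'] by (simp add: polar_comm)
  have tv2: "\<langle>z \<cdot> x, one'\<rangle> = 0" using t adjoint_left0[of z x one'] by (simp add: polar_comm)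
  have nv: "n (y \<cdot> z) = 0" using t by (simp add: norm_mult)
  show "(y \<cdot> z) \<cdot> (y \<cdot> z) = 0" using tv nv by (simp add: square)
  show "x \<cdot> (x \<cdot> y) = 0" using t by (simp add: left_square)
  have "x \<cdot> (x \<cdot> z) = 0" using t by (simp add: left_square)
  thus "x \<cdot> (z \<cdot> x) = 0" by (simp add: ac mul_uminus)
  show "(y \<cdot> z) \<cdot> z = 0" using t by (simp add: right_square)
  have "(z \<cdot> y) \<cdot> y = 0" using t by (simp add: right_square)
  thus "(y \<cdot> z) \<cdot> y = 0" by (simp add: ac mul_uminus)
  show xyz: "x \<cdot> (y \<cdot> z) = y \<cdot> (z \<cdot> x)"
    using left_swap[of x y z] t by (simp add: ac mul_uminus)
  show p: "\<langle>x, y \<cdot> z\<rangle> = 1" "\<langle>y, y \<cdot> z\<rangle> = 0"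
    using t adjoint_left0[of y z y] yy by (simp_all add: polar_comm)
  show p': "\<langle>z, y \<cdot> z\<rangle> = 0" using t adjoint_right0[of z y z] zz by (simp add: polar_comm)
  show vx: "(y \<cdot> z) \<cdot> x = - one' - x \<cdot> (y \<cdot> z)"
    using anticommute[OF tv t(1)] t by simp
  show "(x \<cdot> (y \<cdot> z)) \<cdot> x = - x"
    using right_swap[OF tv t(1), of x] t xx by simp
  show "x \<cdot> (x \<cdot> (y \<cdot> z)) = 0" using t by (simp add: left_square)
  show xvv: "(x \<cdot> (y \<cdot> z)) \<cdot> (y \<cdot> z) = 0" using tv nv by (simp add: right_square)
  show vxv: "(y \<cdot> z) \<cdot> (x \<cdot> (y \<cdot> z)) = - (y \<cdot> z)"
    using left_swap[OF tv t(1), of "y \<cdot> z"] t tv nv by (simp add: square)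
  \<comment> \<open>The product of two dual vectors: \<open>z\<close> is orthogonal to
    \<open>y \<cdot> z\<close> and can be pulled out to the left, and the inner product is then
    given by \<open>vx\<close>.\<close>
  have "(y \<cdot> z) \<cdot> (z \<cdot> x) = - (z \<cdot> ((y \<cdot> z) \<cdot> x))"
    using left_swap[OF tv t(3), of x] p' by (simp add: polar_comm)
  also have "\<dots> = z + z \<cdot> (z \<cdot> (x \<cdot> y))"
    using triad_rotate[OF assms] triad_rotate[OF triad_rotate[OF assms]] xyz
      left_swap[of y z x] t ac by (simp add: vx bilin)
  also have "\<dots> = z" using t by (simp add: left_square)
  finally show vv: "(y \<cdot> z) \<cdot> (z \<cdot> x) = z" .
  have "\<langle>y \<cdot> z, x \<cdot> z\<rangle> = 0" using t by (simp add: polar_mul_right)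
  hence "\<langle>y \<cdot> z, z \<cdot> x\<rangle> = 0" by (simp add: ac polar_uminus)
  thus "(z \<cdot> x) \<cdot> (y \<cdot> z) = - z" using anticommute[OF tv2 tv] vv by (simp add: polar_comm)
  have e: "\<langle>x \<cdot> (y \<cdot> z), one'\<rangle> = - 1" using adjoint_left0[OF t(1), of "y \<cdot> z" one'] t by simp
  have "n (x \<cdot> (y \<cdot> z)) = 0" using t by (simp add: norm_mult)
  hence "- (x \<cdot> (y \<cdot> z)) = (x \<cdot> (y \<cdot> z)) \<cdot> (x \<cdot> (y \<cdot> z))"
    using cnj_mul_mul[of "x \<cdot> (y \<cdot> z)" one'] e by (simp add: conjugation_def mul_diff mul_uminus)
  thus "(x \<cdot> (y \<cdot> z)) \<cdot> (x \<cdot> (y \<cdot> z)) = - (x \<cdot> (y \<cdot> z))" by simp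
qed

text \<open>Only multiplication by \<open>e\<^sub>1\<close>, \<open>e\<^sub>2\<close> and the dual vectors is needed to see independence.\<close>

lemma table_independent:
  assumes "e1 \<cdot> e1 = e1" "e2 \<cdot> e2 = e2" "e1 \<cdot> e2 = 0" "e2 \<cdot> e1 = 0" "e1 \<noteq> 0" "e2 \<noteq> 0"
    and "\<And>i. e1 \<cdot> u i = u i" "\<And>i. u i \<cdot> e1 = 0" "\<And>i. e2 \<cdot> u i = 0" "\<And>i. u i \<cdot> e2 = u i"
    and "\<And>i. e2 \<cdot> v i = v i" "\<And>i. v i \<cdot> e2 = 0" "\<And>i. e1 \<cdot> v i = 0" "\<And>i. v i \<cdot> e1 = v i"
    and "\<And>i j. u i \<cdot> v j = (if i = j then - e1 else 0)" "\<And>i j. v i \<cdot> u j = (if i = j then - e2 else 0)"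
  shows "card {e1, e2, u 1, u 2, u 3, v 1, v 2, v (3::3)} = 8"
    and "independent {e1, e2, u 1, u 2, u 3, v 1, v 2, v 3}"
    and "span {e1, e2, u 1, u 2, u 3, v 1, v 2, v 3} = UNIV"
proof -
  define c where "c i = [e1, e2, u 1, u 2, u 3, v 1, v 2, v 3] ! i" for i
  have c: "c ` {..<8} = {e1, e2, u 1, u 2, u 3, v 1, v 2, v 3}"
    by (auto simp: c_def lessThan_Suc eval_nat_numeral)
  have ind: "\<forall>i\<in>{..<8}. a i = 0" if "(\<Sum>i<8. s (a i) (c i)) = 0" for a
  proof -
    let ?x = "s (a 0) e1 + s (a 1) e2 + s (a 2) (u 1) + s (a 3) (u 2) + s (a 4) (u 3) +
      s (a 5) (v 1) + s (a 6) (v 2) + s (a 7) (v 3)"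
    have x: "?x = 0" using that by (simp add: c_def eval_nat_numeral lessThan_Suc ac_simps)
    have "e1 \<cdot> (?x \<cdot> e1) = s (a 0) e1" "e2 \<cdot> (?x \<cdot> e2) = s (a 1) e2"
      by (simp_all add: bilin assms)
    hence "s (a 0) e1 = 0" "s (a 1) e2 = 0" unfolding x by simp_all
    hence "a 0 = 0" "a 1 = 0" using assms(5,6) scale_eq_0_iff by blast+
    have u: "e1 \<cdot> ?x = s (a 2) (u 1) + s (a 3) (u 2) + s (a 4) (u 3)"
      by (simp add: bilin assms \<open>a 0 = 0\<close>)
    have v: "e2 \<cdot> ?x = s (a 5) (v 1) + s (a 6) (v 2) + s (a 7) (v 3)"
      by (simp add: bilin assms \<open>a 1 = 0\<close>[unfolded One_nat_def])
    have "(e1 \<cdot> ?x) \<cdot> v 1 = - s (a 2) e1" "(e1 \<cdot> ?x) \<cdot> v 2 = - s (a 3) e1" "(e1 \<cdot> ?x) \<cdot> v 3 = - s (a 4) e1"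
      "(e2 \<cdot> ?x) \<cdot> u 1 = - s (a 5) e2" "(e2 \<cdot> ?x) \<cdot> u 2 = - s (a 6) e2" "(e2 \<cdot> ?x) \<cdot> u 3 = - s (a 7) e2"
      unfolding u v by (simp_all add: bilin assms)
    hence "s (a 2) e1 = 0" "s (a 3) e1 = 0" "s (a 4) e1 = 0" "s (a 5) e2 = 0" "s (a 6) e2 = 0" "s (a 7) e2 = 0"
      unfolding x by simp_all
    hence "a 2 = 0" "a 3 = 0" "a 4 = 0" "a 5 = 0" "a 6 = 0" "a 7 = 0" using assms(5,6) scale_eq_0_iff by blast+
    thus ?thesis using \<open>a 0 = 0\<close> \<open>a 1 = 0\<close>[unfolded One_nat_def] by (auto simp: lessThan_Suc eval_nat_numeral)
  qed
  note fam = family_independent[of "{..<8::nat}" c, OF finite_lessThan ind]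
    family_span[of "{..<8::nat}" c, OF finite_lessThan ind]
  show "independent {e1, e2, u 1, u 2, u 3, v 1, v 2, v 3}"
    and "span {e1, e2, u 1, u 2, u 3, v 1, v 2, v 3} = UNIV"
    using fam by (simp_all add: c)
  show "card {e1, e2, u 1, u 2, u 3, v 1, v 2, v 3} = 8"
    using card_image[OF fam(1)] by (simp add: c)
qed

definition triple :: "'v \<Rightarrow> 'v \<Rightarrow> 'v \<Rightarrow> 3 \<Rightarrow> 'v" where
  "triple x y z i = (if i = 1 then x else if i = 2 then y else z)"

lemma triple_simps [simp]: "triple x y z 1 = x" "triple x y z 2 = y" "triple x y z 3 = z"
  by (simp_all add: triple_def)

lemma triad_canonical_basis:
  assumes "triad x y z"
  shows "canonical_basis s mul one' (- (x \<cdot> (y \<cdot> z))) (one' + x \<cdot> (y \<cdot> z)) (triple x y z)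
     (triple (y \<cdot> z) (z \<cdot> x) (x \<cdot> y))"
proof -
  note r = triad_rotate[OF assms] triad_rotate[OF triad_rotate[OF assms]]
  define e1 e2 u v where "e1 = - (x \<cdot> (y \<cdot> z))" and "e2 = one' - e1" and "u = triple x y z"
    and "v = triple (y \<cdot> z) (z \<cdot> x) (x \<cdot> y)"
  \<comment> \<open>Nineteen facts for each of the three rotations: fact \<open>k\<close> reappears
    at \<open>k + 19\<close> and \<open>k + 38\<close>.\<close>
  note T = triad_mul[OF assms] triad_mul[OF r(1)] triad_mul[OF r(2)]
  note ac = triad_anticommute[OF assms] triad_anticommute[OF r(1)] triad_anticommute[OF r(2)]
  have E: "e1 = - (u i \<cdot> v i)" "v i \<cdot> u i = - e2" for i
    using T(7) T(26) T(45) T(8) T(27) T(46) exhaust_3[of i]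
    by (auto simp: e1_def e2_def u_def v_def)
  have ee: "e1 \<cdot> e1 = e1" "e2 \<cdot> e2 = e2" "e1 \<cdot> e2 = 0" "e2 \<cdot> e1 = 0"
    using T(15) by (simp_all add: e2_def e1_def bilin)
  have A: "(u i \<cdot> v i) \<cdot> u i = - u i \<and> u i \<cdot> (u i \<cdot> v i) = 0 \<and> (u i \<cdot> v i) \<cdot> v i = 0 \<and> v i \<cdot> (u i \<cdot> v i) = - v i \<and>
      u i \<cdot> u i = 0 \<and> v i \<cdot> v i = 0" for i
    using T exhaust_3[of i] by (auto simp: u_def v_def)
  have eu: "e1 \<cdot> u i = u i" "u i \<cdot> e1 = 0" "e1 \<cdot> v i = 0" "v i \<cdot> e1 = v i" for i
    using A[of i] by (simp_all add: E(1)[of i] bilin)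
  have eu2: "e2 \<cdot> u i = 0" "u i \<cdot> e2 = u i" "e2 \<cdot> v i = v i" "v i \<cdot> e2 = 0" for i
    using eu[of i] by (simp_all add: e2_def bilin)
  have uv: "u i \<cdot> v j = (if i = j then - e1 else 0)" "v i \<cdot> u j = (if i = j then - e2 else 0)" for i j
  proof -
    have "u i \<cdot> v j = 0 \<and> v i \<cdot> u j = 0" if "i \<noteq> j"
      using that exhaust_3[of i] exhaust_3[of j] T(3-6) T(22-25) T(41-44) by (auto simp: u_def v_def)
    moreover have "u i \<cdot> v i = - e1" using E(1)[of i] by simp
    ultimately show "u i \<cdot> v j = (if i = j then - e1 else 0)" "v i \<cdot> u j = (if i = j then - e2 else 0)"
      using E(2)[of i] by auto
  qed
  have uu: "u i \<cdot> u (i + 1) = v (i + 2)" "u (i + 1) \<cdot> u i = - v (i + 2)"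
    "v i \<cdot> v (i + 1) = u (i + 2)" "v (i + 1) \<cdot> v i = - u (i + 2)" for i
    using exhaust_3[of i] T(13,14) T(32,33) T(51,52) ac by (auto simp: u_def v_def index3)
  have "e1 \<noteq> 0" "e2 \<noteq> 0"
  proof -
    have "x \<noteq> 0" "y \<cdot> z \<noteq> 0" using T(16) by auto
    thus "e1 \<noteq> 0" "e2 \<noteq> 0" using eu(1)[of 1] eu2(3)[of 1] by (auto simp: u_def v_def)
  qed
  note ind = table_independent[of e1 e2 u v, OF ee this eu(1,2) eu2 eu(3,4) uv]
  have B: "{e1, e2} \<union> range u \<union> range v = {e1, e2, u 1, u 2, u 3, v 1, v 2, v 3}"
    by (auto simp: UNIV_3)
  have "canonical_basis s mul one' e1 e2 u v"
    unfolding canonical_basis_def Let_def B using ind A E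
    by (simp add: ee eu eu2 uu uv) (simp add: e2_def)
  thus ?thesis by (simp add: e1_def e2_def u_def v_def)
qed

lemma left_linear: "cnj x \<cdot> (z \<cdot> y) + cnj z \<cdot> (x \<cdot> y) = s \<langle>x, z\<rangle> y"
  using cnj_mul_mul[of "x + z" y] cnj_mul_mul[of x y] cnj_mul_mul[of z y]
  by (simp add: cnj_add bilin norm_add algebra_simps)

text \<open>
  The two vectors generate a split quaternion algebra, and \<open>c\<close> below is a vector to which the
  Cayley-Dickson doubling process applies; \<open>u\<^sub>1 = e\<^sub>1 c\<close> and \<open>u\<^sub>2\<close> is proportional to \<open>v\<^sub>3 c\<close>.
\<close>

lemma extend_hyperbolic_pair:
  assumes t: "\<langle>u3, one'\<rangle> = 0" "\<langle>v3, one'\<rangle> = 0" and nn: "n u3 = 0" "n v3 = 0" and uv: "\<langle>u3, v3\<rangle> = 1"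
  shows "\<exists>u1 u2. triad u1 u2 u3 \<and> u1 \<cdot> u2 = v3"
proof -
  define e1 e2 where "e1 = - (u3 \<cdot> v3)" and "e2 = - (v3 \<cdot> u3)"
  have uu: "u3 \<cdot> u3 = 0" and vv: "v3 \<cdot> v3 = 0" using t nn by (simp_all add: square)
  have sum: "e1 + e2 = one'" using anticommute[OF t] uv by (simp add: e1_def e2_def)
  have e2v: "e2 \<cdot> v3 = v3" using right_swap[OF t, of v3] vv uv by (simp add: e2_def bilin)
  have e2u: "e2 \<cdot> u3 = 0" using right_square[OF t(1), of v3] nn by (simp add: e2_def bilin)
  have e1v: "\<langle>e1, v3\<rangle> = 0" using adjoint_right0[OF t(2), of u3 v3] vv by (simp add: e1_def bilin)
  have e1u: "\<langle>e1, u3\<rangle> = 0" using adjoint_left0[OF t(1), of v3 u3] uu by (simp add: e1_def bilin)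
  have e1o: "\<langle>e1, one'\<rangle> = 1" using adjoint_left0[OF t(1), of v3 one'] uv by (simp add: e1_def bilin polar_comm)
  have ne1: "n e1 = 0" using nn by (simp add: e1_def norm_mult)
  have e12: "\<langle>e1, e2\<rangle> = 1" using e1o ne1 by (simp add: polar_self polar_add' flip: sum)
  have ne2: "n e2 = 0" using nn by (simp add: e2_def norm_mult)
  have e2vu: "\<langle>e2, v3\<rangle> = 0" "\<langle>e2, u3\<rangle> = 0" 
    using e1v e1u t sum by (metis add_0_left polar_add'(1) polar_comm)+
  have ce2: "cnj e2 = e1"
  proof -
    have "\<langle>e2, one'\<rangle> = 1" using e12 ne2 by (simp add: polar_self polar_add' polar_comm flip: sum)
    thus ?thesis by (simp add: conjugation_def diff_eq_eq sum)
  qed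
  \<comment> \<open>Otherwise the norm would vanish on the complement of the quaternion subalgebra.
    By polarization a nonzero \<open>d\<close> in the complement would be orthogonal to the whole
    complement, hence to the whole space.\<close>
  obtain c where c: "\<langle>c, e1\<rangle> = 0" "\<langle>c, e2\<rangle> = 0" "\<langle>c, u3\<rangle> = 0" "\<langle>c, v3\<rangle> = 0" "n c \<noteq> 0"
  proof (rule ccontr)
    assume "\<not> thesis"
    hence iso: "n c = 0" if "\<langle>c, e1\<rangle> = 0" "\<langle>c, e2\<rangle> = 0" "\<langle>c, u3\<rangle> = 0" "\<langle>c, v3\<rangle> = 0" for c
      using that \<open>\<And>c. \<lbrakk>\<langle>c, e1\<rangle> = 0; \<langle>c, e2\<rangle> = 0; \<langle>c, u3\<rangle> = 0; \<langle>c, v3\<rangle> = 0; n c \<noteq> 0\<rbrakk> \<Longrightarrow> thesis\<close> by blast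
    have "card {e1, e2, u3, v3} < 8"
      using card_length[of "[e1, e2, u3, v3]"] by simp
    then obtain d where d: "d \<noteq> 0" "\<langle>d, e1\<rangle> = 0" "\<langle>d, e2\<rangle> = 0" "\<langle>d, u3\<rangle> = 0" "\<langle>d, v3\<rangle> = 0"
      using exists_orthogonal[of "{e1, e2, u3, v3}" UNIV] dim8 by auto
    have "\<langle>d, z\<rangle> = 0" for z
    proof -
      define w where "w = z - s \<langle>z, e2\<rangle> e1 - s \<langle>z, e1\<rangle> e2 - s \<langle>z, v3\<rangle> u3 - s \<langle>z, u3\<rangle> v3"
      have "\<langle>w, e1\<rangle> = 0 \<and> \<langle>w, e2\<rangle> = 0 \<and> \<langle>w, u3\<rangle> = 0 \<and> \<langle>w, v3\<rangle> = 0"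
        using e12 ne1 ne2 e1v e1u e2vu nn uv polar_comm[of e2 e1] polar_comm[of u3 e1] polar_comm[of u3 e2]
          polar_comm[of v3 e1] polar_comm[of v3 e2] polar_comm[of v3 u3]
        by (simp add: w_def bilin polar_self)
      hence "n w = 0" "n (d + w) = 0" using iso d by (simp_all add: polar_add')
      hence "\<langle>d, w\<rangle> = 0" using iso[of d] d by (simp add: norm_add)
      thus ?thesis using d by (simp add: w_def bilin)
    qed
    thus False using nonsingular d by blast
  qed
  \<comment> \<open>It turns out that \<open>c \<cdot> v3 = - (v3 \<cdot> c)\<close> and that
    \<open>(e1 \<cdot> c) \<cdot> (c \<cdot> v3)\<close> is \<open>- n c\<close> times
    \<open>v3\<close>; the factor \<open>1 / n c\<close> normalizes the product to
    \<open>v3\<close>.\<close>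
  define u1 u2 where "u1 = e1 \<cdot> c" and "u2 = s (1 / n c) (v3 \<cdot> c)"
  have tc: "\<langle>c, one'\<rangle> = 0" using c by (simp add: polar_add' flip: sum)
  have vc: "\<langle>v3, c\<rangle> = 0" "c \<cdot> v3 = - (v3 \<cdot> c)" using anticommute[OF tc t(2)] c by (simp_all add: polar_comm)
  \<comment> \<open>Moving \<open>c\<close> past \<open>e2 \<cdot> v3 = v3\<close> turns
    \<open>e2\<close> into its conjugate \<open>e1\<close>.\<close>
  have e1c: "e1 \<cdot> (c \<cdot> v3) = c \<cdot> v3"
    using left_linear[of e2 c v3] c(2) cnj_traceless[OF tc] by (simp add: ce2 e2v mul_uminus polar_comm[of e2])
  have tcv: "\<langle>c \<cdot> v3, one'\<rangle> = 0" using adjoint_left0[OF tc, of v3 one'] vc by simp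
  have ccv: "\<langle>c, c \<cdot> v3\<rangle> = 0"
    using polar_mul_left[of c one' v3] t by (simp add: polar_comm)
  have "(e1 \<cdot> c) \<cdot> (c \<cdot> v3) = - ((c \<cdot> v3) \<cdot> c)"
    using right_swap[OF tc tcv, of e1] ccv e1c by simp
  also have "\<dots> = s (- n c) v3" using right_square[OF tc, of v3] by (simp add: vc mul_uminus)
  finally have u12: "u1 \<cdot> u2 = v3" using c(5) by (simp add: u1_def u2_def vc bilin)
  have "\<langle>u1, one'\<rangle> = 0" using adjoint_right0[OF tc, of e1 one'] c by (simp add: u1_def polar_comm)
  moreover have "\<langle>u2, one'\<rangle> = 0" using tcv vc by (simp add: u2_def bilin)
  moreover have "\<langle>u1, u2\<rangle> = 0" using polar_mul_right[of e1 c v3] e1v by (simp add: u1_def u2_def bilin)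
  moreover have "\<langle>u2, u3\<rangle> = 0"
    using adjoint_left0[OF t(2), of c u3] c(2) by (simp add: u2_def bilin e2_def)
  moreover have "\<langle>u3, u1\<rangle> = 0"
  proof -
    have "cnj e1 = e2" using ce2 cnj_cnj by metis
    thus ?thesis using adjoint_left[of e1 c u3] e2u by (simp add: u1_def polar_comm)
  qed
  ultimately have "triad u1 u2 u3"
    using t nn uv ne1 u12 by (simp add: triad_def u1_def u2_def norm_mult norm_scale' polar_comm)
  thus ?thesis using u12 by blast
qed

end


section \<open>Automorphisms of order three\<close>

locale octonion_order3 = octonion_algebra s mul one' n
  for s :: "'f::field \<Rightarrow> 'v::ab_group_add \<Rightarrow> 'v" and mul (infixl "\<cdot>" 70) and one' n +
  fixes \<tau> :: "'v \<Rightarrow> 'v"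
  assumes order3: "order3_automorphism s mul n \<tau>"
begin

definition N :: "'v \<Rightarrow> 'v" where "N x = \<tau> x - x"

lemma tau_auto: "automorphism s mul n \<tau>"
  using order3 by (simp add: order3_automorphism_def)

lemmas tau_simps = automorphismD(1-4,6-11)[OF tau_auto]

lemma tau3: "\<tau> (\<tau> (\<tau> x)) = x"
  using order3 by (auto simp: order3_automorphism_def fun_eq_iff)

lemma tau_eq: "\<tau> x = x + N x"
  by (simp add: N_def)

lemma N_linear: "N (x + y) = N x + N y" "N (s a x) = s a (N x)" "N (- x) = - N x" "N (x - y) = N x - N y"
  by (simp_all add: N_def tau_simps bilin)

lemma N_zero [simp]: "N 0 = 0"
  by (simp add: N_def tau_simps)

lemma N_one [simp]: "N one' = 0"
  by (simp add: N_def tau_simps)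

lemma N_mul: "N (x \<cdot> y) = N x \<cdot> y + x \<cdot> N y + N x \<cdot> N y"
  by (simp add: N_def tau_simps bilin)

lemma N2: "N (N x) = \<tau> (\<tau> x) + \<tau> x + x"
proof -
  have "N (N x) = \<tau> (\<tau> x) - (\<tau> x + \<tau> x) + x" by (simp add: N_def tau_simps)
  thus ?thesis by (simp only: scale_add_self diff_minus_eq_add)
qed

lemma N3 [simp]: "N (N (N x)) = 0"
  by (simp add: N2[of x] N_linear) (simp add: N_def tau3)

lemma N_polar: "\<langle>N x, y\<rangle> + \<langle>x, N y\<rangle> + \<langle>N x, N y\<rangle> = 0"
  by (simp add: N_def polar_diff tau_simps)

lemma N_polar_fixed: "N a = 0 \<Longrightarrow> \<langle>N x, a\<rangle> = 0" "N a = 0 \<Longrightarrow> \<langle>a, N x\<rangle> = 0"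
  using N_polar[of x a] by (simp_all add: polar_comm)

lemma N_trace [simp]: "\<langle>N x, one'\<rangle> = 0"
  by (simp add: N_polar_fixed)

lemma tau_adjoint: "\<langle>\<tau> (\<tau> x), y\<rangle> = \<langle>x, \<tau> y\<rangle>"
  using tau_simps(8)[of "\<tau> (\<tau> x)" y] by (simp add: tau3)

lemma N2_polar: "\<langle>N (N x), y\<rangle> = \<langle>x, N (N y)\<rangle>"
  using tau_adjoint[of x y] tau_adjoint[of y x] by (simp add: N2 polar_add' polar_comm)

lemma N2_polar_comm: "\<langle>N (N x), y\<rangle> = \<langle>N (N y), x\<rangle>"
  by (metis N2_polar polar_comm)

lemma N2_polar_N [simp]: "\<langle>N (N x), N y\<rangle> = 0"
  by (simp add: N2_polar)

text \<open>\<open>\<tau>\<^sup>2\<close> is the adjoint of \<open>\<tau>\<close>, so the two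
  pairings add up to \<open>3 * \<langle>x, y\<rangle>\<close>. It follows that
  \<open>n (N x)\<close> is the value \<open>B(x, x)\<close>.\<close>

lemma N_polar_N: "\<langle>N x, N y\<rangle> = - \<langle>N (N x), y\<rangle>"
proof -
  have "\<langle>N x, N y\<rangle> + \<langle>N (N x), y\<rangle> = 3 * \<langle>x, y\<rangle>"
    using tau_adjoint[of x y] by (simp add: N2 polar_add' polar_diff tau_simps N_def three)
  thus ?thesis by (simp add: three eq_neg_iff_add_eq_0)
qed

lemma N_norm: "n (N x) = \<langle>N (N x), x\<rangle>"
  using N_polar_N[of x x] by (simp add: polar_self)

lemma N2_norm [simp]: "n (N (N x)) = 0"
  using N_norm[of "N x"] by simp

definition trace_free :: "'v \<Rightarrow> 'v" where "trace_free x = x + s \<langle>x, one'\<rangle> one'"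

lemma trace_free: "\<langle>trace_free x, one'\<rangle> = 0" "N (trace_free x) = N x"
  by (simp_all add: trace_free_def bilin polar_one_one N_linear)

text \<open>The delicate choice is \<open>u1\<close>. It must be orthogonal to the image of
  \<open>N\<close>, which makes it fixed, and to \<open>one'\<close> and \<open>u3\<close>, but pair
  to \<open>1\<close> with \<open>z = u2 \<cdot> u3\<close>, the future \<open>v 1\<close>. This is
  possible once \<open>z\<close> lies outside the span of those vectors.\<close>

lemma square_zero_long_root_form:
  assumes sq: "\<And>x. N (N x) = 0"
  shows "\<exists>e1 e2 u v. canonical_basis s mul one' e1 e2 u v \<and> long_root_form u \<tau>"
proof -
  have iso: "\<langle>N x, N y\<rangle> = 0" "n (N x) = 0" for x y
    by (simp_all add: N_polar_N N_norm sq)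
  have skew: "\<langle>N x, y\<rangle> = - \<langle>x, N y\<rangle>" for x y
    using N_polar[of x y] by (simp add: iso eq_neg_iff_add_eq_0)
  \<comment> \<open>Only the mixed terms survive in \<open>N\<^sup>2 (x \<cdot> y)\<close>, and they
    amount to twice \<open>N x \<cdot> N y\<close>.\<close>
  have prod: "N x \<cdot> N y = 0" for x y
  proof -
    have "N x \<cdot> N y + N x \<cdot> N y = N (N (x \<cdot> y))" by (simp add: N_mul N_linear sq)
    thus ?thesis by (simp add: sq scale_add_self)
  qed
  obtain x0 where x0: "N x0 \<noteq> 0"
    using order3 by (auto simp: order3_automorphism_def fun_eq_iff N_def)
  obtain y where y: "\<langle>N x0, y\<rangle> = 1" using polar_neq_0[OF x0] by blast
  define x1 where "x1 = trace_free x0"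
  \<comment> \<open>A correction from the image of \<open>N\<close> changes neither the trace nor
    \<open>N u3\<close>; its pairing with \<open>x1\<close> is \<open>- n x1\<close>, which makes
    \<open>u3\<close> isotropic.\<close>
  define u3 where "u3 = x1 + N (s (n x1) y)"
  define u2 where "u2 = N u3"
  have x1: "\<langle>x1, one'\<rangle> = 0" "N x1 = N x0" by (simp_all add: x1_def trace_free)
  have u2: "u2 = N x0" by (simp add: u2_def u3_def N_linear sq x1)
  have t3: "\<langle>u3, one'\<rangle> = 0" by (simp add: u3_def polar_add' x1)
  have "\<langle>x1, N y\<rangle> = - 1" using skew[of x1 y] y by (simp add: x1 minus_equation_iff)
  hence n3: "n u3 = 0" by (simp add: u3_def norm_add iso N_linear polar_scale')
      (simp add: norm_scale' iso)
  have t2: "\<langle>u2, one'\<rangle> = 0" by (simp add: u2)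
  have n2: "n u2 = 0" by (simp add: u2 iso)
  have u23: "\<langle>u2, u3\<rangle> = 0" 
    using skew[of u3 u3] by (simp add: u2_def polar_comm[of u3] eq_neg_iff_add_eq_0 add_self)
  define z where "z = u2 \<cdot> u3"
  have z': "N u3 \<cdot> u3 = z" by (simp add: z_def u2_def)
  have Nz: "N z = 0" using prod by (simp add: z_def N_mul u2_def sq)
  have tz: "\<langle>z, one'\<rangle> = 0" using adjoint_left0[OF t2, of u3 one'] u23 by (simp add: z_def polar_comm)
  have nz: "n z = 0" by (simp add: z_def norm_mult n2)
  have z3: "\<langle>z, u3\<rangle> = 0" using adjoint_right0[OF t3, of u2 u3] t3 n3 by (simp add: z_def square)
  define S where "S = range N \<union> {one', u3}"
  have "z \<notin> span S"
  proof
    assume "z \<in> span S"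
    hence "\<exists>y c d. z = N y + s c one' + s d u3"
    proof (induction rule: span_induct_alt)
      case base
      show ?case by (intro exI[of _ 0]) simp
    next
      case (step a x z)
      then obtain y c d where z: "z = N y + s c one' + s d u3" by blast
      consider x' where "x = N x'" | "x = one'" | "x = u3" using step.hyps by (auto simp: S_def)
      thus ?case
      proof cases
        case 1
        hence "s a x + z = N (s a x' + y) + s c one' + s d u3" by (simp add: z N_linear add.assoc)
        thus ?thesis by blast
      next
        case 2
        hence "s a x + z = N y + s (a + c) one' + s d u3" by (simp add: z bilin algebra_simps)
        thus ?thesis by blast
      next
        case 3
        hence "s a x + z = N y + s c one' + s (a + d) u3" by (simp add: z bilin algebra_simps)
        thus ?thesis by blast
      qed
    qed
    then obtain y c d where zy: "z = N y + s c one' + s d u3" by blast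
    have "c = 0" using tz t3 by (simp add: zy polar_add' polar_scale' polar_one_one)
    moreover have "d = 0" using Nz x0 by (simp add: zy N_linear sq flip: u2_def) (simp add: u2)
    ultimately have zy: "z = N y" using zy by simp
    \<comment> \<open>With \<open>z\<close> in the image, \<open>N w\<close> annihilates
      \<open>u2 \<cdot> u3\<close>. Moving \<open>N w\<close> past \<open>u2\<close> and
      \<open>u3\<close> leaves \<open>\<langle>N w, u3\<rangle>\<close> times \<open>u2\<close>, so
      this scalar vanishes; then \<open>u2 = N u3\<close> is orthogonal to everything.\<close>
    have "\<langle>N w, u3\<rangle> = 0" for w
    proof -
      have tw: "\<langle>N w, one'\<rangle> = 0" by simp
      have w2: "\<langle>N w, u2\<rangle> = 0" "N w \<cdot> u2 = 0" "u2 \<cdot> N w = 0" by (simp_all add: u2 iso prod)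
      have "N w \<cdot> (u2 \<cdot> u3) = 0" using prod[of w y] zy by (simp add: z_def)
      hence "u2 \<cdot> (N w \<cdot> u3) = 0" using left_swap[OF tw t2, of u3] w2 by simp
      moreover have "N w \<cdot> u3 = - (u3 \<cdot> N w) - s \<langle>N w, u3\<rangle> one'" by (rule anticommute[OF tw t3])
      moreover have "u2 \<cdot> (u3 \<cdot> N w) = 0" using left_swap[OF t2 t3, of "N w"] w2 u23 by simp
      ultimately have "s \<langle>N w, u3\<rangle> u2 = 0" by (simp add: bilin)
      thus ?thesis using x0 u2 by simp
    qed
    hence "\<langle>u2, w\<rangle> = 0" for w using skew[of w u3] by (simp add: u2_def polar_comm)
    thus False using x0 u2 nonsingular[of u2] by auto
  qed
  then obtain w where w: "\<And>y. y \<in> S \<Longrightarrow> \<langle>w, y\<rangle> = 0" "\<langle>w, z\<rangle> = 1" using separating_vector by blast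
  define u1 where "u1 = w - s (n w) z"
  have Nw: "N w = 0"
  proof (rule polar_eqI)
    fix y show "\<langle>N w, y\<rangle> = \<langle>0, y\<rangle>" using skew[of w y] w(1)[of "N y"] by (simp add: S_def)
  qed
  have "triad u2 u3 u1"
    using w(1)[of one'] w(1)[of u3] w(1)[of u2] w(2) N_polar_fixed(2)[OF Nz, of x0] tz nz z3 t2 t3 n2 n3 u23
    by (simp add: triad_def u1_def bilin norm_diff norm_scale' S_def polar_comm u2_def z'
        polar_self flip: u2)
  hence tr: "triad u1 u2 u3" by (metis triad_rotate)
  have "long_root_form (triple u1 u2 u3) \<tau>"
    by (simp add: long_root_form_def tau_eq u1_def N_linear Nw Nz u2_def sq)
  thus ?thesis using triad_canonical_basis[OF tr] by blast
qed

text \<open>\<open>B\<close> is symmetric, and the characteristic is not \<open>2\<close>: a form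
  vanishing on the diagonal vanishes.\<close>

lemma exists_B_anisotropic:
  assumes "N (N z) \<noteq> 0"
  shows "\<exists>x. \<langle>N (N x), x\<rangle> \<noteq> 0"
proof (rule ccontr)
  assume "\<nexists>x. \<langle>N (N x), x\<rangle> \<noteq> 0"
  hence 0: "\<langle>N (N x), x\<rangle> = 0" for x by blast
  have "\<langle>N (N z), y\<rangle> = 0" for y
  proof -
    have "\<langle>N (N y), z\<rangle> = \<langle>N (N z), y\<rangle>" by (rule N2_polar_comm)
    hence "\<langle>N (N z), y\<rangle> + \<langle>N (N z), y\<rangle> = 0"
      using 0[of "z + y"] 0[of z] 0[of y] by (simp add: N_linear polar_add')
    thus ?thesis by (simp add: add_self)
  qed
  thus False using assms nonsingular by blast
qed

text \<open>
  If \<open>N\<^sup>2\<close> has two orthogonal directions for the form \<open>B(x, y) = \<langle>N\<^sup>2 x, y\<rangle>\<close>, then two Jordan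
  blocks of size \<open>3\<close> span a nondegenerate \<open>\<tau>\<close>-stable subspace of dimension \<open>6\<close>, and its
  orthogonal complement is fixed.
\<close>

lemma two_blocks_independent:
  assumes B: "\<langle>N (N x), x\<rangle> \<noteq> 0" "\<langle>N (N y), y\<rangle> \<noteq> 0" "\<langle>N (N x), y\<rangle> = 0"
    and t: "\<langle>x, one'\<rangle> = 0" "\<langle>y, one'\<rangle> = 0"
    and r: "\<langle>r, x\<rangle> = 0" "\<langle>r, N x\<rangle> = 0" "\<langle>r, N (N x)\<rangle> = 0" "\<langle>r, y\<rangle> = 0" "\<langle>r, N y\<rangle> = 0" "\<langle>r, N (N y)\<rangle> = 0"
      "\<langle>r, one'\<rangle> = 0"
    and sum: "s c0 x + s c1 (N x) + s c2 (N (N x)) + s c3 y + s c4 (N y) + s c5 (N (N y)) + s c6 one' + r = 0"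
  shows "c0 = 0 \<and> c1 = 0 \<and> c2 = 0 \<and> c3 = 0 \<and> c4 = 0 \<and> c5 = 0 \<and> c6 = 0 \<and> r = 0"
proof -
  let ?L = "s c0 x + s c1 (N x) + s c2 (N (N x)) + s c3 y + s c4 (N y) + s c5 (N (N y)) + s c6 one' + r"
  have B': "\<langle>N (N y), x\<rangle> = 0" "\<langle>x, N (N x)\<rangle> = \<langle>N (N x), x\<rangle>" "\<langle>y, N (N y)\<rangle> = \<langle>N (N y), y\<rangle>"
    "\<langle>x, N (N y)\<rangle> = 0" "\<langle>y, N (N x)\<rangle> = 0" "\<langle>one', N z\<rangle> = 0" "\<langle>one', x\<rangle> = 0" "\<langle>one', y\<rangle> = 0"
    "\<langle>N (N z), N (N w)\<rangle> = 0" "\<langle>N z, N (N w)\<rangle> = 0" for z w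
    using B(3) t N2_polar_comm[of y x] polar_comm[of x "N (N x)"] polar_comm[of y "N (N y)"]
      polar_comm[of x "N (N y)"] polar_comm[of y "N (N x)"] polar_comm[of one'] polar_comm[of "N z" "N (N w)"]
    by simp_all
  have L: "\<langle>?L, w\<rangle> = 0" for w using sum by simp
  \<comment> \<open>Pairing with the far end of a Jordan chain isolates the coefficient of its
    beginning; the remaining coefficients then fall in the order of the chain.\<close>
  have c0: "c0 = 0" using L[of "N (N x)"] B B' r by (simp add: polar_add' polar_scale')
  have c3: "c3 = 0" using L[of "N (N y)"] B B' r by (simp add: polar_add' polar_scale')
  have c1: "c1 = 0" using L[of "N x"] B B' r c0 c3 by (simp add: polar_add' polar_scale' N_polar_N)
  have c4: "c4 = 0" using L[of "N y"] B B' r c0 c3 by (simp add: polar_add' polar_scale' N_polar_N)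
  have c2: "c2 = 0" using L[of x] B B' r c0 c1 c3 c4 by (simp add: polar_add' polar_scale')
  have c5: "c5 = 0" using L[of y] B B' r c0 c1 c3 c4 by (simp add: polar_add' polar_scale')
  have c6: "c6 = 0" using L[of one'] r c0 c1 c2 c3 c4 c5 by (simp add: polar_add' polar_scale' polar_one_one)
  show ?thesis using c0 c1 c2 c3 c4 c5 c6 sum by simp
qed

text \<open>The two blocks and \<open>one'\<close> are seven vectors, so a nonzero \<open>a\<close>
  orthogonal to them exists. Then \<open>N a\<close> is orthogonal to them as well, and
  \<open>N a \<noteq> 0\<close> would give nine independent vectors. If \<open>n a = 0\<close>, then
  \<open>a\<close> would be orthogonal to a basis containing it.\<close>

lemma two_blocks_fixed:
  assumes B: "\<langle>N (N x), x\<rangle> \<noteq> 0" "\<langle>N (N y), y\<rangle> \<noteq> 0" "\<langle>N (N x), y\<rangle> = 0"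
  shows "\<exists>a. N a = 0 \<and> \<langle>a, one'\<rangle> = 0 \<and> n a \<noteq> 0"
proof -
  define x' y' where "x' = trace_free x" and "y' = trace_free y"
  have t: "\<langle>x', one'\<rangle> = 0" "\<langle>y', one'\<rangle> = 0" by (simp_all add: x'_def y'_def trace_free)
  have N': "N x' = N x" "N y' = N y" by (simp_all add: x'_def y'_def trace_free)
  have B': "\<langle>N (N x'), x'\<rangle> \<noteq> 0" "\<langle>N (N y'), y'\<rangle> \<noteq> 0" "\<langle>N (N x'), y'\<rangle> = 0"
    unfolding N' using B by (simp_all add: x'_def y'_def trace_free_def bilin)
  define T where "T = {x', N x', N (N x'), y', N y', N (N y'), one'}"
  have "card T < 8" unfolding T_def using card_length[of "[x', N x', N (N x'), y', N y', N (N y'), one']"] by simp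
  then obtain a where a: "a \<noteq> 0" "\<And>w. w \<in> T \<Longrightarrow> \<langle>a, w\<rangle> = 0"
    using exists_orthogonal[of T UNIV] dim8 by (auto simp: T_def)
  have aT: "\<langle>a, x'\<rangle> = 0" "\<langle>a, N x'\<rangle> = 0" "\<langle>a, N (N x')\<rangle> = 0" "\<langle>a, y'\<rangle> = 0" "\<langle>a, N y'\<rangle> = 0"
    "\<langle>a, N (N y')\<rangle> = 0" "\<langle>a, one'\<rangle> = 0"
    by (simp_all add: a T_def)
  have NT: "\<langle>N a, x'\<rangle> = 0" "\<langle>N a, N x'\<rangle> = 0" "\<langle>N a, N (N x')\<rangle> = 0" "\<langle>N a, y'\<rangle> = 0" "\<langle>N a, N y'\<rangle> = 0"
    "\<langle>N a, N (N y')\<rangle> = 0"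
    using N_polar[of a "N (N x')"] N_polar[of a "N x'"] N_polar[of a x']
      N_polar[of a "N (N y')"] N_polar[of a "N y'"] N_polar[of a y'] aT by simp_all
  have Na: "N a = 0"
  proof (rule ccontr)
    assume Na: "N a \<noteq> 0"
    define c where "c i = [x', N x', N (N x'), y', N y', N (N y'), one', a, N a] ! i" for i
    have "\<forall>i\<in>{..<9}. k i = 0" if "(\<Sum>i<9. s (k i) (c i)) = 0" for k
    proof -
      define r where "r = s (k 7) a + s (k 8) (N a)"
      have "s (k 0) x' + s (k 1) (N x') + s (k 2) (N (N x')) + s (k 3) y' + s (k 4) (N y') +
          s (k 5) (N (N y')) + s (k 6) one' + r = 0"
        using that by (simp add: c_def r_def eval_nat_numeral lessThan_Suc ac_simps)
      from two_blocks_independent[OF B' t _ _ _ _ _ _ _ this] aT NT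
      have k: "k 0 = 0" "k 1 = 0" "k 2 = 0" "k 3 = 0" "k 4 = 0" "k 5 = 0" "k 6 = 0" "r = 0"
        by (simp_all add: r_def polar_add' polar_scale')
      have "N (N r) = s (k 7) (N (N a))" by (simp add: r_def N_linear)
      hence k7: "k 7 = 0 \<or> N (N a) = 0" by (simp add: k)
      have "N r = s (k 7) (N a) + s (k 8) (N (N a))" by (simp add: r_def N_linear)
      hence "k 7 = 0" using k7 Na by (auto simp: k)
      hence "k 8 = 0" using \<open>r = 0\<close> Na by (simp add: r_def)
      thus ?thesis using k \<open>k 7 = 0\<close> by (auto simp: eval_nat_numeral less_Suc_eq)
    qed
    from family_card_le[of "{..<9::nat}" c, OF finite_lessThan this] show False by simp
  qed
  have "n a \<noteq> 0"
  proof
    assume n: "n a = 0"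
    define c where "c i = [x', N x', N (N x'), y', N y', N (N y'), one', a] ! i" for i
    have c: "c ` {..<8} = insert a T"
      by (auto simp: c_def T_def lessThan_Suc eval_nat_numeral)
    have "\<forall>i\<in>{..<8}. k i = 0" if "(\<Sum>i<8. s (k i) (c i)) = 0" for k
    proof -
      have "s (k 0) x' + s (k 1) (N x') + s (k 2) (N (N x')) + s (k 3) y' + s (k 4) (N y') +
          s (k 5) (N (N y')) + s (k 6) one' + s (k 7) a = 0"
        using that by (simp add: c_def eval_nat_numeral lessThan_Suc ac_simps)
      from two_blocks_independent[OF B' t _ _ _ _ _ _ _ this] aT
      have "k 0 = 0" "k 1 = 0" "k 2 = 0" "k 3 = 0" "k 4 = 0" "k 5 = 0" "k 6 = 0" "s (k 7) a = 0"
        by (simp_all add: polar_scale')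
      thus ?thesis using a(1) by (auto simp: eval_nat_numeral less_Suc_eq)
    qed
    from family_span[of "{..<8::nat}" c, OF finite_lessThan this] have "span (insert a T) = UNIV" by (simp add: c)
    hence "z \<in> span (insert a T)" for z by simp
    moreover have "\<langle>y, a\<rangle> = 0" if "y \<in> insert a T" for y
      using that a(2)[of y] n by (auto simp: polar_self polar_comm[of y])
    ultimately have "\<langle>z, a\<rangle> = 0" for z using polar_span by blast
    thus False using a(1) nonsingular[of a] by (simp add: polar_comm)
  qed
  thus ?thesis using Na aT by blast
qed

text \<open>Two \<open>B\<close>-orthogonal vectors that are both \<open>B\<close>-anisotropic would
  produce a forbidden fixed vector. So \<open>B\<close> vanishes on the diagonal of the
  \<open>B\<close>-complement of \<open>x\<close>, hence on that complement, and
  \<open>N\<^sup>2\<close> only sees the component along \<open>x\<close>.\<close>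

lemma rank_one:
  assumes no: "\<And>a. N a = 0 \<Longrightarrow> \<langle>a, one'\<rangle> = 0 \<Longrightarrow> n a = 0" and x: "\<langle>N (N x), x\<rangle> \<noteq> 0"
  shows "N (N z) = s (\<langle>N (N x), z\<rangle> / \<langle>N (N x), x\<rangle>) (N (N x))"
proof -
  define k where "k z = \<langle>N (N x), z\<rangle> / \<langle>N (N x), x\<rangle>" for z
  have k: "\<langle>N (N x), z - s (k z) x\<rangle> = 0" for z using x by (simp add: k_def bilin)
  have B0: "\<langle>N (N w), w\<rangle> = 0" if "\<langle>N (N x), w\<rangle> = 0" for w
    using two_blocks_fixed[of x w] no x that by blast
  have B1: "N (N w) = 0" if w: "\<langle>N (N x), w\<rangle> = 0" for w
  proof (rule polar_eqI)
    fix z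
    define z' where "z' = z - s (k z) x"
    have "\<langle>N (N z'), w\<rangle> = \<langle>N (N w), z'\<rangle>" by (rule N2_polar_comm)
    moreover have "\<langle>N (N w), x\<rangle> = 0" using w by (simp add: N2_polar_comm[of w])
    moreover have "\<langle>N (N x), z'\<rangle> = 0" using k by (simp add: z'_def)
    ultimately have "\<langle>N (N w), z'\<rangle> = 0" "\<langle>N (N w), z\<rangle> = \<langle>N (N w), z'\<rangle>"
      using B0[of w] B0[of z'] B0[of "w + z'"] w
      by (simp_all add: N_linear polar_add' add_self) (simp add: z'_def bilin)
    thus "\<langle>N (N w), z\<rangle> = \<langle>0, z\<rangle>" by simp
  qed
  have "N (N (z - s (k z) x)) = 0" by (rule B1[OF k])
  thus ?thesis by (simp add: N_linear k_def)
qed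

end


context octonion_order3
begin

text \<open>
  Here \<open>u\<^sub>3\<close> is chosen so that \<open>v\<^sub>3 = - N\<^sup>2 u\<^sub>3\<close> pairs with it to \<open>1\<close> and \<open>N u\<^sub>3 \<cdot> v\<^sub>3 = v\<^sub>3\<close>; the
  hyperbolic pair is then extended to a canonical basis, where \<open>N\<close> turns out to kill \<open>u\<^sub>1\<close> and \<open>u\<^sub>2\<close>.
\<close>

lemma short_or_mixed_form:
  assumes no: "\<And>a. N a = 0 \<Longrightarrow> \<langle>a, one'\<rangle> = 0 \<Longrightarrow> n a = 0" and sq: "N (N z0) \<noteq> 0"
  shows "\<exists>e1 e2 u v. canonical_basis s mul one' e1 e2 u v \<and>
    (short_root_form e1 e2 u v \<tau> \<or> mixed_form e1 e2 u v \<tau>)"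
proof -
  obtain x where x: "\<langle>N (N x), x\<rangle> \<noteq> 0" using exists_B_anisotropic[OF sq] by blast
  have w0: "N (N x) \<noteq> 0" using x by auto
  have Nx_anti: "N (N x) \<cdot> N x = - (N x \<cdot> N (N x))" using anticommute[of "N (N x)" "N x"] by simp
  \<comment> \<open>This exhibits \<open>N x \<cdot> N (N x)\<close> as a value of
    \<open>N\<^sup>2\<close>, hence as a multiple of \<open>N (N x)\<close>.\<close>
  have "N (N (x \<cdot> N x)) = N x \<cdot> N (N x)"
    using square[of "N (N x)"] by (simp add: N_mul N_linear Nx_anti)
  then obtain l where l: "N x \<cdot> N (N x) = s l (N (N x))" using rank_one[OF no x] by metis
  \<comment> \<open>Multiplying by \<open>N x\<close> twice shows that
    \<open>- \<langle>N (N x), x\<rangle>\<close> is the square of \<open>l\<close>. Dividing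
    \<open>x\<close> by \<open>l\<close> therefore normalizes \<open>B\<close> to \<open>- 1\<close>
    over any field, and turns the factor \<open>l\<close> into \<open>1\<close>.\<close>
  have "s (l * l) (N (N x)) = s (- n (N x)) (N (N x))"
    using left_square[of "N x" "N (N x)"] by (simp add: l mul_scale)
  hence l2: "l * l = - \<langle>N (N x), x\<rangle>" using w0 by (simp only: scale_cancel_right N_norm) simp
  hence l0: "l \<noteq> 0" using x by auto
  define x' where "x' = s (1 / l) (trace_free x)"
  have x': "\<langle>x', one'\<rangle> = 0" "N x' = s (1 / l) (N x)" by (simp_all add: x'_def bilin trace_free N_linear)
  have x'B: "\<langle>N (N x'), x'\<rangle> = - 1"
  proof -
    have "\<langle>N (N x), trace_free x\<rangle> = - (l * l)" by (simp add: l2 trace_free_def bilin)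
    thus ?thesis using l0 by (simp add: x' N_linear bilin) (simp add: x'_def bilin)
  qed
  \<comment> \<open>\<open>x'\<close> and \<open>N (N x')\<close> pair to \<open>- 1\<close>, so
    this multiple cancels the norm of \<open>x'\<close>; it leaves \<open>N x'\<close>
    unchanged.\<close>
  define u3 where "u3 = x' + s (n x') (N (N x'))"
  define v3 where "v3 = - N (N x')"
  have N_u3: "N u3 = N x'" by (simp add: u3_def N_linear)
  have t3: "\<langle>u3, one'\<rangle> = 0" "\<langle>v3, one'\<rangle> = 0" by (simp_all add: u3_def v3_def bilin x')
  have n3: "n u3 = 0" "n v3 = 0"
    using x'B by (simp_all add: u3_def v3_def norm_add norm_scale' polar_scale' polar_comm[of x'])
  have uv: "\<langle>u3, v3\<rangle> = 1"
    using x'B by (simp add: u3_def v3_def bilin polar_self polar_comm[of x'])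
  obtain u1 u2 where tr: "triad u1 u2 u3" and u12: "u1 \<cdot> u2 = v3"
    using extend_hyperbolic_pair[OF t3 n3 uv] by blast
  note can = triad_canonical_basis[OF tr]
  define e1 e2 u v where "e1 = - (u1 \<cdot> (u2 \<cdot> u3))" and "e2 = one' + u1 \<cdot> (u2 \<cdot> u3)" and "u = triple u1 u2 u3"
    and "v = triple (u2 \<cdot> u3) (u3 \<cdot> u1) (u1 \<cdot> u2)"
  obtain oct where "octonion_frame s mul one' n e1 e2 u v oct"
    using frame_exists can unfolding e1_def e2_def u_def v_def by blast
  then interpret F: octonion_frame s mul one' n e1 e2 u v oct .
  have U: "u3 = u 3" "v3 = v 3" "u1 = u 1" "u2 = u 2" by (simp_all add: u_def v_def u12)
  have U': "u3 = oct 0 0 0 0 1 0 0 0" "v3 = oct 0 0 0 0 0 0 0 1" "u1 = oct 0 0 1 0 0 0 0 0" "u2 = oct 0 0 0 1 0 0 0 0"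
    unfolding U by (simp_all add: F.oct_basis)
  have Nv3: "N v3 = 0" by (simp add: v3_def N_linear)
  have NNu3: "N (N u3) = - v3" by (simp add: N_u3 v3_def)
  have yv: "N u3 \<cdot> v3 = v3" using l l0 by (simp add: N_u3 v3_def x' N_linear bilin)
  have yt: "\<langle>N u3, one'\<rangle> = 0" by simp
  have yv3: "\<langle>N u3, v3\<rangle> = 0" by (simp add: N_u3 v3_def bilin polar_comm[of "N x'"])
  have yu3: "\<langle>N u3, u3\<rangle> = 1"
  proof -
    have "\<langle>N u3, u3\<rangle> + \<langle>N u3, u3\<rangle> = - 1"
      using N_polar[of u3 u3] uv by (simp add: N_polar_N NNu3 bilin polar_comm[of u3] eq_neg_iff_add_eq_0)
    thus ?thesis by (simp add: add_self)
  qed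
  obtain a b p1 p2 p3 q1 q2 q3 where y: "N u3 = oct a b p1 p2 p3 q1 q2 q3" by (rule F.oct_cases)
  have "p3 = 0 \<and> b = 1 \<and> q1 = 0 \<and> q2 = 0"
    using yv unfolding y unfolding U' by (simp add: F.oct_simps)
  moreover have "a + b = 0" using yt unfolding y F.oct_one by (simp add: F.oct_polar)
  moreover have "q3 = 1" using yu3 unfolding y unfolding U' by (simp add: F.oct_polar)
  \<comment> \<open>Only \<open>p1\<close> and \<open>p2\<close> stay free; whether they vanish
    decides between the two forms.\<close>
  ultimately have y: "N u3 = oct (- 1) 1 p1 p2 0 0 0 1" using y by (simp add: eq_neg_iff_add_eq_0[symmetric])
  have Nz: "N z = 0" if z: "z = oct 0 0 k1 k2 0 0 0 0" for z k1 k2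
  proof -
    obtain a' b' p1' p2' p3' q1' q2' q3' where z': "N z = oct a' b' p1' p2' p3' q1' q2' q3'" by (rule F.oct_cases)
    \<comment> \<open>\<open>v3\<close> is fixed and annihilates \<open>z\<close> on both sides, so
      it also annihilates \<open>N z\<close>. With the trace this leaves the coordinates at
      \<open>u 1\<close>, \<open>u 2\<close> and \<open>v 3\<close>.\<close>
    have vz: "v3 \<cdot> z = 0" "z \<cdot> v3 = 0" unfolding z U' F.oct_zero by (simp_all add: F.oct_simps)
    have "N (v3 \<cdot> z) = v3 \<cdot> N z" "N (z \<cdot> v3) = N z \<cdot> v3" by (simp_all add: N_mul Nv3)
    hence vz': "v3 \<cdot> N z = 0" "N z \<cdot> v3 = 0" by (simp_all add: vz)
    have tz: "\<langle>N z, one'\<rangle> = 0" by simp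
    have "a' = 0 \<and> p3' = 0 \<and> q1' = 0 \<and> q2' = 0"
      using vz'(1) unfolding z' unfolding U' F.oct_zero by (simp add: F.oct_simps)
    moreover have "a' + b' = 0" using tz unfolding z' F.oct_one by (simp add: F.oct_polar)
    ultimately have z': "N z = oct 0 0 p1' p2' 0 0 0 q3'" using z' by simp
    have rank: "\<exists>k. N (N w) = s k v3" for w
    proof -
      have "N (N w) = s (- (\<langle>N (N x'), w\<rangle> / \<langle>N (N x'), x'\<rangle>)) v3"
        using rank_one[OF no, of x' w] x'B by (simp add: v3_def)
      thus ?thesis ..
    qed
    have NNz: "N (N z) = 0"
    proof -
      have "\<langle>N (N x'), z\<rangle> = - \<langle>v3, z\<rangle>" by (simp add: v3_def bilin)
      also have "\<dots> = 0" by (simp add: z U' F.oct_simps)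
      finally show ?thesis using rank_one[OF no, of x' z] x'B by simp
    qed
    obtain k where k: "N (N (u3 \<cdot> z)) = s k v3" using rank by blast
    \<comment> \<open>The image of \<open>N\<^sup>2\<close> is the line of \<open>v3\<close>, so
      \<open>N u3 \<cdot> N z\<close> is a multiple of \<open>v3\<close>, which forces
      \<open>p1'\<close> and \<open>p2'\<close> to vanish.\<close>
    have "N (N (u3 \<cdot> z)) = N u3 \<cdot> N z + N u3 \<cdot> N z"
      by (simp add: N_mul N_linear NNz NNu3 vz vz' bilin)
    hence "s k v3 = - (N u3 \<cdot> N z)" using k by (simp add: scale_add_self)
    hence "p1' = 0 \<and> p2' = 0" unfolding z' y unfolding U' by (simp add: F.oct_simps)
    moreover have "q3' = 0"
    proof -
      have "\<langle>N z, u3\<rangle> + \<langle>z, N u3\<rangle> + \<langle>N z, N u3\<rangle> = 0" by (rule N_polar)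
      thus ?thesis unfolding z' y unfolding z U' using \<open>p1' = 0 \<and> p2' = 0\<close> by (simp add: F.oct_simps)
    qed
    ultimately show ?thesis using z' by (simp add: F.oct_zero)
  qed
  show ?thesis
  proof (cases "p1 = 0 \<and> p2 = 0")
    case True
    have "N u3 = v 3 - (e1 - e2)" unfolding y using True by (simp add: F.oct_basis F.oct_simps)
    moreover have "N u1 = 0" "N u2 = 0" using Nz[OF U'(3)] Nz[OF U'(4)] by simp_all
    ultimately have "short_root_form e1 e2 u v \<tau>"
      unfolding short_root_form_def U by (simp add: tau_eq)
    thus ?thesis using F.canonical by blast
  next
    case False
    \<comment> \<open>A change of \<open>u1\<close>, \<open>u2\<close> with determinant
      \<open>1\<close> keeps \<open>u1 \<cdot> u2 = v3\<close> and \<open>e1\<close>,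
      \<open>e2\<close>, and makes the free part of \<open>N u3\<close> the second basis vector
      \<open>w2\<close>.\<close>
    then obtain c d where cd: "c * p2 - d * p1 = 1"
    proof (cases "p2 = 0")
      case True
      thus thesis using False that[of 0 "- 1 / p1"] by simp
    next
      case False
      thus thesis using that[of "1 / p2" 0] by simp
    qed
    define w1 w2 where "w1 = oct 0 0 c d 0 0 0 0" and "w2 = oct 0 0 p1 p2 0 0 0 0"
    have cd': "p2 * c = 1 + d * p1" "c * p2 = 1 + d * p1" using cd by (simp_all add: algebra_simps)
    have w12: "w1 \<cdot> w2 = v3" using cd' by (simp add: w1_def w2_def U' F.oct_simps algebra_simps)
    have tr': "triad w1 w2 u3"
      unfolding triad_def w12 unfolding w1_def w2_def U' F.oct_one by (simp add: F.oct_simps)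
    have "w1 \<cdot> (w2 \<cdot> u3) = - e1" 
      using cd' by (simp add: w1_def w2_def U' F.oct_basis F.oct_simps algebra_simps)
    hence can': "canonical_basis s mul one' e1 e2 (triple w1 w2 u3) (triple (w2 \<cdot> u3) (u3 \<cdot> w1) v3)"
      using triad_canonical_basis[OF tr'] F.one_eq by (simp add: w12)
    have Nw: "N w1 = 0" "N w2 = 0" by (rule Nz[OF w1_def], rule Nz[OF w2_def])
    have "N u3 = w2 + v3 - (e1 - e2)" unfolding y w2_def U'(2) by (simp add: F.oct_basis F.oct_simps)
    hence "mixed_form e1 e2 (triple w1 w2 u3) (triple (w2 \<cdot> u3) (u3 \<cdot> w1) v3) \<tau>"
      unfolding mixed_form_def by (simp add: tau_eq Nw)
    thus ?thesis using can' by blast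
  qed
qed

end


section \<open>Symmetric composition and change of idempotent\<close>

context octonion_order3
begin

abbreviation star :: "'v \<Rightarrow> 'v \<Rightarrow> 'v" (infixl "\<star>" 70) where "star \<equiv> petersson s mul one' n \<tau>"

lemma star_eq: "x \<star> y = \<tau> (cnj x) \<cdot> \<tau> (\<tau> (cnj y))"
  by (simp add: petersson_def)

lemma star_bilin:
  "(x + y) \<star> z = x \<star> z + y \<star> z" "z \<star> (x + y) = z \<star> x + z \<star> y"
  "s a x \<star> y = s a (x \<star> y)" "x \<star> s a y = s a (x \<star> y)"
  by (simp_all add: star_eq cnj_add cnj_scale tau_simps bilin)

lemma star_uminus: "- x \<star> y = - (x \<star> y)" "x \<star> - y = - (x \<star> y)"
  using star_bilin(3)[of "- 1" x y] star_bilin(4)[of x "- 1" y] by simp_all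

lemma star_diff: "(x - y) \<star> z = x \<star> z - y \<star> z" "z \<star> (x - y) = z \<star> x - z \<star> y"
  using star_bilin(1)[of x "- y" z] star_bilin(2)[of z x "- y"] by (simp_all add: star_uminus)

lemma star_zero [simp]: "0 \<star> x = 0" "x \<star> 0 = 0"
  using star_bilin(3)[of 0 0 x] star_bilin(4)[of x 0 0] by simp_all

lemma star_norm: "n (x \<star> y) = n x * n y"
  by (simp add: star_eq norm_mult tau_simps)

text \<open>An associative polar form together with a multiplicative norm makes \<open>star\<close>
  a symmetric composition product; these two properties carry the passage to another
  idempotent.\<close>

lemma star_polar: "\<langle>x \<star> y, z\<rangle> = \<langle>x, y \<star> z\<rangle>"
proof -
  have "\<langle>x \<star> y, z\<rangle> = \<langle>\<tau> (cnj x), z \<cdot> \<tau> (\<tau> y)\<rangle>"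
    by (simp add: star_eq adjoint_right tau_simps)
  also have "\<dots> = \<langle>\<tau> x, \<tau> (\<tau> (cnj y)) \<cdot> cnj z\<rangle>"
    using polar_cnj[of "\<tau> (cnj x)" "z \<cdot> \<tau> (\<tau> y)"] by (simp add: cnj_mul tau_simps)
  also have "\<dots> = \<langle>\<tau> (\<tau> (\<tau> x)), \<tau> (\<tau> (\<tau> (\<tau> (cnj y)) \<cdot> cnj z))\<rangle>" by (simp only: tau_simps(8))
  also have "\<dots> = \<langle>x, y \<star> z\<rangle>" by (simp add: tau_simps(3) tau3 star_eq)
  finally show ?thesis .
qed

lemma star_polar_left: "\<langle>x \<star> y, x \<star> z\<rangle> = n x * \<langle>y, z\<rangle>"
  by (simp add: polar_def star_norm star_bilin[symmetric] algebra_simps)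

lemma star_polar_right: "\<langle>y \<star> x, z \<star> x\<rangle> = n x * \<langle>y, z\<rangle>"
  by (simp add: polar_def star_norm star_bilin[symmetric] algebra_simps)

lemma star_flex: "(x \<star> y) \<star> x = s (n x) y" "x \<star> (y \<star> x) = s (n x) y"
proof -
  show "(x \<star> y) \<star> x = s (n x) y"
    by (rule polar_eqI) (subst star_polar, simp add: star_polar_left polar_scale')
  have "\<langle>x \<star> (y \<star> x), z\<rangle> = n x * \<langle>y, z\<rangle>" for z
    using star_polar[of z x "y \<star> x"] star_polar_right[of z x y] by (simp add: polar_comm)
  thus "x \<star> (y \<star> x) = s (n x) y" by (intro polar_eqI) (simp add: polar_scale')
qed

lemma star_flex_linear: "(x \<star> y) \<star> z + (z \<star> y) \<star> x = s \<langle>x, z\<rangle> y" "x \<star> (y \<star> z) + z \<star> (y \<star> x) = s \<langle>x, z\<rangle> y"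
  using star_flex[of "x + z" y] star_flex[of x y] star_flex[of z y]
  by (simp_all add: star_bilin norm_add bilin algebra_simps)

end

locale petersson_idempotent = octonion_order3 s mul one' n \<tau>
  for s :: "'f::field \<Rightarrow> 'v::ab_group_add \<Rightarrow> 'v" and mul (infixl "\<cdot>" 70) and one' n \<tau> +
  fixes f :: 'v
  assumes f_idem: "f \<star> f = f" and f_nz: "f \<noteq> 0"
begin

text \<open>Kaplansky's construction of a unital algebra from a symmetric composition product. For
  \<open>f = one'\<close> this formula and the next return the original product and
  \<open>\<tau>\<close>.\<close>

definition mulf :: "'v \<Rightarrow> 'v \<Rightarrow> 'v" where "mulf x y = (f \<star> x) \<star> (y \<star> f)"
definition tauf :: "'v \<Rightarrow> 'v" where "tauf x = f \<star> (f \<star> x)"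

lemma f_norm: "n f = 1"
proof -
  have "n f * n f = n f" using star_norm[of f f] f_idem by simp
  moreover have "n f \<noteq> 0" using star_flex(1)[of f f] f_idem f_nz by auto
  ultimately show ?thesis by simp
qed

lemma f_flex: "(f \<star> x) \<star> f = x" "f \<star> (x \<star> f) = x"
  by (simp_all add: star_flex f_norm)

lemma tauf_eq: "tauf x = s \<langle>x, f\<rangle> f - x \<star> f"
  using star_flex_linear(2)[of f f x] f_idem by (simp add: tauf_def polar_comm eq_diff_eq)

lemma f_right: "(x \<star> f) \<star> f = s \<langle>x, f\<rangle> f - f \<star> x"
  using star_flex_linear(1)[of x f f] f_idem by (simp add: eq_diff_eq)

lemma f_polar: "\<langle>f \<star> x, f\<rangle> = \<langle>x, f\<rangle>" "\<langle>x \<star> f, f\<rangle> = \<langle>x, f\<rangle>"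
  using star_polar_left[of f x f] star_polar_right[of x f f] by (simp_all add: f_idem f_norm)

text \<open>\<open>f_flex\<close> makes \<open>f\<close> a two-sided unit, and the norm is
  unchanged. Everything known for octonion algebras becomes available with unit
  \<open>f\<close>.\<close>

sublocale O: octonion_algebra s mulf f n
proof unfold_locales
  show "vector_space.dim s UNIV = 8" by (rule dim8)
qed (use char3 nonsingular in \<open>auto simp: mulf_def star_bilin bilin star_norm norm_scale f_norm f_flex f_idem\<close>)

text \<open>The polar form of the new algebra is the old one, so its notation would make terms ambiguous.\<close>

no_notation O.ip ("\<langle>_, _\<rangle>")

lemma tauf_f [simp]: "tauf f = f"
  by (simp add: tauf_def f_idem)

text \<open>Linearized flexibility trades a left factor \<open>f\<close> in front of a product for a
  right factor \<open>f\<close> inside it. Used twice, it reaches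
  \<open>(x \<star> f) \<star> (y \<star> f)\<close>, to be compared through
  \<open>tauf_eq\<close>.\<close>

lemma tauf_star: "tauf (x \<star> y) = tauf x \<star> tauf y"
proof -
  have 1: "f \<star> (x \<star> y) = s \<langle>f, y\<rangle> x - y \<star> (x \<star> f)"
    using star_flex_linear(2)[of f x y] by (simp add: eq_diff_eq)
  have 2: "f \<star> (y \<star> (x \<star> f)) = s \<langle>x, f\<rangle> y - (x \<star> f) \<star> (y \<star> f)"
    using star_flex_linear(2)[of f y "x \<star> f"] f_polar(2)[of x] by (simp add: eq_diff_eq polar_comm)
  have "tauf (x \<star> y) = s \<langle>y, f\<rangle> (f \<star> x) - s \<langle>x, f\<rangle> y + (x \<star> f) \<star> (y \<star> f)"
    by (simp add: tauf_def 1 2 star_diff star_bilin polar_comm[of f y])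
  also have "\<dots> = tauf x \<star> tauf y"
    by (simp add: tauf_eq star_diff star_bilin f_idem f_flex f_right bilin algebra_simps)
  finally show ?thesis .
qed

text \<open>The third power of left multiplication by \<open>f\<close> is the conjugation
  \<open>J\<close> of the new algebra, an involution; \<open>tauf\<close> is the square of that
  multiplication.\<close>

lemma tauf3: "tauf (tauf (tauf x)) = x"
proof -
  define J where "J x = s \<langle>x, f\<rangle> f - x" for x
  have L2: "f \<star> (f \<star> x) = J (x \<star> f)" for x
    using tauf_eq[of x] by (simp add: tauf_def J_def f_polar)
  have LJ: "f \<star> J x = J (f \<star> x)" for x
    by (simp add: J_def star_diff star_bilin f_idem f_polar)
  have "f \<star> (f \<star> (f \<star> x)) = J x" for x using L2[of "f \<star> x"] by (simp add: f_flex)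
  moreover have "J (J x) = x" for x
    by (simp add: J_def polar_diff polar_scale' O.polar_one_one two)
  ultimately show ?thesis by (simp add: tauf_def LJ)
qed

lemma tauf_auto: "automorphism s mulf n tauf"
proof (rule O.automorphismI)
  fix x y a
  show "tauf (mulf x y) = mulf (tauf x) (tauf y)"
    by (simp add: mulf_def tauf_star)
  show "n (tauf x) = n x" by (simp add: tauf_def star_norm f_norm)
  show "tauf (x + y) = tauf x + tauf y" "tauf (s a x) = s a (tauf x)" by (simp_all add: tauf_def star_bilin)
  show "bij tauf" by (rule bij_betwI[of _ _ _ "tauf \<circ> tauf"]) (auto simp: tauf3)
qed

text \<open>The new conjugation followed by \<open>tauf\<close> is right multiplication by
  \<open>f\<close>, and one more \<open>tauf\<close> turns it into left multiplication by
  \<open>f\<close>; the factors \<open>f\<close> in \<open>mulf\<close> undo both.\<close>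

lemma star_petersson: "star = petersson s mulf f n tauf"
proof (intro ext)
  fix x y
  have J: "tauf (conjugation s f n x) = x \<star> f" for x
    by (simp add: conjugation_def tauf_def star_diff star_bilin f_idem)
      (use tauf_eq[of x] in \<open>simp add: tauf_def algebra_simps\<close>)
  have "tauf (tauf (conjugation s f n y)) = f \<star> y"
    by (simp add: J) (simp add: tauf_def f_flex)
  moreover have "petersson s mulf f n tauf x y =
      mulf (tauf (conjugation s f n x)) (tauf (tauf (conjugation s f n y)))" by (rule petersson_def)
  ultimately show "x \<star> y = petersson s mulf f n tauf x y"
    by (simp add: J mulf_def f_flex)
qed

lemma centralizer_iff: "x \<in> centralizer star f \<longleftrightarrow> tauf x = x"
proof
  assume "tauf x = x"
  hence "(f \<star> (f \<star> x)) \<star> f = x \<star> f" by (simp add: tauf_def)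
  thus "x \<in> centralizer star f" by (simp add: f_flex centralizer_def)
qed (simp add: centralizer_def tauf_def f_flex)

lemma cayley_mulf: "cayley_algebra s mulf f n"
  unfolding cayley_algebra_def using O.hurwitz_algebra_axioms dim8 by simp

text \<open>The orbit of \<open>u\<close> under \<open>tauf\<close> is a triad of the Cayley algebra with unit \<open>f\<close>.\<close>

lemma split_okuboI:
  assumes "n u = 0" "\<langle>u, f\<rangle> = 0" "\<langle>u, u \<star> f\<rangle> = 0" "\<langle>u \<star> u, u\<rangle> = 1"
  shows "split_okubo_algebra s star n"
proof -
  note A = O.automorphismD[OF tauf_auto]
  define x y z where "x = u" and "y = tauf u" and "z = tauf (tauf u)"
  have y: "y = - (u \<star> f)" using assms(2) by (simp add: y_def tauf_eq)
  have z: "z = - (f \<star> u)" unfolding z_def y_def[symmetric] y by (simp add: tauf_def star_uminus f_flex)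
  \<comment> \<open>The new product of \<open>x\<close> and \<open>y\<close> is
    \<open>z \<star> z\<close>, so the trilinear form takes the value
    \<open>\<langle>u \<star> u, u\<rangle>\<close> on the orbit.\<close>
  have "mulf x y = (f \<star> u) \<star> (f \<star> u)"
    using f_right[of u] assms(2) by (simp add: mulf_def x_def y star_uminus)
  hence "mulf x y = z \<star> z" by (simp add: z star_uminus)
  hence "\<langle>mulf x y, z\<rangle> = \<langle>tauf (tauf (u \<star> u)), tauf (tauf u)\<rangle>" by (simp add: z_def tauf_star)
  also have "\<dots> = 1" using assms(4) by (simp only: A)
  finally have xyz: "\<langle>mulf x y, z\<rangle> = 1" .
  have t: "\<langle>tauf w, f\<rangle> = \<langle>w, f\<rangle>" for w using A(9)[of w f] by simp
  have xy: "\<langle>x, y\<rangle> = 0" using assms(3) by (simp add: x_def y polar_uminus)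
  have yz: "\<langle>y, z\<rangle> = 0" using xy A(9)[of x y] by (simp add: x_def y_def z_def)
  have "\<langle>z, x\<rangle> = 0" using yz A(9)[of y z] by (simp add: x_def y_def z_def tauf3)
  hence tr: "O.triad x y z"
    using assms xyz xy yz by (simp add: O.triad_def x_def y_def z_def t A(4))
  have r: "tauf x = y" "tauf y = z" "tauf z = x" by (simp_all add: x_def y_def z_def tauf3)
  have xyz': "mulf y (mulf z x) = mulf x (mulf y z)" using O.triad_mul(7)[OF tr] by simp
  define e1 e2 u' v' where "e1 = - mulf x (mulf y z)" and "e2 = f + mulf x (mulf y z)"
    and "u' = O.triple x y z" and "v' = O.triple (mulf y z) (mulf z x) (mulf x y)"
  have "canonical_basis s mulf f e1 e2 u' v'"
    unfolding e1_def e2_def u'_def v'_def by (rule O.triad_canonical_basis[OF tr])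
  moreover have "tauf e1 = e1" "tauf e2 = e2" by (simp_all add: e1_def e2_def A r xyz')
  moreover have "\<forall>i. tauf (u' i) = u' (i + 1) \<and> tauf (v' i) = v' (i + 1)"
    by (simp add: forall_3 index3 u'_def v'_def A(3) r)
  ultimately show ?thesis
    unfolding split_okubo_algebra_def using cayley_mulf tauf_auto star_petersson by blast
qed

lemma para_hurwitzI:
  assumes "\<And>x. f \<star> (f \<star> x) = x"
  shows "para_hurwitz s UNIV star n 8"
proof -
  have "tauf = id" by (auto simp: tauf_def assms)
  thus ?thesis unfolding para_hurwitz_def
    using O.hurwitz_algebra_axioms dim8 star_petersson by auto
qed

end


section \<open>Automorphisms fixing a quadratic etale subalgebra\<close>

context octonion_algebra
begin

definition nonsingular_on :: "'v set \<Rightarrow> bool" where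
  "nonsingular_on A \<longleftrightarrow> subspace A \<and> (\<forall>x\<in>A. (\<forall>y\<in>A. \<langle>x, y\<rangle> = 0) \<longrightarrow> x = 0)"

lemma hurwitz_nonsingular_on:
  assumes "hurwitz_algebra s A mul' e n"
  shows "nonsingular_on A"
proof -
  interpret A: hurwitz_algebra s A mul' e n by (rule assms)
  show ?thesis using A.carrier_subspace A.nonsingular by (auto simp: nonsingular_on_def)
qed

text \<open>The product and unit hidden in \<open>para_hurwitz\<close> are unknown. Negative
  statements about idempotents are drawn from nonsingularity and dimension of the carrier.\<close>

lemma para_hurwitz_nonsingular_on: "para_hurwitz s A st n d \<Longrightarrow> nonsingular_on A \<and> dim A = d"
  unfolding para_hurwitz_def using hurwitz_nonsingular_on by blast

text \<open>\<open>b\<close> spans a complement of the hyperplane cut out by \<open>f\<close>,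
  unless that is all of \<open>A\<close>. By polarizing \<open>iso\<close>, a vector of the
  hyperplane orthogonal to \<open>b\<close> lies in the radical of \<open>A\<close>.\<close>

lemma isotropic_hyperplane:
  assumes A: "subspace A" "b \<in> A" and iso: "\<And>w. w \<in> A \<Longrightarrow> \<langle>w, f\<rangle> = 0 \<Longrightarrow> n w = 0"
    and b: "\<langle>b, f\<rangle> = 0 \<Longrightarrow> \<forall>y\<in>A. \<langle>y, f\<rangle> = 0"
    and a: "a \<in> A" "\<langle>a, f\<rangle> = 0" "\<langle>a, b\<rangle> = 0" and y: "y \<in> A"
  shows "\<langle>a, y\<rangle> = 0"
proof -
  define w where "w = y - s (\<langle>y, f\<rangle> / \<langle>b, f\<rangle>) b"
  have "w \<in> A" using A y by (simp add: w_def subspace_diff subspace_scale)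
  moreover have "\<langle>w, f\<rangle> = 0" using b y by (cases "\<langle>b, f\<rangle> = 0") (simp_all add: w_def bilin)
  ultimately have "n w = 0" "n (a + w) = 0" using iso A a by (simp_all add: polar_add' subspace_add)
  hence "\<langle>a, w\<rangle> = 0" using iso a by (simp add: norm_add)
  thus ?thesis using a by (simp add: w_def bilin)
qed

text \<open>Dimension \<open>3\<close> leaves room to impose orthogonality to \<open>f\<close> and
  to \<open>b\<close> at once.\<close>

lemma anisotropic_in_hyperplane:
  assumes "nonsingular_on A" "3 \<le> dim A"
  shows "\<exists>a\<in>A. \<langle>a, f\<rangle> = 0 \<and> n a \<noteq> 0"
proof (rule ccontr)
  assume no: "\<not> ?thesis"
  have A: "subspace A" using assms by (simp add: nonsingular_on_def)
  obtain b where b: "b \<in> A" "\<langle>b, f\<rangle> = 0 \<Longrightarrow> \<forall>y\<in>A. \<langle>y, f\<rangle> = 0"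
    using subspace_0[OF A] by (cases "\<forall>y\<in>A. \<langle>y, f\<rangle> = 0") auto
  have "card {f, b} < dim A" using assms(2) card_length[of "[f, b]"] by simp
  then obtain a where "a \<in> A" "a \<noteq> 0" "\<langle>a, f\<rangle> = 0" "\<langle>a, b\<rangle> = 0"
    using exists_orthogonal[of "{f, b}" A] A by auto
  hence "\<langle>a, y\<rangle> = 0" if "y \<in> A" for y
    using isotropic_hyperplane[of A b f a y] A b no that by blast
  thus False using \<open>a \<in> A\<close> \<open>a \<noteq> 0\<close> assms(1) unfolding nonsingular_on_def by blast
qed

text \<open>A unit in \<open>A\<close> spans a complement of its own hyperplane, so a single
  condition has to be imposed.\<close>

lemma anisotropic_orthogonal_one:
  assumes "nonsingular_on A" "2 \<le> dim A" "one' \<in> A"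
  shows "\<exists>a\<in>A. \<langle>a, one'\<rangle> = 0 \<and> n a \<noteq> 0"
proof (rule ccontr)
  assume no: "\<not> ?thesis"
  have A: "subspace A" using assms by (simp add: nonsingular_on_def)
  have "card {one'} < dim A" using assms(2) by simp
  then obtain a where "a \<in> A" "a \<noteq> 0" "\<langle>a, one'\<rangle> = 0"
    using exists_orthogonal[of "{one'}" A] A by auto
  hence "\<langle>a, y\<rangle> = 0" if "y \<in> A" for y
    using isotropic_hyperplane[of A one' one' a y] A assms(3) no that by (auto simp: polar_one_one)
  thus False using \<open>a \<in> A\<close> \<open>a \<noteq> 0\<close> assms(1) unfolding nonsingular_on_def by blast
qed

lemma hurwitz_on_subspaceI:
  assumes "nonsingular_on A" "one' \<in> A" "\<And>x y. x \<in> A \<Longrightarrow> y \<in> A \<Longrightarrow> x \<cdot> y \<in> A"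
  shows "hurwitz_algebra s A mul one' n"
  by unfold_locales
    (use assms in \<open>simp_all add: nonsingular_on_def bilin norm_scale norm_mult\<close>)

lemma family_combination:
  assumes "finite I" and "\<And>a. (\<Sum>i\<in>I. s (a i) (c i)) = 0 \<Longrightarrow> \<forall>i\<in>I. a i = 0" and "card I = 8"
  shows "\<exists>a. z = (\<Sum>i\<in>I. s (a i) (c i))"
proof -
  have "z \<in> span (c ` I)" using family_span[OF assms] by simp
  then obtain a where "z = (\<Sum>x\<in>c ` I. s (a x) x)" using span_finite[of "c ` I"] assms(1) by auto
  hence "z = (\<Sum>i\<in>I. s (a (c i)) (c i))"
    by (simp add: sum.reindex[OF family_independent(1)[OF assms(1,2)]])
  thus ?thesis by (rule exI[of _ "\<lambda>i. a (c i)"])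
qed

end

context octonion_order3
begin

text \<open>The unit is an idempotent whose \<open>tauf\<close> is \<open>\<tau>\<close> itself, so
  its centralizer is the fixed space of \<open>\<tau>\<close>.\<close>

sublocale I: petersson_idempotent s mul one' n \<tau> one'
  by unfold_locales (simp_all add: star_eq tau_simps one_neq_0)

no_notation I.O.ip ("\<langle>_, _\<rangle>")

lemma centralizer_one: "x \<in> centralizer star one' \<longleftrightarrow> N x = 0"
proof -
  have "I.tauf x = \<tau> x" by (simp add: I.tauf_def star_eq tau_simps tau3)
  thus ?thesis by (simp add: I.centralizer_iff N_def)
qed

lemma idempotent_one: "idempotent star one'"
  by (simp add: idempotent_def I.f_idem one_neq_0)

lemma fixed_subalgebra:
  assumes "hurwitz_algebra s A mul one' n" "\<And>x. x \<in> A \<Longrightarrow> N x = 0"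
  shows "centralizer_contains_para_hurwitz s star n one' (dim A)"
proof -
  have A: "subspace A" "one' \<in> A"
    using hurwitz_nonsingular_on[OF assms(1)] hurwitz_algebra.one_closed[OF assms(1)]
    by (simp_all add: nonsingular_on_def)
  have tau_fix: "\<tau> x = x" if "x \<in> A" for x using assms(2)[OF that] by (simp add: N_def)
  have "cnj x \<in> A" if "x \<in> A" for x
    using that A by (simp add: conjugation_def subspace_diff subspace_scale)
  hence "x \<star> y = petersson s mul one' n id x y" if "x \<in> A" "y \<in> A" for x y
    using that tau_fix by (simp add: petersson_def)
  thus ?thesis
    unfolding centralizer_contains_para_hurwitz_def para_hurwitz_def
    using assms centralizer_one by blast
qed

text \<open>\<open>one'\<close> and \<open>a\<close> span a subalgebra because \<open>a\<close>
  squares to a multiple of the unit, and it is nonsingular because \<open>a\<close> is anisotropic.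
  With the converse below, the etale condition becomes one about a single vector.\<close>

lemma quadratic_etale_of_fixed:
  assumes a: "N a = 0" "\<langle>a, one'\<rangle> = 0" "n a \<noteq> 0"
  shows "\<exists>K. quadratic_etale_subalgebra s mul one' n K \<and> (\<forall>x\<in>K. \<tau> x = x)"
proof -
  define K where "K = span {one', a}"
  have K: "x \<in> K \<longleftrightarrow> (\<exists>c d. x = s c one' + s d a)" for x
    unfolding K_def by (simp add: span_insert) (metis add_diff_cancel_left' add_diff_cancel diff_add_cancel)
  have "a \<noteq> 0" using a by auto
  have "one' \<noteq> a" using a by (metis polar_one_one neg_equal_0_iff_equal one_neq_zero)
  have ind: "independent {one', a}"
  proof (rule independent_if_scalars_zero)
    fix f x assume "(\<Sum>x\<in>{one', a}. s (f x) x) = 0" and x: "x \<in> {one', a}"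
    hence 0: "s (f one') one' + s (f a) a = 0" using \<open>one' \<noteq> a\<close> by simp
    hence "\<langle>s (f one') one' + s (f a) a, one'\<rangle> = 0" by simp
    hence "f one' = 0" using a by (simp add: polar_add' polar_scale' polar_one_one)
    thus "f x = 0" using 0 x \<open>a \<noteq> 0\<close> by auto
  qed simp
  have dimK: "dim K = 2" unfolding K_def using dim_span_eq_card_independent[OF ind] \<open>one' \<noteq> a\<close> by simp
  have sub: "subspace K" by (simp add: K_def)
  have non: "nonsingular_on K"
    unfolding nonsingular_on_def
  proof (intro conjI ballI impI)
    fix x assume "x \<in> K" and 0: "\<forall>y\<in>K. \<langle>x, y\<rangle> = 0"
    then obtain c d where x: "x = s c one' + s d a" using K by blast
    have "one' \<in> K" "a \<in> K" by (simp_all add: K_def span_base)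
    hence "\<langle>x, one'\<rangle> = 0" "\<langle>x, a\<rangle> = 0" using 0 by auto
    hence "c = 0" "d = 0" using a polar_comm[of one' a] by (simp_all add: x polar_add' polar_scale' polar_one_one polar_self)
    thus "x = 0" by (simp add: x)
  qed (rule sub)
  have "x \<cdot> y \<in> K" if "x \<in> K" "y \<in> K" for x y
  proof -
    from that obtain c d c' d' where "x = s c one' + s d a" "y = s c' one' + s d' a" using K by blast
    hence "x \<cdot> y = s (c * c') one' + s (c * d') a + (s (d * c') a + s (d * d') (s (- n a) one'))"
      using square[OF a(2)] by (simp add: bilin mult_ac)
    also have "\<dots> \<in> K" unfolding K_def by (intro span_add span_scale span_base) auto
    finally show ?thesis .
  qed
  hence "hurwitz_algebra s K mul one' n" using non K_def span_base by (intro hurwitz_on_subspaceI) auto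
  hence "quadratic_etale_subalgebra s mul one' n K" by (simp add: quadratic_etale_subalgebra_def dimK)
  moreover have "\<tau> x = x" if "x \<in> K" for x
    using that a(1) by (auto simp: K tau_simps tau_eq[of a])
  ultimately show ?thesis by blast
qed

lemma fixed_of_quadratic_etale:
  assumes "quadratic_etale_subalgebra s mul one' n K" "\<forall>x\<in>K. \<tau> x = x"
  shows "\<exists>a. N a = 0 \<and> \<langle>a, one'\<rangle> = 0 \<and> n a \<noteq> 0"
proof -
  have h: "hurwitz_algebra s K mul one' n" "dim K = 2"
    using assms by (simp_all add: quadratic_etale_subalgebra_def)
  obtain a where "a \<in> K" "\<langle>a, one'\<rangle> = 0" "n a \<noteq> 0"
    using anisotropic_orthogonal_one[OF hurwitz_nonsingular_on[OF h(1)]] hurwitz_algebra.one_closed[OF h(1)] h(2)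
    by auto
  thus ?thesis using assms(2) by (auto simp: N_def)
qed

end

text \<open>\<open>one'\<close> and \<open>k\<close> span the fixed etale subalgebra. Left
  multiplication by \<open>k\<close> commutes with \<open>N\<close>, so the Jordan chain of
  \<open>x\<close> comes with a second one starting at \<open>k \<cdot> x\<close>.\<close>

locale octonion_order3_etale = octonion_order3 s mul one' n \<tau>
  for s :: "'f::field \<Rightarrow> 'v::ab_group_add \<Rightarrow> 'v" and mul (infixl "\<cdot>" 70) and one' n \<tau> +
  fixes k x :: 'v
  assumes k_fixed: "N k = 0" and k_trace: "\<langle>k, one'\<rangle> = 0" and k_norm: "n k \<noteq> 0"
    and x_B: "\<langle>N (N x), x\<rangle> \<noteq> 0"
begin

lemma N_k [simp]: "N (k \<cdot> z) = k \<cdot> N z"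
  by (simp add: N_mul k_fixed)

lemma k_skew: "\<langle>k \<cdot> y, z\<rangle> = - \<langle>y, k \<cdot> z\<rangle>"
  by (rule adjoint_left0[OF k_trace])

lemma k_square: "k \<cdot> (k \<cdot> z) = s (- n k) z"
  by (rule left_square[OF k_trace])

text \<open>Left multiplication by \<open>k\<close> is skew and commutes with the self-adjoint
  \<open>N\<^sup>2\<close>, so \<open>k \<cdot> x\<close> is \<open>B\<close>-orthogonal to
  \<open>x\<close>.\<close>

lemma k_B: "\<langle>k \<cdot> N (N x), x\<rangle> = 0" "\<langle>N (N x), k \<cdot> x\<rangle> = 0" "\<langle>k \<cdot> N (N x), k \<cdot> x\<rangle> = n k * \<langle>N (N x), x\<rangle>"
proof -
  have "\<langle>k \<cdot> N (N x), x\<rangle> = - \<langle>N (N x), k \<cdot> x\<rangle>" by (rule k_skew)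
  moreover have "\<langle>N (N x), k \<cdot> x\<rangle> = \<langle>k \<cdot> N (N x), x\<rangle>" using N2_polar_comm[of x "k \<cdot> x"] by simp
  ultimately have "\<langle>k \<cdot> N (N x), x\<rangle> + \<langle>k \<cdot> N (N x), x\<rangle> = 0" by (simp add: eq_neg_iff_add_eq_0)
  thus "\<langle>k \<cdot> N (N x), x\<rangle> = 0" by (simp add: add_self)
  thus "\<langle>N (N x), k \<cdot> x\<rangle> = 0" using N2_polar_comm[of x "k \<cdot> x"] by simp
qed (rule polar_mul_left)

lemma etale_independent:
  assumes "s a0 x + s a1 (N x) + s a2 (N (N x)) + s b0 (k \<cdot> x) + s b1 (k \<cdot> N x) + s b2 (k \<cdot> N (N x)) +
    s c one' + s d k = 0" (is "?L = 0")
  shows "a0 = 0 \<and> a1 = 0 \<and> a2 = 0 \<and> b0 = 0 \<and> b1 = 0 \<and> b2 = 0 \<and> c = 0 \<and> d = 0"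
proof -
  have *: "p = 0 \<and> q = 0" if "s p (N (N x)) + s q (k \<cdot> N (N x)) = 0" for p q
  proof -
    have "\<langle>s p (N (N x)) + s q (k \<cdot> N (N x)), x\<rangle> = 0" "\<langle>s p (N (N x)) + s q (k \<cdot> N (N x)), k \<cdot> x\<rangle> = 0"
      using that by simp_all
    thus ?thesis using k_B x_B k_norm by (simp add: polar_add' polar_scale')
  qed
  have "N (N ?L) = s a0 (N (N x)) + s b0 (k \<cdot> N (N x))" by (simp add: N_linear k_fixed)
  hence ab0: "a0 = 0" "b0 = 0" using *[of a0 b0] unfolding assms by simp_all
  have "N ?L = s a1 (N (N x)) + s b1 (k \<cdot> N (N x))" by (simp add: N_linear k_fixed ab0)
  hence ab1: "a1 = 0" "b1 = 0" using *[of a1 b1] unfolding assms by simp_all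
  have L: "s a2 (N (N x)) + s b2 (k \<cdot> N (N x)) + s c one' + s d k = 0" using assms by (simp add: ab0 ab1)
  have f: "\<langle>N z, one'\<rangle> = 0" "\<langle>N z, k\<rangle> = 0" "\<langle>k \<cdot> N z, one'\<rangle> = 0" "\<langle>k \<cdot> N z, k\<rangle> = 0" for z
    using N_polar_fixed(1)[OF k_fixed, of "k \<cdot> z"] N_polar_fixed(1)[of one' "k \<cdot> z"]
    by (simp_all add: N_polar_fixed k_fixed)
  have "\<langle>s a2 (N (N x)) + s b2 (k \<cdot> N (N x)) + s c one' + s d k, one'\<rangle> = 0"
    "\<langle>s a2 (N (N x)) + s b2 (k \<cdot> N (N x)) + s c one' + s d k, k\<rangle> = 0" by (simp_all add: L)
  hence cd: "c = 0" "d = 0"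
    using k_trace k_norm polar_comm[of one' k] by (simp_all add: f polar_add' polar_scale' polar_one_one polar_self)
  thus ?thesis using *[of a2 b2] L ab0 ab1 by simp
qed

lemma etale_segre: "segre_symbol s N [3, 3, 1, 1]"
proof (rule segre_symbolI[where x = "\<lambda>i. [x, k \<cdot> x, one', k] ! i"])
  show "Vector_Spaces.linear s s N" by (intro linear_endoI) (simp_all add: N_linear)
  fix i assume "i < length [3, 3, 1, 1::nat]"
  thus "(N ^^ ([3, 3, 1, 1] ! i)) ([x, k \<cdot> x, one', k] ! i) = 0"
    by (auto simp: less_Suc_eq eval_nat_numeral k_fixed)
next
  fix a assume "(\<Sum>i<length [3, 3, 1, 1::nat]. \<Sum>j<[3, 3, 1, 1] ! i. s (a i j) ((N ^^ j) ([x, k \<cdot> x, one', k] ! i))) = 0"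
  hence "s (a 0 0) x + s (a 0 1) (N x) + s (a 0 2) (N (N x)) + s (a 1 0) (k \<cdot> x) + s (a 1 1) (k \<cdot> N x) +
      s (a 1 2) (k \<cdot> N (N x)) + s (a 2 0) one' + s (a 3 0) k = 0"
    by (simp add: eval_nat_numeral lessThan_Suc ac_simps)
  from etale_independent[OF this]
  show "\<forall>i<length [3, 3, 1, 1::nat]. \<forall>j<[3, 3, 1, 1] ! i. a i j = 0"
    by (auto simp: less_Suc_eq eval_nat_numeral)
qed auto

lemma etale_combination:
  "\<exists>a0 a1 a2 b0 b1 b2 c d. z = s a0 x + s a1 (N x) + s a2 (N (N x)) + s b0 (k \<cdot> x) + s b1 (k \<cdot> N x) +
    s b2 (k \<cdot> N (N x)) + s c one' + s d k"
proof -
  define e where "e i = [x, N x, N (N x), k \<cdot> x, k \<cdot> N x, k \<cdot> N (N x), one', k] ! i" for i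
  have e: "(\<Sum>i<8. s (a i) (e i)) = s (a 0) x + s (a 1) (N x) + s (a 2) (N (N x)) + s (a 3) (k \<cdot> x) +
      s (a 4) (k \<cdot> N x) + s (a 5) (k \<cdot> N (N x)) + s (a 6) one' + s (a 7) k" for a
    by (simp add: e_def eval_nat_numeral lessThan_Suc ac_simps)
  have ind: "\<forall>i\<in>{..<8}. a i = 0" if "(\<Sum>i<8. s (a i) (e i)) = 0" for a
    using etale_independent[OF that[unfolded e]] by (auto simp: eval_nat_numeral less_Suc_eq)
  have "\<exists>a. z = (\<Sum>i<8. s (a i) (e i))"
    by (rule family_combination[OF finite_lessThan]) (erule ind, simp)
  then obtain a :: "nat \<Rightarrow> 'f" where "z = s (a 0) x + s (a 1) (N x) + s (a 2) (N (N x)) + s (a 3) (k \<cdot> x) +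
      s (a 4) (k \<cdot> N x) + s (a 5) (k \<cdot> N (N x)) + s (a 6) one' + s (a 7) k"
    unfolding e by blast
  thus ?thesis by (intro exI)
qed

text \<open>The fixed space has dimension \<open>4\<close>, but its intersection with the image of \<open>N\<^sup>2\<close> lies in its radical.\<close>

lemma etale_no_fixed_nonsingular:
  assumes "nonsingular_on A" "3 \<le> dim A" "\<And>a. a \<in> A \<Longrightarrow> N a = 0"
  shows False
proof -
  have "card {one', k} < dim A" using assms(2) card_length[of "[one', k]"] by simp
  then obtain a where a: "a \<in> A" "a \<noteq> 0" "\<langle>a, one'\<rangle> = 0" "\<langle>a, k\<rangle> = 0"
    using exists_orthogonal[of "{one', k}" A] assms(1) by (auto simp: nonsingular_on_def)
  obtain a0 a1 a2 b0 b1 b2 c d where ac: "a = s a0 x + s a1 (N x) + s a2 (N (N x)) + s b0 (k \<cdot> x) +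
      s b1 (k \<cdot> N x) + s b2 (k \<cdot> N (N x)) + s c one' + s d k" using etale_combination by blast
  have "N a = 0" by (rule assms(3)[OF a(1)])
  hence "s 0 x + s a0 (N x) + s a1 (N (N x)) + s 0 (k \<cdot> x) + s b0 (k \<cdot> N x) + s b1 (k \<cdot> N (N x)) + s 0 one' + s 0 k = 0"
    by (simp add: ac N_linear k_fixed add.assoc)
  from etale_independent[OF this] have 0: "a0 = 0" "a1 = 0" "b0 = 0" "b1 = 0" by simp_all
  have "\<langle>k \<cdot> N z, one'\<rangle> = 0" "\<langle>k \<cdot> N z, k\<rangle> = 0" for z
    using N_polar_fixed(1)[OF k_fixed, of "k \<cdot> z"] N_polar_fixed(1)[of one' "k \<cdot> z"] by simp_all
  hence "c = 0" "d = 0" using a(3,4) k_trace k_norm polar_comm[of one' k]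
    by (simp_all add: ac 0 polar_add' polar_scale' polar_one_one N_polar_fixed k_fixed polar_self)
  \<comment> \<open>A fixed vector orthogonal to \<open>one'\<close> and \<open>k\<close> lies in
    the image of \<open>N\<^sup>2\<close>, which is orthogonal to every fixed vector.\<close>
  hence "a = N (N (s a2 x + s b2 (k \<cdot> x)))" by (simp add: ac 0 N_linear)
  hence "\<langle>a, y\<rangle> = 0" if "y \<in> A" for y
    using N_polar_fixed(1)[OF assms(3)[OF that]] by simp
  thus False using a assms(1) by (auto simp: nonsingular_on_def)
qed

end

section \<open>Large nonsingular fixed subspaces\<close>

context octonion_order3
begin

text \<open>If \<open>N\<^sup>2\<close> were not zero, \<open>A\<close> would itself supply the
  vector \<open>k\<close> of the etale setting, whose fixed space is too degenerate to contain
  \<open>A\<close>. This excludes para-quaternion subalgebras in the etale case and drives the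
  uniqueness of the quaternionic idempotent.\<close>

lemma fixed_subspace_square_zero:
  assumes "nonsingular_on A" "3 \<le> dim A" "\<And>a. a \<in> A \<Longrightarrow> N a = 0"
  shows "N (N z) = 0"
proof (rule ccontr)
  assume "N (N z) \<noteq> 0"
  then obtain x where x: "\<langle>N (N x), x\<rangle> \<noteq> 0" using exists_B_anisotropic by blast
  obtain k where "k \<in> A" "\<langle>k, one'\<rangle> = 0" "n k \<noteq> 0" using anisotropic_in_hyperplane[OF assms(1,2)] by blast
  then interpret octonion_order3_etale s mul one' n \<tau> k x by unfold_locales (use assms(3) x in auto)
  show False by (rule etale_no_fixed_nonsingular[OF assms])
qed

lemma etale_quadratic_idempotent:
  assumes "quadratic_etale_subalgebra s mul one' n K" "\<forall>x\<in>K. \<tau> x = x" "N (N z) \<noteq> 0"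
  shows "quadratic_idempotent s star n one'"
proof -
  have h: "hurwitz_algebra s K mul one' n" "dim K = 2"
    using assms by (simp_all add: quadratic_etale_subalgebra_def)
  have "centralizer_contains_para_hurwitz s star n one' 2"
    using fixed_subalgebra[OF h(1)] assms(2) by (simp add: h N_def)
  moreover have "\<not> centralizer_contains_para_hurwitz s star n one' 4"
  proof
    assume "centralizer_contains_para_hurwitz s star n one' 4"
    then obtain A where A: "A \<subseteq> centralizer star one'" "nonsingular_on A" "dim A = 4"
      unfolding centralizer_contains_para_hurwitz_def using para_hurwitz_nonsingular_on by blast
    have "N a = 0" if "a \<in> A" for a using A(1) that centralizer_one by blast
    thus False using fixed_subspace_square_zero[OF A(2)] A(3) assms(3) by simp
  qed
  ultimately show ?thesis using idempotent_one by (simp add: quadratic_idempotent_def)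
qed

end


context octonion_order3_etale
begin

text \<open>
  When \<open>n k = -1\<close> the eigenspaces of left multiplication by \<open>k\<close> for \<open>1\<close> and \<open>-1\<close> are totally isotropic.
  The vectors \<open>u = x + k x\<close> and \<open>u' = x - k x\<close> are eigenvectors, and the pairings between the
  \<open>N\<close>-orbits of \<open>u\<close> and \<open>u'\<close> show that \<open>u\<close>, \<open>\<tau> u\<close>, \<open>\<tau>\<^sup>2 u\<close> is a triad up to a scalar.
\<close>

lemma orbit_product_neq_0:
  assumes nk: "n k = - 1" and x: "\<langle>x, one'\<rangle> = 0" "\<langle>x, k\<rangle> = 0"
  defines "u \<equiv> x + k \<cdot> x"
  shows "\<langle>u, one'\<rangle> = 0" "n u = 0" "\<langle>u, \<tau> u\<rangle> = 0" "\<langle>u \<cdot> \<tau> u, \<tau> (\<tau> u)\<rangle> \<noteq> 0"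
proof -
  define u' where "u' = x - k \<cdot> x"
  have kk: "k \<cdot> (k \<cdot> z) = z" for z by (simp add: k_square nk)
  have kone: "\<langle>k, k\<rangle> = 1" "\<langle>one', k\<rangle> = 0" using k_trace by (simp_all add: polar_self nk polar_comm)
  have plus: "\<langle>a, b\<rangle> = 0" if "k \<cdot> a = a" "k \<cdot> b = b" for a b
  proof -
    have "\<langle>a, b\<rangle> = - \<langle>a, b\<rangle>" using k_skew[of a b] that by simp
    thus ?thesis by (simp add: eq_neg_iff_add_eq_0 add_self)
  qed
  have minus: "\<langle>a, b\<rangle> = 0" if "k \<cdot> a = - a" "k \<cdot> b = - b" for a b
  proof -
    have "\<langle>a, b\<rangle> = - \<langle>a, b\<rangle>" using k_skew[of a b] that by (simp add: polar_uminus)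
    thus ?thesis by (simp add: eq_neg_iff_add_eq_0 add_self)
  qed
  have k_prod: "k \<cdot> (a \<cdot> b) = - (a \<cdot> (k \<cdot> b))" if "\<langle>a, one'\<rangle> = 0" "\<langle>k, a\<rangle> = 0" for a b
    using left_swap[OF k_trace that(1), of b] that by simp
  have prod_k: "(a \<cdot> b) \<cdot> k = - ((a \<cdot> k) \<cdot> b)" if "\<langle>b, one'\<rangle> = 0" "\<langle>b, k\<rangle> = 0" for a b
    using right_swap[OF that(1) k_trace, of a] that by simp
  have anti: "a \<cdot> k = - (k \<cdot> a)" if "\<langle>a, one'\<rangle> = 0" "\<langle>a, k\<rangle> = 0" for a
    using anticommute[OF that(1) k_trace] that by simp
  \<comment> \<open>An eigenvector for \<open>1\<close> times one for \<open>- 1\<close> lands in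
    the etale subalgebra: the part \<open>c0\<close> of the product orthogonal to it both commutes
    and anticommutes with \<open>k\<close>.\<close>
  have mixed: "a \<cdot> b = s \<langle>a, b\<rangle> (one' + k)"
    if a: "k \<cdot> a = a" "\<langle>a, one'\<rangle> = 0" "\<langle>a, k\<rangle> = 0" and b: "k \<cdot> b = - b" "\<langle>b, one'\<rangle> = 0" "\<langle>b, k\<rangle> = 0" for a b
  proof -
    define c where "c = a \<cdot> b"
    have kc: "k \<cdot> c = c" using k_prod[of a b] a b by (simp add: c_def mul_uminus polar_comm[of k])
    have ck: "c \<cdot> k = c" using prod_k[of b a] a b anti[of a] by (simp add: c_def mul_uminus)
    have c1: "\<langle>c, one'\<rangle> = - \<langle>a, b\<rangle>" using adjoint_left0[OF a(2), of b one'] by (simp add: c_def polar_comm[of b])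
    have ck1: "\<langle>c, k\<rangle> = \<langle>a, b\<rangle>" using polar_mul_left[of k c one'] by (simp add: kc nk c1)
    define c0 where "c0 = c + s \<langle>c, one'\<rangle> one' - s \<langle>c, k\<rangle> k"
    have c0: "\<langle>c0, one'\<rangle> = 0" "\<langle>c0, k\<rangle> = 0"
      using k_trace by (simp_all add: c0_def bilin polar_one_one kone)
    have "k \<cdot> c0 = c0 \<cdot> k" by (simp add: c0_def bilin kc ck)
    hence "k \<cdot> c0 = - (k \<cdot> c0)" using anti[OF c0] by simp
    hence "k \<cdot> c0 + k \<cdot> c0 = 0" by (simp only: eq_neg_iff_add_eq_0)
    hence "k \<cdot> c0 = 0" by (simp add: scale_add_self)
    hence "c0 = 0" using kk[of c0] by simp
    thus ?thesis by (simp add: c0_def c1 ck1 bilin diff_eq_eq add.commute flip: c_def)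
  qed
  have xk: "\<langle>k, x\<rangle> = 0" using x by (simp add: polar_comm)
  have ku: "k \<cdot> u = u" "k \<cdot> u' = - u'" by (simp_all add: u_def u'_def bilin kk add.commute)
  define y w y' w' where "y = N u" and "w = N y" and "y' = N u'" and "w' = N y'"
  have kN: "k \<cdot> y = y" "k \<cdot> w = w" "k \<cdot> y' = - y'" "k \<cdot> w' = - w'"
  proof -
    show 1: "k \<cdot> y = y" "k \<cdot> y' = - y'" unfolding y_def y'_def by (metis N_k N_linear(3) ku)+
    show "k \<cdot> w = w" "k \<cdot> w' = - w'" unfolding w_def w'_def by (metis N_k N_linear(3) 1)+
  qed
  have tr: "\<langle>u, one'\<rangle> = 0" "\<langle>u', one'\<rangle> = 0" "\<langle>y, one'\<rangle> = 0" "\<langle>w, one'\<rangle> = 0" "\<langle>y', one'\<rangle> = 0" "\<langle>w', one'\<rangle> = 0"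
    using x k_skew[of x one'] by (simp_all add: u_def u'_def y_def w_def y'_def w'_def bilin)
  have orth_k: "\<langle>u, k\<rangle> = 0" "\<langle>u', k\<rangle> = 0" "\<langle>y, k\<rangle> = 0" "\<langle>w, k\<rangle> = 0" "\<langle>y', k\<rangle> = 0" "\<langle>w', k\<rangle> = 0"
    using x k_skew[of x k] square[OF k_trace]
    by (simp_all add: u_def u'_def y_def w_def y'_def w'_def bilin N_polar_fixed k_fixed nk)
  show "\<langle>u, one'\<rangle> = 0" by (rule tr)
  show nu: "n u = 0" using plus[OF ku(1) ku(1)] by (simp add: polar_self)
  have tau_u: "\<tau> u = u + y" "\<tau> (\<tau> u) = u - y + w"
  proof -
    show 1: "\<tau> u = u + y" by (simp add: y_def tau_eq)
    have "\<tau> (\<tau> u) = u + (y + y) + w" by (simp add: 1 tau_simps) (simp add: y_def w_def tau_eq)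
    thus "\<tau> (\<tau> u) = u - y + w" by (simp only: scale_add_self) simp
  qed
  show "\<langle>u, \<tau> u\<rangle> = 0" using plus ku kN by (simp add: tau_u polar_add')
  have uu: "u \<cdot> u = 0" using square[OF tr(1)] nu by simp
  have yy: "y \<cdot> y = 0" using square[OF tr(3)] plus[OF kN(1) kN(1)] by (simp add: polar_self)
  define p where "p = u \<cdot> y"
  have kp: "k \<cdot> p = - p" using k_prod[of u y] tr orth_k kN by (simp add: p_def polar_comm[of k])
  have pu: "\<langle>p, u\<rangle> = 0" "\<langle>p, y\<rangle> = 0"
    using adjoint_left0[OF tr(1), of y u] adjoint_right0[OF tr(3), of u y] by (simp_all add: p_def uu yy)
  \<comment> \<open>Only this pairing survives the expansion, because \<open>u\<close>,
    \<open>y\<close>, \<open>w\<close> are eigenvectors for the same eigenvalue and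
    \<open>u\<close>, \<open>y\<close> square to zero.\<close>
  have delta: "\<langle>u \<cdot> \<tau> u, \<tau> (\<tau> u)\<rangle> = \<langle>p, w\<rangle>"
    by (simp add: tau_u(2)) (simp add: tau_u(1) bilin uu pu flip: p_def)
  have uw': "\<langle>u, w'\<rangle> \<noteq> 0"
  proof -
    have "\<langle>u, w'\<rangle> = \<langle>N (N x), x\<rangle> + \<langle>N (N x), x\<rangle>"
      using k_B by (simp add: u_def w'_def y'_def u'_def N_linear bilin nk
          polar_comm[of x] polar_comm[of "k \<cdot> x"])
    thus ?thesis using x_B by (simp add: add_self)
  qed
  have yy': "\<langle>y, y'\<rangle> = - \<langle>u, w'\<rangle>"
    using N_polar_N[of u u'] by (simp add: y_def y'_def w'_def N2_polar)
  \<comment> \<open>\<open>p\<close> is tested against \<open>y' \<cdot> w'\<close>: the right-hand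
    side of the exchange identity vanishes, and its second term is computed by
    \<open>mixed\<close>.\<close>
  have "\<langle>u \<cdot> y, y' \<cdot> w'\<rangle> + \<langle>u \<cdot> w', y' \<cdot> y\<rangle> = 0"
    using polar_exchange[of u y y' w'] N2_polar_N[of u' u] by (simp add: y_def w'_def y'_def polar_comm)
  moreover have "u \<cdot> w' = s \<langle>u, w'\<rangle> (one' + k)" using ku kN tr orth_k by (intro mixed)
  moreover have "y' \<cdot> y = s \<langle>y, y'\<rangle> (one' - k)"
  proof -
    have "y \<cdot> y' = s \<langle>y, y'\<rangle> (one' + k)" using ku kN tr orth_k by (intro mixed)
    hence "y' \<cdot> y = - s \<langle>y, y'\<rangle> (one' + one' + k)"
      using anticommute[OF tr(5) tr(3)] by (simp add: polar_comm[of y'] bilin)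
    thus ?thesis by (simp add: scale_add_self bilin)
  qed
  moreover have "\<langle>one' + k, one' - k\<rangle> = 1"
    using k_trace by (simp add: bilin polar_one_one kone two)
  ultimately have "\<langle>p, y' \<cdot> w'\<rangle> = \<langle>u, w'\<rangle> * \<langle>u, w'\<rangle>"
    by (simp add: p_def polar_scale' polar_uminus yy' add_eq_0_iff)
  hence p0: "p \<noteq> 0" using uw' by auto
  \<comment> \<open>\<open>p\<close> is an eigenvector for \<open>- 1\<close>, hence orthogonal to
    \<open>u'\<close>, \<open>y'\<close>, \<open>w'\<close>; it is also orthogonal to
    \<open>u\<close>, \<open>y\<close>, \<open>one'\<close> and \<open>k\<close>. In dimension
    \<open>8\<close> only \<open>w\<close> is left to pair with it.\<close>
  have "\<langle>p, w\<rangle> \<noteq> 0"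
  proof
    assume pw: "\<langle>p, w\<rangle> = 0"
    have p': "\<langle>p, u'\<rangle> = 0" "\<langle>p, y'\<rangle> = 0" "\<langle>p, w'\<rangle> = 0" using minus kp ku kN by blast+
    have p1: "\<langle>p, one'\<rangle> = 0" using adjoint_left0[OF tr(1), of y one'] plus[OF kN(1) ku(1)] by (simp add: p_def)
    have pk: "\<langle>p, k\<rangle> = 0" using polar_mul_left[of k p one'] p1 by (simp add: kp polar_uminus)
    have e: "y = N x + k \<cdot> N x" "w = N (N x) + k \<cdot> N (N x)" "y' = N x - k \<cdot> N x" "w' = N (N x) - k \<cdot> N (N x)"
      by (simp_all add: y_def w_def y'_def w'_def u_def u'_def N_linear)
    have sum: "\<langle>p, z\<rangle> = 0 \<and> \<langle>p, k \<cdot> z\<rangle> = 0" if "\<langle>p, z + k \<cdot> z\<rangle> = 0" "\<langle>p, z - k \<cdot> z\<rangle> = 0" for z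
    proof -
      have eq: "\<langle>p, z\<rangle> = \<langle>p, k \<cdot> z\<rangle>" and 0: "\<langle>p, z\<rangle> + \<langle>p, k \<cdot> z\<rangle> = 0"
        using that by (simp_all add: polar_add' polar_diff)
      have "\<langle>p, k \<cdot> z\<rangle> + \<langle>p, k \<cdot> z\<rangle> = 0" using 0 unfolding eq .
      hence "\<langle>p, k \<cdot> z\<rangle> = 0" by (simp only: add_self neg_equal_0_iff_equal)
      thus ?thesis using eq by simp
    qed
    have px: "\<langle>p, x\<rangle> = 0" "\<langle>p, k \<cdot> x\<rangle> = 0" "\<langle>p, N x\<rangle> = 0" "\<langle>p, k \<cdot> N x\<rangle> = 0" "\<langle>p, N (N x)\<rangle> = 0" "\<langle>p, k \<cdot> N (N x)\<rangle> = 0"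
      using sum[of x] sum[of "N x"] sum[of "N (N x)"] pu pw p' unfolding e[symmetric] u_def u'_def by simp_all
    have "\<langle>p, z\<rangle> = 0" for z
    proof -
      obtain a0 a1 a2 b0 b1 b2 c d where "z = s a0 x + s a1 (N x) + s a2 (N (N x)) + s b0 (k \<cdot> x) +
          s b1 (k \<cdot> N x) + s b2 (k \<cdot> N (N x)) + s c one' + s d k" using etale_combination by blast
      thus ?thesis by (simp add: polar_add' polar_scale' px p1 pk)
    qed
    thus False using p0 nonsingular by blast
  qed
  thus "\<langle>u \<cdot> \<tau> u, \<tau> (\<tau> u)\<rangle> \<noteq> 0" by (simp add: delta)
qed

end

lemma algebraically_closed_root:
  assumes "algebraically_closed_field TYPE('f::field)" "0 < m"
  shows "\<exists>t :: 'f. t ^ m = c"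
proof -
  have "degree (monom (1::'f) m - [:c:]) = m"
  proof (rule antisym)
    show "degree (monom (1::'f) m - [:c:]) \<le> m"
      by (rule degree_diff_le) (simp_all add: degree_monom_le)
    have "coeff (monom (1::'f) m - [:c:]) m = 1" using assms(2) by (simp add: coeff_pCons split: nat.split)
    thus "m \<le> degree (monom (1::'f) m - [:c:])" by (intro le_degree) simp
  qed
  then obtain t where "poly (monom (1::'f) m - [:c:]) t = 0"
    using assms unfolding algebraically_closed_field_def by metis
  thus ?thesis by (auto simp: poly_monom)
qed

section \<open>Cyclic canonical bases and the normalizer of the torus\<close>

context octonion_order3
begin

text \<open>Two roots are taken: a square root brings \<open>n k\<close> to \<open>- 1\<close>, so
  that left multiplication by \<open>k\<close> has eigenvalues \<open>1\<close> and
  \<open>- 1\<close>, and a cube root scales the orbit of \<open>u\<close> to a triad.\<close>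

lemma cyclic_canonical_basis:
  assumes ac: "algebraically_closed_field TYPE('f)"
    and k: "N k = 0" "\<langle>k, one'\<rangle> = 0" "n k \<noteq> 0" and sq: "N (N z) \<noteq> 0"
  shows "\<exists>e1 e2 u v. canonical_basis s mul one' e1 e2 u v \<and> (\<forall>i. \<tau> (u i) = u (i + 1)) \<and>
    (\<forall>i. \<tau> (v i) = v (i + 1)) \<and> \<tau> e1 = e1 \<and> \<tau> e2 = e2"
proof -
  obtain r :: 'f where r: "r ^ 2 = - 1 / n k" using algebraically_closed_root[OF ac] by fastforce
  define k' where "k' = s r k"
  have k': "N k' = 0" "\<langle>k', one'\<rangle> = 0" "n k' = - 1"
    using k r by (simp_all add: k'_def N_linear bilin norm_scale)
  obtain x where x: "\<langle>N (N x), x\<rangle> \<noteq> 0" using exists_B_anisotropic[OF sq] by blast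
  \<comment> \<open>Projection off \<open>one'\<close> and \<open>k'\<close>, whose self-pairings
    are \<open>- 1\<close> and \<open>1\<close>. The form \<open>B\<close> does not change, since
    both vectors are fixed.\<close>
  define x' where "x' = x + s \<langle>x, one'\<rangle> one' - s \<langle>x, k'\<rangle> k'"
  have Nx': "N x' = N x" by (simp add: x'_def N_linear k')
  have x': "\<langle>x', one'\<rangle> = 0" "\<langle>x', k'\<rangle> = 0"
    using k' polar_comm[of one' k'] by (simp_all add: x'_def bilin polar_one_one polar_self)
  have "\<langle>N (N x'), x'\<rangle> = \<langle>N (N x), x\<rangle>"
    unfolding Nx' by (simp add: x'_def bilin N_polar_fixed k')
  then interpret E: octonion_order3_etale s mul one' n \<tau> k' x' by unfold_locales (use x k' in auto)
  note E = E.orbit_product_neq_0[OF k'(3) x']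
  define u where "u = x' + k' \<cdot> x'"
  define d where "d = \<langle>u \<cdot> \<tau> u, \<tau> (\<tau> u)\<rangle>"
  obtain t :: 'f where t: "t ^ 3 = 1 / d" using algebraically_closed_root[OF ac, of 3] by fastforce
  define w1 w2 w3 where "w1 = s t u" and "w2 = \<tau> w1" and "w3 = \<tau> w2"
  have tau: "\<tau> w1 = w2" "\<tau> w2 = w3" "\<tau> w3 = w1" by (simp_all add: w2_def w3_def tau3)
  have iso: "\<langle>w1, w2\<rangle> = 0" using E(3) by (simp add: w2_def w1_def bilin tau_simps flip: u_def)
  hence iso': "\<langle>w2, w3\<rangle> = 0" "\<langle>w3, w1\<rangle> = 0" using tau_simps(8)[of w1 w2] tau_simps(8)[of w2 w3] by (simp_all add: tau)
  have tr1: "\<langle>w1, one'\<rangle> = 0" using E(1) by (simp add: w1_def bilin flip: u_def)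
  have tr: "\<langle>\<tau> y, one'\<rangle> = \<langle>y, one'\<rangle>" for y using tau_simps(8)[of y one'] by (simp add: tau_simps)
  have "\<langle>w1 \<cdot> w2, w3\<rangle> = t ^ 3 * d"
    by (simp add: w3_def w2_def w1_def tau_simps bilin d_def power3_eq_cube)
  also have "\<dots> = 1" using t E(4) by (simp add: d_def flip: u_def)
  finally have w123: "\<langle>w1 \<cdot> w2, w3\<rangle> = 1" .
  have tr2: "\<langle>w2, one'\<rangle> = 0" "\<langle>w3, one'\<rangle> = 0" using tr[of w1] tr[of w2] tr1 by (simp_all add: tau)
  have "n w1 = 0" using E(2) by (simp add: w1_def norm_scale flip: u_def)
  moreover from this have "n w2 = 0" "n w3 = 0" by (simp_all add: w3_def w2_def tau_simps)
  ultimately have triad: "triad w1 w2 w3" using iso iso' tr1 tr2 w123 by (simp add: triad_def)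
  have xyz: "w2 \<cdot> (w3 \<cdot> w1) = w1 \<cdot> (w2 \<cdot> w3)" using triad_mul(7)[OF triad] by simp
  have "\<forall>i. \<tau> (triple w1 w2 w3 i) = triple w1 w2 w3 (i + 1)"
    "\<forall>i. \<tau> (triple (w2 \<cdot> w3) (w3 \<cdot> w1) (w1 \<cdot> w2) i) = triple (w2 \<cdot> w3) (w3 \<cdot> w1) (w1 \<cdot> w2) (i + 1)"
    by (simp_all add: forall_3 index3 tau_simps(3) tau)
  moreover have "\<tau> (- (w1 \<cdot> (w2 \<cdot> w3))) = - (w1 \<cdot> (w2 \<cdot> w3))" "\<tau> (one' + w1 \<cdot> (w2 \<cdot> w3)) = one' + w1 \<cdot> (w2 \<cdot> w3)"
    by (simp_all add: tau_simps tau xyz)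
  ultimately show ?thesis using triad_canonical_basis[OF triad] by blast
qed

lemma cyclic_conjugate_torus:
  assumes "\<forall>i. \<tau> (u i) = u (i + 1)" "\<forall>i. \<tau> (v i) = v (i + 1)" "\<tau> e1 = e1" "\<tau> e2 = e2"
    and t: "t \<in> torus s mul n e1 e2 u v"
  shows "\<tau> \<circ> t \<circ> inv_into UNIV \<tau> \<in> torus s mul n e1 e2 u v"
proof -
  obtain \<alpha> where "torus_point s mul n e1 e2 u v \<alpha> t" using t by (auto simp: torus_def)
  hence \<alpha>: "\<alpha> 1 * \<alpha> 2 * \<alpha> 3 = 1" "automorphism s mul n t" "t e1 = e1" "t e2 = e2"
    "\<And>i. t (u i) = s (\<alpha> i) (u i)" "\<And>i. t (v i) = s (inverse (\<alpha> i)) (v i)"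
    by (auto simp: torus_point_def)
  have inv: "inv_into UNIV \<tau> x = \<tau> (\<tau> x)" for x
  proof (rule inv_f_eq)
    show "inj \<tau>" by (rule inj_on_inverseI[of _ "\<tau> \<circ> \<tau>"]) (simp add: tau3)
  qed (rule tau3)
  \<comment> \<open>The inverse of \<open>\<tau>\<close> is its square and sends \<open>u i\<close>
    to \<open>u (i + 2)\<close>, whence the shift in the parameters.\<close>
  have "torus_point s mul n e1 e2 u v (\<lambda>i. \<alpha> (i + 2)) (\<tau> \<circ> t \<circ> inv_into UNIV \<tau>)"
    unfolding torus_point_def
  proof (intro conjI allI)
    show "\<alpha> (1 + 2) * \<alpha> (2 + 2) * \<alpha> (3 + 2) = 1" using \<alpha>(1) by (simp add: index3 mult_ac)
    show "automorphism s mul n (\<tau> \<circ> t \<circ> inv_into UNIV \<tau>)"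
      by (intro automorphism_comp automorphism_inv tau_auto \<alpha>)
    have i3: "i + 1 + 1 + 1 = (i::3)" "i + 1 + 1 = i + 2" "i + 2 + 1 = i" for i :: 3
      using exhaust_3[of i] by (auto simp: index3)
    show "(\<tau> \<circ> t \<circ> inv_into UNIV \<tau>) (u i) = s (\<alpha> (i + 2)) (u i)"
      "(\<tau> \<circ> t \<circ> inv_into UNIV \<tau>) (v i) = s (inverse (\<alpha> (i + 2))) (v i)" for i
      by (simp_all only: o_apply inv assms(1,2)[rule_format] \<alpha> tau_simps(2) i3)
  qed (simp_all add: inv assms \<alpha>)
  thus ?thesis by (auto simp: torus_def)
qed

lemma cyclic_torus_normalizer:
  assumes "\<forall>i. \<tau> (u i) = u (i + 1)" "\<forall>i. \<tau> (v i) = v (i + 1)" "\<tau> e1 = e1" "\<tau> e2 = e2"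
  shows "\<tau> \<in> torus_normalizer s mul n e1 e2 u v"
proof -
  define c where "c t = \<tau> \<circ> t \<circ> inv_into UNIV \<tau>" for t
  note T = cyclic_conjugate_torus[OF assms, folded c_def]
  have inv: "inv_into UNIV \<tau> x = \<tau> (\<tau> x)" for x
  proof (rule inv_f_eq)
    show "inj \<tau>" by (rule inj_on_inverseI[of _ "\<tau> \<circ> \<tau>"]) (simp add: tau3)
  qed (rule tau3)
  \<comment> \<open>The third iterate of this conjugation is the identity, so stability of the torus
    already gives equality.\<close>
  have ccc: "c (c (c t)) = t" for t by (auto simp: c_def inv tau3 fun_eq_iff)
  have "c ` torus s mul n e1 e2 u v = torus s mul n e1 e2 u v"
  proof (intro equalityI subsetI)
    fix t assume "t \<in> torus s mul n e1 e2 u v"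
    thus "t \<in> c ` torus s mul n e1 e2 u v" using T ccc by (metis imageI)
  qed (use T in auto)
  thus ?thesis using tau_auto by (simp add: torus_normalizer_def c_def[abs_def])
qed

end


section \<open>Extension of scalars\<close>

text \<open>The parameter \<open>t\<close> is the scalar action on the target, so that scalar and
  vector valued maps are treated alike.\<close>

lemma vec_additive_eqI:
  fixes f g :: "'k::field ^ 8 \<Rightarrow> 'w::ab_group_add"
  assumes f: "\<And>x y. f (x + y) = f x + f y" "\<And>c x. f (c *s x) = t c (f x)"
    and g: "\<And>x y. g (x + y) = g x + g y" "\<And>c x. g (c *s x) = t c (g x)"
    and eq: "\<And>i. f (axis i 1) = g (axis i 1)"
  shows "f x = g x"
proof -
  have sum: "h (\<Sum>i\<in>A. c i *s d i) = (\<Sum>i\<in>A. t (c i) (h (d i)))"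
    if "finite A" and h: "\<And>x y. h (x + y) = h x + h y" "\<And>c x. h (c *s x) = t c (h x)"
    for h :: "'k ^ 8 \<Rightarrow> 'w" and A :: "8 set" and c d
    using that(1)
  proof (induction A rule: finite_induct)
    case empty
    have "h 0 = h 0 + h 0" using h(1)[of 0 0] by simp
    thus ?case by simp
  qed (simp add: h)
  have "x = (\<Sum>i\<in>UNIV. x $ i *s axis i 1)" by (simp add: basis_expansion)
  moreover have "f (\<Sum>i\<in>UNIV. x $ i *s axis i 1) = g (\<Sum>i\<in>UNIV. x $ i *s axis i 1)"
    using sum[of UNIV f, OF finite f] sum[of UNIV g, OF finite g] eq by simp
  ultimately show ?thesis by simp
qed

text \<open>\<open>ext_norm\<close> runs over the diagonal and the pairs above it; this relates it
  to a full bilinear sum.\<close>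

lemma sum_symmetric_split:
  fixes f :: "'i::{finite, linorder} \<Rightarrow> 'i \<Rightarrow> 'a::comm_monoid_add"
  shows "(\<Sum>i\<in>UNIV. \<Sum>j\<in>UNIV. f i j) = (\<Sum>i\<in>UNIV. f i i) + (\<Sum>i\<in>UNIV. \<Sum>j\<in>{i<..}. f i j + f j i)"
proof -
  have row: "(\<Sum>j\<in>UNIV. f i j) = f i i + (\<Sum>j\<in>{i<..}. f i j) + (\<Sum>j\<in>{..<i}. f i j)" for i
  proof -
    have "UNIV = insert i ({i<..} \<union> {..<i})" by auto
    hence "(\<Sum>j\<in>UNIV. f i j) = (\<Sum>j\<in>insert i ({i<..} \<union> {..<i}). f i j)" by simp
    also have "\<dots> = f i i + ((\<Sum>j\<in>{i<..}. f i j) + (\<Sum>j\<in>{..<i}. f i j))"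
      by (subst sum.insert) (auto intro!: arg_cong2[of _ _ _ _ "(+)"] sum.union_disjoint)
    finally show ?thesis by (simp add: add.assoc)
  qed
  have "(\<Sum>i\<in>UNIV. \<Sum>j\<in>{..<i}. f i j) = (\<Sum>j\<in>UNIV. \<Sum>i\<in>{j<..}. f i j)"
    using sum.swap_restrict[of "UNIV::'i set" "UNIV::'i set" f "\<lambda>i j. j < i"]
    by (simp add: lessThan_def greaterThan_def)
  thus ?thesis by (simp add: row sum.distrib add.assoc)
qed

locale scalar_extension = vector_space s
  for s :: "'f::field \<Rightarrow> 'v::ab_group_add \<Rightarrow> 'v" +
  fixes b :: "8 \<Rightarrow> 'v" and \<iota> :: "'f \<Rightarrow> 'k::field"
  assumes basis: "basis_family s b" and emb: "field_embedding \<iota>"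
begin

lemma iota_simps [simp]: "\<iota> 1 = 1" "\<iota> (x + y) = \<iota> x + \<iota> y" "\<iota> (x * y) = \<iota> x * \<iota> y" "\<iota> 0 = 0"
  "\<iota> (- x) = - \<iota> x"
proof -
  show "\<iota> 1 = 1" and add: "\<iota> (x + y) = \<iota> x + \<iota> y" and "\<iota> (x * y) = \<iota> x * \<iota> y" for x y
    using emb by (auto simp: field_embedding_def)
  show 0: "\<iota> 0 = 0" using add[of 0 0] by (metis add_0 add_cancel_left_right)
  show "\<iota> (- x) = - \<iota> x" using add[of x "- x"] 0 by (simp add: eq_neg_iff_add_eq_0 add.commute)
qed

lemma iota_eq_0_iff [simp]: "\<iota> x = 0 \<longleftrightarrow> x = 0"
proof
  assume 0: "\<iota> x = 0"
  show "x = 0"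
  proof (rule ccontr)
    assume "x \<noteq> 0"
    hence "\<iota> x * \<iota> (1 / x) = 1" by (simp flip: iota_simps(3))
    thus False using 0 by simp
  qed
qed simp

lemma iota_sum: "\<iota> (sum f A) = (\<Sum>i\<in>A. \<iota> (f i))"
  by (induction A rule: infinite_finite_induct) auto

definition coord :: "'v \<Rightarrow> 8 \<Rightarrow> 'f" where "coord x i = representation (range b) x (b i)"

abbreviation j :: "'v \<Rightarrow> 'k ^ 8" where "j \<equiv> ext_vec s b \<iota>"
abbreviation M :: "('v \<Rightarrow> 'v \<Rightarrow> 'v) \<Rightarrow> 'k ^ 8 \<Rightarrow> 'k ^ 8 \<Rightarrow> 'k ^ 8" where "M \<equiv> ext_mul s b \<iota>"
abbreviation T :: "('v \<Rightarrow> 'v) \<Rightarrow> 'k ^ 8 \<Rightarrow> 'k ^ 8" where "T \<equiv> ext_endo s b \<iota>"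

lemma b_basis: "inj b" "independent (range b)" "span (range b) = UNIV"
  using basis by (auto simp: basis_family_def)

lemma coord_add: "coord (x + y) i = coord x i + coord y i"
  and coord_scale: "coord (s a x) i = a * coord x i"
  and coord_b: "coord (b k) i = (if i = k then 1 else 0)"
  using b_basis by (auto simp: coord_def representation_add representation_scale representation_basis inj_eq)

lemma coord_expansion: "x = (\<Sum>i\<in>UNIV. s (coord x i) (b i))"
proof -
  have "x \<in> span (range b)" by (simp add: b_basis)
  hence "(\<Sum>v\<in>range b. s (representation (range b) x v) v) = x"
    using b_basis(2) by (intro sum_representation_eq) auto
  thus ?thesis by (simp add: sum.reindex[OF b_basis(1)] coord_def)
qed

lemma j_nth: "j x $ i = \<iota> (coord x i)"
  by (simp add: ext_vec_def coord_def)

lemma j_add: "j (x + y) = j x + j y"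
  by (simp add: vec_eq_iff j_nth coord_add)

lemma j_scale: "j (s a x) = \<iota> a *s j x"
  by (simp add: vec_eq_iff j_nth coord_scale)

lemma j_uminus: "j (- x) = - j x"
  using j_scale[of "- 1" x] by (simp add: vec_eq_iff)

lemma j_diff: "j (x - y) = j x - j y"
  using j_add[of x "- y"] by (simp add: j_uminus)

lemma j_b: "j (b i) = axis i 1"
  by (auto simp: vec_eq_iff j_nth coord_b axis_def)

lemma j_inj: "j x = j y \<Longrightarrow> x = y"
proof -
  assume "j x = j y"
  hence "\<iota> (coord (x - y) i) = 0" for i
    using j_nth[of "x - y" i] by (simp add: j_diff)
  hence "x - y = 0" using coord_expansion[of "x - y"] by simp
  thus ?thesis by simp
qed

lemma j_zero [simp]: "j 0 = 0"
  using j_diff[of 0 0] by simp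

lemma ext_eqI:
  fixes f g :: "'k ^ 8 \<Rightarrow> 'w::ab_group_add"
  assumes "\<And>x y. f (x + y) = f x + f y" "\<And>c x. f (c *s x) = t c (f x)"
    and "\<And>x y. g (x + y) = g x + g y" "\<And>c x. g (c *s x) = t c (g x)"
    and "\<And>x. f (j x) = g (j x)"
  shows "f x = g x"
proof (rule vec_additive_eqI[of f t g, OF assms(1-4)])
  fix i show "f (axis i 1) = g (axis i 1)" using assms(5)[of "b i"] by (simp only: j_b)
qed

lemma M_bilin:
  "M m (x + y) z = M m x z + M m y z" "M m z (x + y) = M m z x + M m z y"
  "M m (c *s x) y = c *s M m x y" "M m x (c *s y) = c *s M m x y"
  by (simp_all add: ext_mul_def vec_eq_iff sum.distrib sum_distrib_left algebra_simps)

lemma T_linear: "T d (x + y) = T d x + T d y" "T d (c *s x) = c *s T d x"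
  by (simp_all add: ext_endo_def vec_eq_iff sum.distrib sum_distrib_left algebra_simps)

lemma M_j:
  assumes "\<And>x y z. m (x + y) z = m x z + m y z" "\<And>x y z. m z (x + y) = m z x + m z y"
    "\<And>a x y. m (s a x) y = s a (m x y)" "\<And>a x y. m x (s a y) = s a (m x y)"
  shows "M m (j x) (j y) = j (m x y)"
proof -
  have lin: "j (h x) = (\<Sum>i\<in>UNIV. \<iota> (coord x i) *s j (h (b i)))"
    if h: "\<And>x y. h (x + y) = h x + h y" "\<And>a x. h (s a x) = s a (h x)" for h :: "'v \<Rightarrow> 'v" and x
  proof -
    have sum: "j (h (\<Sum>i\<in>A. s (a i) (b i))) = (\<Sum>i\<in>A. \<iota> (a i) *s j (h (b i)))" for A a
      by (induction A rule: infinite_finite_induct)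
        (use h(2)[of 0 0] in \<open>simp_all add: h j_add j_scale\<close>)
    show ?thesis using sum[of "coord x" UNIV] by (simp flip: coord_expansion)
  qed
  have "j (m x y) = (\<Sum>i\<in>UNIV. \<iota> (coord x i) *s (\<Sum>k\<in>UNIV. \<iota> (coord y k) *s j (m (b i) (b k))))"
    using lin[of "\<lambda>x. m x y" x] lin[of "m (b i)" y for i] by (simp add: assms)
  also have "\<dots> = M m (j x) (j y)"
    by (simp add: ext_mul_def j_nth vec_eq_iff sum_distrib_left mult.assoc)
  finally show ?thesis by simp
qed

lemma T_j:
  assumes h: "\<And>x y. h (x + y) = h x + h y" "\<And>a x. h (s a x) = s a (h x)"
  shows "T h (j x) = j (h x)"
proof -
  have "j (h (\<Sum>i\<in>A. s (a i) (b i))) = (\<Sum>i\<in>A. \<iota> (a i) *s j (h (b i)))" for A a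
    by (induction A rule: infinite_finite_induct)
      (use h(2)[of 0 0] in \<open>simp_all add: h j_add j_scale\<close>)
  from this[of "coord x" UNIV] show ?thesis by (simp add: ext_endo_def j_nth flip: coord_expansion)
qed

end

section \<open>The octonion algebra over the extension field\<close>

locale octonion_extension = octonion_algebra s mul one' n + scalar_extension s b \<iota>
  for s :: "'f::field \<Rightarrow> 'v::ab_group_add \<Rightarrow> 'v" and mul (infixl "\<cdot>" 70) and one' n
    and b :: "8 \<Rightarrow> 'v" and \<iota> :: "'f \<Rightarrow> 'k::field"
begin

abbreviation nk :: "'k ^ 8 \<Rightarrow> 'k" where "nk \<equiv> ext_norm b \<iota> n"

definition G :: "'k ^ 8 \<Rightarrow> 'k ^ 8 \<Rightarrow> 'k" where
  "G x y = (\<Sum>i\<in>UNIV. \<Sum>k\<in>UNIV. x $ i * y $ k * \<iota> \<langle>b i, b k\<rangle>)"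

lemma three_k: "(3::'k) = 0"
proof -
  have "\<iota> (1 + 1 + 1) = 1 + 1 + 1" by (simp only: iota_simps(1,2))
  thus ?thesis using three by simp
qed

lemma two_k: "(2::'k) = - 1"
proof -
  have "(2::'k) + 1 = 0" using three_k by simp
  thus ?thesis by (simp only: eq_neg_iff_add_eq_0)
qed

lemma char_k: "CHAR('k) = 3"
proof (rule CHAR_eqI)
  show "of_nat 3 = (0::'k)" using three_k by simp
  fix m assume m: "of_nat m = (0::'k)"
  have "(of_nat m :: 'k) = \<iota> (of_nat m)" by (induction m) simp_all
  hence "(of_nat m :: 'f) = 0" using m by simp
  thus "3 dvd m" by (simp add: of_nat_eq_0_iff_char_dvd char3)
qed

lemma G_bilin: "G (x + y) z = G x z + G y z" "G z (x + y) = G z x + G z y" "G (c *s x) y = c * G x y"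
    "G x (c *s y) = c * G x y"
  by (simp_all add: G_def sum.distrib sum_distrib_left algebra_simps)

lemma G_j: "G (j x) (j y) = \<iota> \<langle>x, y\<rangle>"
proof -
  have 1: "\<langle>x, z\<rangle> = (\<Sum>i\<in>UNIV. coord x i * \<langle>b i, z\<rangle>)" for z
    by (subst coord_expansion[of x]) (simp only: polar_sum polar_scale')
  have 2: "\<langle>z, y\<rangle> = (\<Sum>k\<in>UNIV. coord y k * \<langle>z, b k\<rangle>)" for z
    by (subst coord_expansion[of y]) (simp only: polar_sum polar_scale')
  have "\<langle>x, y\<rangle> = (\<Sum>i\<in>UNIV. coord x i * \<langle>b i, y\<rangle>)" by (rule 1)
  also have "\<dots> = (\<Sum>i\<in>UNIV. \<Sum>k\<in>UNIV. coord x i * (coord y k * \<langle>b i, b k\<rangle>))"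
    by (rule sum.cong[OF refl], subst 2, rule sum_distrib_left)
  finally have "\<langle>x, y\<rangle> = (\<Sum>i\<in>UNIV. \<Sum>k\<in>UNIV. coord x i * (coord y k * \<langle>b i, b k\<rangle>))" .
  thus ?thesis by (simp add: G_def j_nth iota_sum mult.assoc)
qed

lemma G_comm: "G x y = G y x"
  unfolding G_def by (subst sum.swap) (simp add: polar_comm mult_ac)

lemma nk_eq: "nk x = - G x x"
proof -
  have "G x x = (\<Sum>i\<in>UNIV. x $ i * x $ i * \<iota> \<langle>b i, b i\<rangle>) +
      (\<Sum>i\<in>UNIV. \<Sum>k\<in>{i<..}. x $ i * x $ k * \<iota> \<langle>b i, b k\<rangle> + x $ k * x $ i * \<iota> \<langle>b k, b i\<rangle>)"
    unfolding G_def by (rule sum_symmetric_split)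
  also have "\<dots> = - nk x"
    by (simp add: ext_norm_def polar_self sum_negf power2_eq_square mult_ac polar_comm two_k)
  finally show ?thesis by simp
qed

lemma nk_polar: "polar nk x y = G x y"
proof -
  have "polar nk x y = - (G x y + G x y)"
    by (simp add: polar_def nk_eq G_bilin G_comm[of y x])
  also have "\<dots> = G x y" using two_k by (metis mult_2 mult_minus1 minus_minus)
  finally show ?thesis .
qed

lemma nk_j: "nk (j x) = \<iota> (n x)"
  by (simp add: nk_eq G_j polar_self)

lemma mul_j: "M mul (j x) (j y) = j (x \<cdot> y)"
  by (rule M_j) (simp_all add: bilin)

text \<open>Multiplicativity of the norm is quadratic in each factor and cannot be checked on the
  vectors \<open>j x\<close> alone. Its full linearization can, one of the four arguments at a
  time.\<close>

lemma G_exchange: "G (M mul x y) (M mul z w) + G (M mul x w) (M mul z y) = G x z * G y w"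
proof -
  have 0: "G (M mul (j x) (j y)) (M mul (j z) (j w)) + G (M mul (j x) (j w)) (M mul (j z) (j y)) = G (j x) (j z) * G (j y) (j w)" for x y z w
    by (simp only: mul_j G_j iota_simps(2,3)[symmetric] polar_exchange)
  have 1: "G (M mul x (j y)) (M mul (j z) (j w)) + G (M mul x (j w)) (M mul (j z) (j y)) =
      G x (j z) * G (j y) (j w)" for x y z w
    by (rule ext_eqI[where t = "(*)" and x = x and f = "\<lambda>x. G (M mul x (j y)) (M mul (j z) (j w)) + G (M mul x (j w)) (M mul (j z) (j y))"
        and g = "\<lambda>x. G x (j z) * G (j y) (j w)"]; (simp only: 0)?)
      (simp_all add: G_bilin M_bilin algebra_simps)
  have 2: "G (M mul x y) (M mul (j z) (j w)) + G (M mul x (j w)) (M mul (j z) y) =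
      G x (j z) * G y (j w)" for x y z w
    by (rule ext_eqI[where t = "(*)" and x = y and f = "\<lambda>y. G (M mul x y) (M mul (j z) (j w)) + G (M mul x (j w)) (M mul (j z) y)"
        and g = "\<lambda>y. G x (j z) * G y (j w)"]; (simp only: 1)?)
      (simp_all add: G_bilin M_bilin algebra_simps)
  have 3: "G (M mul x y) (M mul z (j w)) + G (M mul x (j w)) (M mul z y) =
      G x z * G y (j w)" for x y z w
    by (rule ext_eqI[where t = "(*)" and x = z and f = "\<lambda>z. G (M mul x y) (M mul z (j w)) + G (M mul x (j w)) (M mul z y)"
        and g = "\<lambda>z. G x z * G y (j w)"]; (simp only: 2)?)
      (simp_all add: G_bilin M_bilin algebra_simps)
  show ?thesis
    by (rule ext_eqI[where t = "(*)" and x = w and f = "\<lambda>w. G (M mul x y) (M mul z w) + G (M mul x w) (M mul z y)"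
        and g = "\<lambda>w. G x z * G y w"]; (simp only: 3)?)
      (simp_all add: G_bilin M_bilin algebra_simps)
qed

lemma nk_mul: "nk (M mul x y) = nk x * nk y"
proof -
  have "G (M mul x y) (M mul x y) + G (M mul x y) (M mul x y) = G x x * G y y" by (rule G_exchange)
  moreover have "y + y = - y" for y :: 'k using two_k by (metis mult_2 mult_minus1)
  ultimately show ?thesis by (simp add: nk_eq)
qed

text \<open>Coordinate functionals over the base field are pairings with vectors \<open>d\<close>;
  the images \<open>j d\<close> extract the same coordinates after extension.\<close>

lemma G_nonsingular: "(\<And>y. G x y = 0) \<Longrightarrow> x = 0"
proof -
  assume 0: "\<And>y. G x y = 0"
  have "x $ i = 0" for i
  proof -
    obtain d where d: "\<And>x. coord x i = \<langle>d, x\<rangle>"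
      using functional_eq_polar[of "\<lambda>x. coord x i"] coord_add coord_scale by metis
    have "G y (j d) = y $ i" for y
      by (rule ext_eqI[where t = "(*)" and x = y and f = "\<lambda>y. G y (j d)" and g = "\<lambda>y. y $ i"]) (simp_all add: G_bilin G_j j_nth d polar_comm)
    thus ?thesis using 0 by metis
  qed
  thus ?thesis by (simp add: vec_eq_iff)
qed

lemma octonion_extension: "octonion_algebra (*s) (M mul) (j one') nk"
proof unfold_locales
  have one: "M mul (j one') x = x" "M mul x (j one') = x" for x
    by (rule ext_eqI[where t = "(*s)" and x = x and f = "M mul (j one')" and g = "\<lambda>x. x"]; simp add: M_bilin mul_j)
      (rule ext_eqI[where t = "(*s)" and x = x and f = "\<lambda>x. M mul x (j one')" and g = "\<lambda>x. x"]; simp add: M_bilin mul_j)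
  show "M mul (j one') x = x" "M mul x (j one') = x" for x by (rule one)+
  show "vector_space.dim (*s) (UNIV :: ('k ^ 8) set) = 8" using vec_dim_card[where 'a = 'k and 'n = 8] by simp
  show "CHAR('k) = 3" by (rule char_k)
  show "x = 0" if "\<And>y. y \<in> UNIV \<Longrightarrow> polar nk x y = 0" for x using G_nonsingular that by (simp add: nk_polar)
  show "nk (a *s x) = a\<^sup>2 * nk x" for a x by (simp add: nk_eq G_bilin power2_eq_square mult.assoc)
qed (simp_all add: nk_polar G_bilin M_bilin nk_mul vec.subspace_UNIV)

end

lemma (in octonion_algebra) basis_family_exists: "\<exists>b. basis_family s b"
proof -
  have "card some_basis = CARD(8)"
    using basis_card_eq_dim[of some_basis UNIV] some_basis dim8 by simp
  then obtain b where "bij_betw b (UNIV :: 8 set) some_basis"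
    using finite_same_card_bij[of "UNIV :: 8 set" some_basis] some_basis(3) by auto
  thus ?thesis using some_basis unfolding basis_family_def bij_betw_def by auto
qed


context octonion_extension
begin

lemma ext_conjugation: "conjugation (*s) (j one') nk (j x) = j (cnj x)"
  by (simp add: conjugation_def nk_polar G_j j_scale j_diff)

lemma ext_comm_LR: "ext_endo s b \<iota> (comm_LR mul a c) x = comm_LR (M mul) (j a) (j c) x"
proof (rule ext_eqI[where t = "(*s)" and x = x and g = "comm_LR (M mul) (j a) (j c)"])
  show "ext_endo s b \<iota> (comm_LR mul a c) (j x) = comm_LR (M mul) (j a) (j c) (j x)" for x
    by (subst T_j) (simp_all add: comm_LR_def bilin mul_j j_diff)
qed (simp_all add: T_linear, simp_all add: comm_LR_def M_bilin vec.scale_right_diff_distrib)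

lemma ext_ad: "ext_endo s b \<iota> (\<lambda>x. - ad mul a x) x = - ad (M mul) (j a) x"
proof (rule ext_eqI[where t = "(*s)" and x = x and g = "\<lambda>x. - ad (M mul) (j a) x"])
  show "ext_endo s b \<iota> (\<lambda>x. - ad mul a x) (j x) = - ad (M mul) (j a) (j x)" for x
    by (subst T_j) (simp_all add: ad_def bilin mul_j j_diff)
qed (simp_all add: T_linear, simp_all add: ad_def M_bilin vec.scale_right_diff_distrib)

lemma order3_extension:
  assumes "order3_automorphism s mul n \<tau>"
  shows "octonion_order3 (*s) (M mul) (j one') nk (T \<tau>)"
    and "M (petersson s mul one' n \<tau>) = petersson (*s) (M mul) (j one') nk (T \<tau>)"
proof -
  interpret O: octonion_order3 s mul one' n \<tau> by unfold_locales (rule assms)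
  interpret E: octonion_algebra "(*s)" "M mul" "j one'" nk by (rule octonion_extension)
  have Tj: "T \<tau> (j x) = j (\<tau> x)" for x by (rule T_j) (simp_all add: O.tau_simps)
  have T3: "T \<tau> (T \<tau> (T \<tau> x)) = x" for x
    by (rule ext_eqI[where t = "(*s)" and x = x and f = "\<lambda>x. T \<tau> (T \<tau> (T \<tau> x))" and g = "\<lambda>x. x"])
      (simp_all add: T_linear Tj O.tau3)
  have mul1: "T \<tau> (M mul (j x) y) = M mul (j (\<tau> x)) (T \<tau> y)" for x y
    by (rule ext_eqI[where t = "(*s)" and x = y and f = "\<lambda>y. T \<tau> (M mul (j x) y)" and g = "\<lambda>y. M mul (j (\<tau> x)) (T \<tau> y)"])
      (simp_all add: T_linear M_bilin mul_j Tj O.tau_simps)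
  have mul: "T \<tau> (M mul x y) = M mul (T \<tau> x) (T \<tau> y)" for x y
    by (rule ext_eqI[where t = "(*s)" and x = x and f = "\<lambda>x. T \<tau> (M mul x y)" and g = "\<lambda>x. M mul (T \<tau> x) (T \<tau> y)"])
      (simp_all add: T_linear M_bilin Tj mul1)
  have G1: "G (j (\<tau> x)) (T \<tau> y) = G (j x) y" for x y
    by (rule ext_eqI[where t = "(*)" and x = y and f = "\<lambda>y. G (j (\<tau> x)) (T \<tau> y)" and g = "\<lambda>y. G (j x) y"])
      (simp_all add: T_linear G_bilin G_j Tj O.tau_simps)
  have G2: "G (T \<tau> x) (T \<tau> y) = G x y" for x y
    by (rule ext_eqI[where t = "(*)" and x = x and f = "\<lambda>x. G (T \<tau> x) (T \<tau> y)" and g = "\<lambda>x. G x y"])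
      (simp_all add: T_linear G_bilin Tj G1)
  have "automorphism (*s) (M mul) nk (T \<tau>)"
  proof (rule E.automorphismI)
    show "bij (T \<tau>)" by (rule bij_betwI[of _ _ _ "T \<tau> \<circ> T \<tau>"]) (auto simp: T3)
  qed (simp_all add: T_linear mul nk_eq G2)
  moreover have "T \<tau> \<noteq> id"
  proof
    assume "T \<tau> = id"
    hence "j (\<tau> x) = j x" for x using Tj[of x] by simp
    hence "\<tau> = id" using j_inj by auto
    thus False using assms by (simp add: order3_automorphism_def)
  qed
  ultimately have "order3_automorphism (*s) (M mul) nk (T \<tau>)"
    by (auto simp: order3_automorphism_def T3)
  thus E3: "octonion_order3 (*s) (M mul) (j one') nk (T \<tau>)"
    by unfold_locales
  interpret E3: octonion_order3 "(*s)" "M mul" "j one'" nk "T \<tau>" by (rule E3)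
  have 0: "M O.star (j x) (j y) = E3.star (j x) (j y)" for x y
    by (subst M_j) (simp_all add: O.star_bilin, simp add: petersson_def ext_conjugation Tj mul_j)
  have 1: "M O.star (j x) y = E3.star (j x) y" for x y
    by (rule ext_eqI[where t = "(*s)" and x = y and f = "M O.star (j x)" and g = "E3.star (j x)"])
      (simp_all add: M_bilin E3.star_bilin 0)
  have "M O.star x y = E3.star x y" for x y
    by (rule ext_eqI[where t = "(*s)" and x = x and f = "\<lambda>x. M O.star x y" and g = "\<lambda>x. E3.star x y"])
      (simp_all add: M_bilin E3.star_bilin 1)
  thus "M O.star = E3.star" by (intro ext)
qed

end

lemma algebraically_closed_alg_closure: "algebraically_closed_field TYPE('f::field alg_closure)"
  unfolding algebraically_closed_field_def using alg_closed_imp_poly_has_root by blast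

lemma field_embedding_to_ac: "field_embedding to_ac"
  by (simp add: field_embedding_def)

text \<open>The fixed vector and the nonvanishing of \<open>N\<^sup>2\<close> survive extension, and
  over the closure the cyclic basis turns the extended automorphism into the standard one.\<close>

lemma (in octonion_order3) etale_okubo:
  assumes k: "N k = 0" "\<langle>k, one'\<rangle> = 0" "n k \<noteq> 0" and sq: "N (N z) \<noteq> 0"
  shows "okubo_algebra s star n"
proof -
  obtain b where b: "basis_family s b" using basis_family_exists by blast
  interpret X: octonion_extension s mul one' n b "to_ac :: 'f \<Rightarrow> 'f alg_closure"
    by unfold_locales (rule b, rule field_embedding_to_ac)
  interpret E: octonion_order3 "(*s)" "X.M mul" "X.j one'" X.nk "X.T \<tau>"
    by (rule X.order3_extension[OF order3])
  have Tj: "X.T \<tau> (X.j x) = X.j (\<tau> x)" for x by (rule X.T_j) (simp_all add: tau_simps)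
  have Nj: "E.N (X.j x) = X.j (N x)" for x by (simp add: E.N_def N_def Tj X.j_diff)
  have j0: "X.j x = 0 \<longleftrightarrow> x = 0" for x using X.j_inj[of x 0] by auto
  have 1: "E.N (X.j k) = 0" "polar X.nk (X.j k) (X.j one') = 0" "X.nk (X.j k) \<noteq> 0" "E.N (E.N (X.j z)) \<noteq> 0"
    using k sq by (simp_all add: Nj X.nk_polar X.G_j X.nk_j j0)
  obtain e1 e2 u v where c: "canonical_basis (*s) (X.M mul) (X.j one') e1 e2 u v"
      "\<forall>i. X.T \<tau> (u i) = u (i + 1)" "\<forall>i. X.T \<tau> (v i) = v (i + 1)" "X.T \<tau> e1 = e1" "X.T \<tau> e2 = e2"
    using E.cyclic_canonical_basis[OF algebraically_closed_alg_closure 1] by blast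
  have "cayley_algebra (*s) (X.M mul) (X.j one') X.nk"
    unfolding cayley_algebra_def using E.hurwitz_algebra_axioms E.dim8 by blast
  hence "split_okubo_algebra (*s) (X.M star) X.nk"
    unfolding split_okubo_algebra_def X.order3_extension(2)[OF order3] using c E.tau_auto by blast
  thus ?thesis unfolding okubo_algebra_def using b field_embedding_to_ac by blast
qed

subsection \<open>Root spaces\<close>

context octonion_algebra
begin

text \<open>Conjugation by an automorphism \<open>t\<close> replaces \<open>u p\<close> and
  \<open>v q\<close> in the commutator by their images, here multiples of themselves; the two
  factors multiply to the character.\<close>

lemma root_space_comm_LR:
  assumes der: "comm_LR mul (u p) (v q) \<in> Der s mul n"
    and w: "\<And>\<alpha> :: 3 \<Rightarrow> 'f alg_closure. \<alpha> 1 * \<alpha> 2 * \<alpha> 3 = 1 \<Longrightarrow> char_value w \<alpha> = \<alpha> p * inverse (\<alpha> q)"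
  shows "comm_LR mul (u p) (v q) \<in> root_space s mul n e1 e2 u v w"
proof -
  obtain b where b: "basis_family s b" using basis_family_exists by blast
  interpret X: octonion_extension s mul one' n b "to_ac :: 'f \<Rightarrow> 'f alg_closure"
    by unfold_locales (rule b, rule field_embedding_to_ac)
  interpret E: octonion_algebra "(*s)" "X.M mul" "X.j one'" X.nk by (rule X.octonion_extension)
  let ?d = "comm_LR mul (u p) (v q)"
  have "t \<circ> X.T ?d \<circ> inv_into UNIV t = (\<lambda>x. char_value w \<alpha> *s X.T ?d x)"
    if t: "torus_point (*s) (X.M mul) X.nk (X.j e1) (X.j e2) (X.j \<circ> u) (X.j \<circ> v) \<alpha> t" for \<alpha> t
  proof
    fix x
    from t have a: "\<alpha> 1 * \<alpha> 2 * \<alpha> 3 = 1" and T: "automorphism (*s) (X.M mul) X.nk t"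
      and tu: "t (X.j (u p)) = \<alpha> p *s X.j (u p)" and tv: "t (X.j (v q)) = inverse (\<alpha> q) *s X.j (v q)"
      by (auto simp: torus_point_def)
    note A = E.automorphismD[OF T]
    have "t (inv_into UNIV t x) = x" using A(5) by (simp add: bij_is_surj surj_f_inv_f)
    hence "t (comm_LR (X.M mul) (X.j (u p)) (X.j (v q)) (inv_into UNIV t x)) =
        comm_LR (X.M mul) (t (X.j (u p))) (t (X.j (v q))) x"
      by (simp add: comm_LR_def A(3,7))
    also have "\<dots> = (\<alpha> p * inverse (\<alpha> q)) *s comm_LR (X.M mul) (X.j (u p)) (X.j (v q)) x"
      by (simp add: tu tv comm_LR_def X.M_bilin vec.scale_right_diff_distrib mult.commute)
    finally show "(t \<circ> X.T ?d \<circ> inv_into UNIV t) x = char_value w \<alpha> *s X.T ?d x"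
      by (simp add: X.ext_comm_LR w[OF a])
  qed
  thus ?thesis unfolding root_space_def Let_def using der b by blast
qed

lemma root_space_ad:
  assumes der: "(\<lambda>x. - ad mul (v q) x) \<in> Der s mul n"
    and w: "\<And>\<alpha> :: 3 \<Rightarrow> 'f alg_closure. \<alpha> 1 * \<alpha> 2 * \<alpha> 3 = 1 \<Longrightarrow> char_value w \<alpha> = inverse (\<alpha> q)"
  shows "(\<lambda>x. - ad mul (v q) x) \<in> root_space s mul n e1 e2 u v w"
proof -
  obtain b where b: "basis_family s b" using basis_family_exists by blast
  interpret X: octonion_extension s mul one' n b "to_ac :: 'f \<Rightarrow> 'f alg_closure"
    by unfold_locales (rule b, rule field_embedding_to_ac)
  interpret E: octonion_algebra "(*s)" "X.M mul" "X.j one'" X.nk by (rule X.octonion_extension)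
  let ?d = "\<lambda>x. - ad mul (v q) x"
  have "t \<circ> X.T ?d \<circ> inv_into UNIV t = (\<lambda>x. char_value w \<alpha> *s X.T ?d x)"
    if t: "torus_point (*s) (X.M mul) X.nk (X.j e1) (X.j e2) (X.j \<circ> u) (X.j \<circ> v) \<alpha> t" for \<alpha> t
  proof
    fix x
    from t have a: "\<alpha> 1 * \<alpha> 2 * \<alpha> 3 = 1" and T: "automorphism (*s) (X.M mul) X.nk t"
      and tv: "t (X.j (v q)) = inverse (\<alpha> q) *s X.j (v q)"
      by (auto simp: torus_point_def)
    note A = E.automorphismD[OF T]
    have "t (inv_into UNIV t x) = x" using A(5) by (simp add: bij_is_surj surj_f_inv_f)
    hence "t (- ad (X.M mul) (X.j (v q)) (inv_into UNIV t x)) = - ad (X.M mul) (t (X.j (v q))) x"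
      by (simp add: ad_def A(3,7))
    also have "\<dots> = inverse (\<alpha> q) *s (- ad (X.M mul) (X.j (v q)) x)"
      by (simp add: tv ad_def X.M_bilin vec.scale_right_diff_distrib)
    finally show "(t \<circ> X.T ?d \<circ> inv_into UNIV t) x = char_value w \<alpha> *s X.T ?d x"
      by (simp add: X.ext_ad w[OF a])
  qed
  thus ?thesis unfolding root_space_def Let_def using der b by blast
qed

end

lemma char_value_eq: "char_value w \<alpha> = \<alpha> 1 powi (w $ 1) * \<alpha> 2 powi (w $ 2) * \<alpha> 3 powi (w $ 3)"
  unfolding char_value_def UNIV_3 by (simp add: index3 mult.assoc)

lemma eps_nth: "eps i $ k = (if k = i then 1 else 0)"
  by (simp add: eps_def axis_def)

lemma char_value_long: "char_value (eps 2 - eps 3) \<alpha> = \<alpha> 2 * inverse (\<alpha> 3)"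
  unfolding char_value_eq vector_minus_component eps_nth by (simp add: index3 power_int_minus)

lemma char_value_short: "char_value (- eps 3) \<alpha> = inverse (\<alpha> 3)"
  unfolding char_value_eq uminus_vec_def eps_nth vec_lambda_beta by (simp add: index3 power_int_minus eps_nth)


section \<open>The normal forms in coordinates\<close>

context octonion_frame
begin

lemma oct_conversion:
  "e1 - e2 = oct 1 (- 1) 0 0 0 0 0 0" "u 3 + u 2 = oct 0 0 0 1 1 0 0 0"
  "u 3 + v 3 - (e1 - e2) = oct (- 1) 1 0 0 1 0 0 1" "u 3 + u 2 + v 3 - (e1 - e2) = oct (- 1) 1 0 1 1 0 0 1"
  by (simp_all add: oct_basis oct_simps)

text \<open>
  The three normal forms are treated together: \<open>l\<close> and \<open>m\<close> are the coefficients of the long and the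
  short root part.
\<close>

lemma form_oct:
  assumes "automorphism s mul n \<sigma>" "\<sigma> (u 1) = u 1" "\<sigma> (u 2) = u 2" "\<sigma> (u 3) = oct (- m) m 0 l 1 0 0 m"
  shows "\<sigma> (oct a b p1 p2 p3 q1 q2 q3) =
    oct (a - m * p3) (b + m * p3) (p1 - m * q2) (p2 + l * p3 + m * q1) p3 q1 q2 (q3 + m * p3 - m * a + m * b - l * q2)"
proof -
  have U: "u 1 = oct 0 0 1 0 0 0 0 0" "u 2 = oct 0 0 0 1 0 0 0 0" by (simp_all only: oct_basis)
  have v1: "\<sigma> (v 1) = oct 0 0 0 m 0 1 0 0" and v2: "\<sigma> (v 2) = oct 0 0 (- m) 0 0 0 1 (- l)" and v3: "\<sigma> (v 3) = oct 0 0 0 0 0 0 0 1"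
    unfolding automorphism_basis(1-3)[OF assms(1)] assms(2-4) unfolding U by (simp_all add: oct_mul)
  have e: "\<sigma> e1 = oct 1 0 0 0 0 0 0 (- m)" "\<sigma> e2 = oct 0 1 0 0 0 0 0 m"
    unfolding automorphism_basis(4,5)[OF assms(1)] v3 assms(4) by (simp_all add: oct_mul oct_uminus)
  show ?thesis
    unfolding automorphism_oct[OF assms(1)] v1 v2 v3 e assms(2-4) unfolding U
    by (simp add: oct_scale oct_add oct_eq_iff algebra_simps)
qed

lemma long_form_oct:
  assumes "automorphism s mul n \<sigma>" "long_root_form u \<sigma>"
  shows "\<sigma> (oct a b p1 p2 p3 q1 q2 q3) = oct a b p1 (p2 + p3) p3 q1 q2 (q3 - q2)"
  using form_oct[OF assms(1), of 0 1] assms(2) by (simp add: long_root_form_def oct_conversion)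

lemma short_form_oct:
  assumes "automorphism s mul n \<sigma>" "short_root_form e1 e2 u v \<sigma>"
  shows "\<sigma> (oct a b p1 p2 p3 q1 q2 q3) = oct (a - p3) (b + p3) (p1 - q2) (p2 + q1) p3 q1 q2 (q3 + p3 - a + b)"
proof -
  have "\<sigma> (u 1) = u 1" "\<sigma> (u 2) = u 2" "\<sigma> (u 3) = oct (- 1) 1 0 0 1 0 0 1"
    using assms(2) unfolding short_root_form_def oct_conversion(3) by auto
  thus ?thesis using form_oct[OF assms(1), of 1 0] by simp
qed

lemma mixed_form_oct:
  assumes "automorphism s mul n \<sigma>" "mixed_form e1 e2 u v \<sigma>"
  shows "\<sigma> (oct a b p1 p2 p3 q1 q2 q3) =
    oct (a - p3) (b + p3) (p1 - q2) (p2 + p3 + q1) p3 q1 q2 (q3 + p3 - a + b - q2)"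
proof -
  have "\<sigma> (u 1) = u 1" "\<sigma> (u 2) = u 2" "\<sigma> (u 3) = oct (- 1) 1 0 1 1 0 0 1"
    using assms(2) unfolding mixed_form_def oct_conversion(4) by auto
  thus ?thesis using form_oct[OF assms(1), of 1 1] by simp
qed

text \<open>Thus a normal form exists as soon as the prescribed images of \<open>u 1\<close>,
  \<open>u 2\<close>, \<open>u 3\<close> are seen to form a triad.\<close>

lemma automorphism_of_triad:
  assumes "triad x y z"
  shows "\<exists>\<sigma>. automorphism s mul n \<sigma> \<and> \<sigma> (u 1) = x \<and> \<sigma> (u 2) = y \<and> \<sigma> (u 3) = z"
  using frame_transport[OF canonical triad_canonical_basis[OF assms]] by (metis triple_simps)

lemma long_form_exists: "\<exists>\<sigma>. automorphism s mul n \<sigma> \<and> long_root_form u \<sigma>"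
proof -
  have "triad (u 1) (u 2) (u 3 + u 2)"
    unfolding triad_def unfolding oct_conversion(2) oct_one by (simp add: oct_basis oct_simps)
  from automorphism_of_triad[OF this] show ?thesis by (auto simp: long_root_form_def)
qed

lemma short_form_exists: "\<exists>\<sigma>. automorphism s mul n \<sigma> \<and> short_root_form e1 e2 u v \<sigma>"
proof -
  have "triad (u 1) (u 2) (u 3 + v 3 - (e1 - e2))"
    unfolding triad_def unfolding oct_conversion(3) oct_one by (simp add: oct_basis oct_simps)
  from automorphism_of_triad[OF this] show ?thesis by (auto simp: short_root_form_def)
qed

lemma mixed_decomposition:
  assumes "automorphism s mul n \<sigma>" "mixed_form e1 e2 u v \<sigma>"
  shows "\<exists>\<tau>1 \<tau>3. automorphism s mul n \<tau>1 \<and> long_root_form u \<tau>1 \<and> automorphism s mul n \<tau>3 \<and>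
    short_root_form e1 e2 u v \<tau>3 \<and> \<tau>1 \<circ> \<tau>3 = \<tau>3 \<circ> \<tau>1 \<and> \<sigma> = \<tau>1 \<circ> \<tau>3"
proof -
  obtain \<tau>1 \<tau>3 where a: "automorphism s mul n \<tau>1" "long_root_form u \<tau>1" "automorphism s mul n \<tau>3"
      "short_root_form e1 e2 u v \<tau>3"
    using long_form_exists short_form_exists by blast
  have "\<tau>1 (\<tau>3 x) = \<tau>3 (\<tau>1 x) \<and> \<sigma> x = \<tau>1 (\<tau>3 x)" for x
    by (cases x rule: oct_cases)
      (simp add: long_form_oct[OF a(1,2)] short_form_oct[OF a(3,4)] mixed_form_oct[OF assms] oct_eq_iff)
  thus ?thesis using a by (intro exI[of _ \<tau>1] exI[of _ \<tau>3]) (auto simp: fun_eq_iff)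
qed

lemma comm_LR_oct: "comm_LR mul (u 2) (v 3) (oct a b p1 p2 p3 q1 q2 q3) = oct 0 0 0 p3 0 0 0 (- q2)"
  by (simp add: comm_LR_def oct_basis oct_simps three)

lemma ad_oct: "- ad mul (v 3) (oct a b p1 p2 p3 q1 q2 q3) = oct (- p3) p3 (- q2) q1 0 0 0 (b - a)"
  by (simp add: ad_def oct_basis oct_simps three algebra_simps)

lemma comm_LR_Der: "comm_LR mul (u 2) (v 3) \<in> Der s mul n"
proof -
  let ?d = "comm_LR mul (u 2) (v 3)"
  have lin: "Vector_Spaces.linear s s ?d"
    by (rule linear_endoI) (simp_all add: comm_LR_def bilin)
  have mul: "?d (x \<cdot> y) = ?d x \<cdot> y + x \<cdot> ?d y" for x y
    by (cases x rule: oct_cases; cases y rule: oct_cases)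
      (simp add: oct_mul comm_LR_oct oct_add oct_eq_iff algebra_simps)
  have pol: "\<langle>?d x, y\<rangle> + \<langle>x, ?d y\<rangle> = 0" for x y
    by (cases x rule: oct_cases; cases y rule: oct_cases)
      (simp add: oct_polar comm_LR_oct algebra_simps)
  from lin mul pol show ?thesis by (simp add: Der_def)
qed

lemma ad_Der: "(\<lambda>x. - ad mul (v 3) x) \<in> Der s mul n"
proof -
  let ?d = "\<lambda>x. - ad mul (v 3) x"
  have lin: "Vector_Spaces.linear s s ?d"
    by (rule linear_endoI) (simp_all add: ad_def bilin)
  have mul: "?d (x \<cdot> y) = ?d x \<cdot> y + x \<cdot> ?d y" for x y
    by (cases x rule: oct_cases; cases y rule: oct_cases)
      (simp only: oct_mul ad_oct oct_add oct_eq_iff, simp add: algebra_simps three)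
  have pol: "\<langle>?d x, y\<rangle> + \<langle>x, ?d y\<rangle> = 0" for x y
    by (cases x rule: oct_cases; cases y rule: oct_cases)
      (simp only: oct_polar ad_oct, simp add: algebra_simps)
  from lin mul pol show ?thesis by (simp add: Der_def)
qed

lemma half: "(1 / 2 :: 'f) = - 1"
  by (simp add: two)

text \<open>The derivation squares to zero, so its exponential is the identity plus the derivation,
  which is what \<open>long_form_oct\<close> shows.\<close>

lemma long_form_iff_exp:
  assumes "automorphism s mul n \<sigma>"
  shows "long_root_form u \<sigma> \<longleftrightarrow> \<sigma> = exp_nilp s (comm_LR mul (u 2) (v 3))"
proof
  assume l: "long_root_form u \<sigma>"
  show "\<sigma> = exp_nilp s (comm_LR mul (u 2) (v 3))"
  proof
    fix x show "\<sigma> x = exp_nilp s (comm_LR mul (u 2) (v 3)) x"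
      by (cases x rule: oct_cases)
        (simp add: long_form_oct[OF assms l] exp_nilp_def comm_LR_oct oct_simps)
  qed
next
  assume "\<sigma> = exp_nilp s (comm_LR mul (u 2) (v 3))"
  hence "\<sigma> (oct a b p1 p2 p3 q1 q2 q3) = oct a b p1 (p2 + p3) p3 q1 q2 (q3 - q2)" for a b p1 p2 p3 q1 q2 q3
    by (simp add: exp_nilp_def comm_LR_oct oct_simps)
  thus "long_root_form u \<sigma>" by (simp add: long_root_form_def oct_basis oct_add)
qed

text \<open>As \<open>v 3\<close> squares to zero, \<open>w \<cdot> w = one' + v 3\<close> is the
  inverse of \<open>w\<close>: the map is conjugation by a cube root of the unit.\<close>

lemma short_form_facts:
  assumes "automorphism s mul n \<sigma>" "short_root_form e1 e2 u v \<sigma>"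
  defines "w \<equiv> one' - v 3"
  shows "\<sigma> x = (w \<cdot> x) \<cdot> (w \<cdot> w)" "\<sigma> x = w \<cdot> (x \<cdot> (w \<cdot> w))"
    "\<sigma> = exp_nilp s (\<lambda>x. - ad mul (v 3) x)" "para_unit s (petersson s mul one' n \<sigma>) n w"
proof -
  have w: "w = oct 1 1 0 0 0 0 0 (- 1)" by (simp add: w_def oct_one oct_basis oct_diff)
  note \<sigma> = short_form_oct[OF assms(1,2)]
  show "\<sigma> x = (w \<cdot> x) \<cdot> (w \<cdot> w)" "\<sigma> x = w \<cdot> (x \<cdot> (w \<cdot> w))"
    by (cases x rule: oct_cases; simp add: w \<sigma> oct_mul oct_eq_iff algebra_simps two)+
  show "\<sigma> = exp_nilp s (\<lambda>x. - ad mul (v 3) x)"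
  proof
    fix x show "\<sigma> x = exp_nilp s (\<lambda>x. - ad mul (v 3) x) x"
      by (cases x rule: oct_cases)
        (simp add: \<sigma> exp_nilp_def ad_oct oct_simps half algebra_simps add_self)
  qed
  have "petersson s mul one' n \<sigma> w x = s \<langle>w, x\<rangle> w - x \<and> petersson s mul one' n \<sigma> x w = s \<langle>w, x\<rangle> w - x" for x
    by (cases x rule: oct_cases)
      (simp add: petersson_def w oct_cnj \<sigma> oct_mul oct_polar oct_scale oct_diff oct_eq_iff algebra_simps add_self two)
  moreover from this[of w] have "petersson s mul one' n \<sigma> w w = w"
    by (simp add: w oct_polar oct_scale oct_diff oct_eq_iff two)
  moreover have "w \<noteq> 0" by (simp add: w oct_zero oct_eq_iff)
  ultimately show "para_unit s (petersson s mul one' n \<sigma>) n w" by (simp add: para_unit_def)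
qed

end

text \<open>The automorphism carrying one canonical basis to the other conjugates
  \<open>\<sigma>\<close> to a map with the formulas of \<open>\<sigma>'\<close>; agreement on the
  generators \<open>u' i\<close> suffices.\<close>

lemma (in octonion_algebra) conjugate_automorphisms:
  assumes c: "canonical_basis s mul one' e1 e2 u v" "canonical_basis s mul one' e1' e2' u' v'"
    and a: "automorphism s mul n \<sigma>" "automorphism s mul n \<sigma>'"
    and eq: "\<And>\<phi>. automorphism s mul n \<phi> \<Longrightarrow> \<phi> e1 = e1' \<Longrightarrow> \<phi> e2 = e2' \<Longrightarrow> (\<And>i. \<phi> (u i) = u' i) \<Longrightarrow>
      (\<And>i. \<phi> (v i) = v' i) \<Longrightarrow> \<forall>i. \<phi> (\<sigma> (u i)) = \<sigma>' (u' i)"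
  shows "\<exists>\<phi>. automorphism s mul n \<phi> \<and> \<sigma>' = \<phi> \<circ> \<sigma> \<circ> inv_into UNIV \<phi>"
proof -
  obtain \<phi> where \<phi>: "automorphism s mul n \<phi>" "\<phi> e1 = e1'" "\<phi> e2 = e2'" "\<And>i. \<phi> (u i) = u' i" "\<And>i. \<phi> (v i) = v' i"
    using frame_transport[OF c] by blast
  obtain oct where "octonion_frame s mul one' n e1' e2' u' v' oct" using frame_exists[OF c(2)] by blast
  then interpret F: octonion_frame s mul one' n e1' e2' u' v' oct .
  have "inv_into UNIV \<phi> (u' i) = u i" for i
    using automorphismD(5)[OF \<phi>(1)] by (simp add: bij_is_inj inv_f_f flip: \<phi>(4))
  hence "\<sigma>' (u' i) = (\<phi> \<circ> \<sigma> \<circ> inv_into UNIV \<phi>) (u' i)" for i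
    using eq[OF \<phi>] by simp
  hence "\<sigma>' = \<phi> \<circ> \<sigma> \<circ> inv_into UNIV \<phi>"
    by (intro F.automorphism_eqI automorphism_comp automorphism_inv a \<phi>(1))
  thus ?thesis using \<phi>(1) by blast
qed

context octonion_algebra
begin

lemma long_form_conjugate:
  assumes "canonical_basis s mul one' e1 e2 u v" "canonical_basis s mul one' e1' e2' u' v'"
    "automorphism s mul n \<sigma>" "automorphism s mul n \<sigma>'" "long_root_form u \<sigma>" "long_root_form u' \<sigma>'"
  shows "\<exists>\<phi>. automorphism s mul n \<phi> \<and> \<sigma>' = \<phi> \<circ> \<sigma> \<circ> inv_into UNIV \<phi>"
  using assms(5,6)
  by (intro conjugate_automorphisms[OF assms(1-4)]) (simp add: forall_3 long_root_form_def automorphismD)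

lemma short_form_conjugate:
  assumes "canonical_basis s mul one' e1 e2 u v" "canonical_basis s mul one' e1' e2' u' v'"
    "automorphism s mul n \<sigma>" "automorphism s mul n \<sigma>'" "short_root_form e1 e2 u v \<sigma>" "short_root_form e1' e2' u' v' \<sigma>'"
  shows "\<exists>\<phi>. automorphism s mul n \<phi> \<and> \<sigma>' = \<phi> \<circ> \<sigma> \<circ> inv_into UNIV \<phi>"
  using assms(5,6)
  by (intro conjugate_automorphisms[OF assms(1-4)]) (simp add: forall_3 short_root_form_def automorphismD)

lemma mixed_form_conjugate:
  assumes "canonical_basis s mul one' e1 e2 u v" "canonical_basis s mul one' e1' e2' u' v'"
    "automorphism s mul n \<sigma>" "automorphism s mul n \<sigma>'" "mixed_form e1 e2 u v \<sigma>" "mixed_form e1' e2' u' v' \<sigma>'"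
  shows "\<exists>\<phi>. automorphism s mul n \<phi> \<and> \<sigma>' = \<phi> \<circ> \<sigma> \<circ> inv_into UNIV \<phi>"
  using assms(5,6)
  by (intro conjugate_automorphisms[OF assms(1-4)]) (simp add: forall_3 mixed_form_def automorphismD)

end

section \<open>Jordan types, Petersson algebras and idempotents of the normal forms\<close>

locale octonion_order3_frame = octonion_order3 s mul one' n \<tau> + octonion_frame s mul one' n e1 e2 u v oct
  for s :: "'f::field \<Rightarrow> 'v::ab_group_add \<Rightarrow> 'v" and mul (infixl "\<cdot>" 70) and one' n \<tau> e1 e2 u v oct
begin

lemma segre_long:
  assumes "long_root_form u \<tau>"
  shows "segre_symbol s N [2, 2, 1, 1, 1, 1]"
proof -
  have N: "N (oct a b p1 p2 p3 q1 q2 q3) = oct 0 0 0 p3 0 0 0 (- q2)" for a b p1 p2 p3 q1 q2 q3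
    by (simp add: N_def long_form_oct[OF tau_auto assms] oct_diff)
  \<comment> \<open>The chains of length two start at \<open>u 3\<close> and \<open>v 2\<close>; the
    other four vectors are fixed.\<close>
  define x where "x i = [oct 0 0 0 0 1 0 0 0, oct 0 0 0 0 0 0 1 0, oct 1 0 0 0 0 0 0 0, oct 0 1 0 0 0 0 0 0,
    oct 0 0 1 0 0 0 0 0, oct 0 0 0 0 0 1 0 0] ! i" for i
  show ?thesis
  proof (rule segre_symbolI[where x = x])
    show "Vector_Spaces.linear s s N" by (intro linear_endoI) (simp_all add: N_linear)
    fix i assume "i < length [2, 2, 1, 1, 1, 1::nat]"
    thus "(N ^^ ([2, 2, 1, 1, 1, 1] ! i)) (x i) = 0"
      by (auto simp: less_Suc_eq eval_nat_numeral x_def N oct_zero)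
  next
    fix a assume "(\<Sum>i<length [2, 2, 1, 1, 1, 1::nat]. \<Sum>j<[2, 2, 1, 1, 1, 1] ! i. s (a i j) ((N ^^ j) (x i))) = 0"
    thus "\<forall>i<length [2, 2, 1, 1, 1, 1::nat]. \<forall>j<[2, 2, 1, 1, 1, 1] ! i. a i j = 0"
      by (auto simp: eval_nat_numeral lessThan_Suc less_Suc_eq x_def N oct_zero oct_scale oct_add oct_eq_iff)
  qed auto
qed

lemma segre_short_or_mixed:
  assumes "short_root_form e1 e2 u v \<tau> \<or> mixed_form e1 e2 u v \<tau>"
  shows "segre_symbol s N [3, 2, 2, 1]"
proof -
  obtain l where N: "N (oct a b p1 p2 p3 q1 q2 q3) =
      oct (- p3) p3 (- q2) (l * p3 + q1) 0 0 0 (p3 - a + b - l * q2)" for a b p1 p2 p3 q1 q2 q3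
  proof (cases "mixed_form e1 e2 u v \<tau>")
    case True
    show thesis by (rule that[of 1]) (simp add: N_def mixed_form_oct[OF tau_auto True] oct_diff oct_eq_iff)
  next
    case False
    hence True: "short_root_form e1 e2 u v \<tau>" using assms by blast
    show thesis by (rule that[of 0]) (simp add: N_def short_form_oct[OF tau_auto True] oct_diff oct_eq_iff)
  qed
  \<comment> \<open>Chains start at \<open>u 3\<close>, \<open>v 1\<close>, \<open>v 2\<close> and
    \<open>one'\<close>. The long root coefficient \<open>l\<close> changes the chains but not their
    lengths.\<close>
  define x where "x i = [oct 0 0 0 0 1 0 0 0, oct 0 0 0 0 0 1 0 0, oct 0 0 0 0 0 0 1 0, oct 1 1 0 0 0 0 0 0] ! i" for i
  show ?thesis
  proof (rule segre_symbolI[where x = x])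
    show "Vector_Spaces.linear s s N" by (intro linear_endoI) (simp_all add: N_linear)
    fix i assume "i < length [3, 2, 2, 1::nat]"
    thus "(N ^^ ([3, 2, 2, 1] ! i)) (x i) = 0"
      by (auto simp: less_Suc_eq eval_nat_numeral x_def N oct_zero oct_eq_iff)
  next
    fix a assume "(\<Sum>i<length [3, 2, 2, 1::nat]. \<Sum>j<[3, 2, 2, 1] ! i. s (a i j) ((N ^^ j) (x i))) = 0"
    thus "\<forall>i<length [3, 2, 2, 1::nat]. \<forall>j<[3, 2, 2, 1] ! i. a i j = 0"
      by (auto simp: eval_nat_numeral lessThan_Suc less_Suc_eq x_def N oct_zero oct_scale oct_add oct_eq_iff)
  qed auto
qed

end


context octonion_order3_frame
begin

text \<open>
  In both cases \<open>f = - e\<^sub>2 - u\<^sub>1 - v\<^sub>1\<close> serves as idempotent; the vector whose orbit is a triad is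
  \<open>e\<^sub>2 + v\<^sub>2\<close> for the long form and \<open>- u\<^sub>3\<close> for the mixed form.
\<close>

lemma split_okubo_long:
  assumes "long_root_form u \<tau>"
  shows "split_okubo_algebra s star n"
proof -
  define f x where "f = oct 0 (- 1) (- 1) 0 0 (- 1) 0 0" and "x = oct 0 1 0 0 0 0 1 0"
  note t = long_form_oct[OF tau_auto assms]
  have fs: "f \<star> f = f" "\<langle>x, x \<star> f\<rangle> = 0" "\<langle>x \<star> x, x\<rangle> = 1" "f \<noteq> 0" "n x = 0" "\<langle>x, f\<rangle> = 0"
    by (simp_all add: f_def x_def star_eq oct_cnj t oct_mul oct_polar oct_norm oct_eq_iff oct_zero two)
  interpret F: petersson_idempotent s mul one' n \<tau> f by unfold_locales (rule fs)+
  show ?thesis using F.split_okuboI[of x] fs by simp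
qed

lemma split_okubo_mixed:
  assumes "mixed_form e1 e2 u v \<tau>"
  shows "split_okubo_algebra s star n"
proof -
  define f x where "f = oct 0 (- 1) (- 1) 0 0 (- 1) 0 0" and "x = oct 0 0 0 0 (- 1) 0 0 0"
  note t = mixed_form_oct[OF tau_auto assms]
  have fs: "f \<star> f = f" "\<langle>x, x \<star> f\<rangle> = 0" "\<langle>x \<star> x, x\<rangle> = 1" "f \<noteq> 0" "n x = 0" "\<langle>x, f\<rangle> = 0"
    by (simp_all add: f_def x_def star_eq oct_cnj t oct_mul oct_polar oct_norm oct_eq_iff oct_zero two)
  interpret F: petersson_idempotent s mul one' n \<tau> f by unfold_locales (rule fs)+
  show ?thesis using F.split_okuboI[of x] fs by simp
qed

lemma para_hurwitz_short:
  assumes "short_root_form e1 e2 u v \<tau>"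
  shows "para_hurwitz s UNIV star n 8"
proof -
  define w where "w = one' - v 3"
  have pu: "para_unit s star n w" unfolding w_def by (rule short_form_facts(4)[OF tau_auto assms])
  hence st: "w \<star> x = s \<langle>w, x\<rangle> w - x" for x by (simp add: para_unit_def)
  interpret F: petersson_idempotent s mul one' n \<tau> w
    by unfold_locales (use pu in \<open>auto simp: para_unit_def\<close>)
  have "w \<star> (w \<star> x) = x" for x
    by (simp only: st[of x] star_diff star_bilin F.f_idem) (simp add: st)
  thus ?thesis by (rule F.para_hurwitzI)
qed

text \<open>\<open>e1\<close>, \<open>e2\<close>, \<open>u 1\<close>, \<open>v 1\<close> span a
  split quaternion algebra on which the long form is the identity.\<close>

lemma quaternionic_one_long:
  assumes "long_root_form u \<tau>"
  shows "quaternionic_idempotent s star n one'"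
proof -
  define A where "A = span {e1, e2, u 1, v 1}"
  have eq: "x \<in> A \<longleftrightarrow> (\<exists>a b p q. x = oct a b p 0 0 q 0 0)" for x
  proof
    assume "x \<in> A"
    thus "\<exists>a b p q. x = oct a b p 0 0 q 0 0"
      unfolding A_def
    proof (induction rule: span_induct_alt)
      case base
      show ?case using oct_zero by blast
    next
      case (step c x y)
      have "\<exists>a b p q. x = oct a b p 0 0 q 0 0"
        using step.hyps oct_basis by blast
      with step.IH show ?case by (auto simp: oct_scale oct_add) blast
    qed
  next
    assume "\<exists>a b p q. x = oct a b p 0 0 q 0 0"
    then obtain a b p q where x: "x = s a e1 + s b e2 + s p (u 1) + s q (v 1)" by (auto simp: oct_def)
    show "x \<in> A" unfolding A_def x by (intro span_add span_scale span_base) auto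
  qed
  have "independent {e1, e2, u 1, v 1}"
    by (rule independent_mono[OF basis_independent]) auto
  hence dim: "dim A = 4"
    unfolding A_def using dim_span_eq_card_independent basis_distinct by auto
  have "hurwitz_algebra s A mul one' n"
  proof (rule hurwitz_on_subspaceI)
    show "nonsingular_on A"
      unfolding nonsingular_on_def
    proof (intro conjI ballI impI)
      show "subspace A" by (simp add: A_def)
      fix x assume "x \<in> A" and 0: "\<forall>y\<in>A. \<langle>x, y\<rangle> = 0"
      then obtain a b p q where x: "x = oct a b p 0 0 q 0 0" using eq by blast
      have "oct 1 0 0 0 0 0 0 0 \<in> A" "oct 0 1 0 0 0 0 0 0 \<in> A" "oct 0 0 1 0 0 0 0 0 \<in> A" "oct 0 0 0 0 0 1 0 0 \<in> A"
        using eq by blast+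
      with 0 have "\<langle>x, oct 1 0 0 0 0 0 0 0\<rangle> = 0" "\<langle>x, oct 0 1 0 0 0 0 0 0\<rangle> = 0" "\<langle>x, oct 0 0 1 0 0 0 0 0\<rangle> = 0"
        "\<langle>x, oct 0 0 0 0 0 1 0 0\<rangle> = 0" by blast+
      thus "x = 0" by (simp add: x oct_polar oct_zero oct_eq_iff)
    qed
    show "one' \<in> A" using eq oct_one by blast
    show "x \<cdot> y \<in> A" if "x \<in> A" "y \<in> A" for x y
      using that by (auto simp: eq oct_mul) blast
  qed
  moreover have "N x = 0" if "x \<in> A" for x
    using that by (auto simp: eq N_def long_form_oct[OF tau_auto assms])
  ultimately show ?thesis
    using fixed_subalgebra[of A] idempotent_one by (simp add: dim quaternionic_idempotent_def)
qed

text \<open>On the fixed space the polar form sees only the component along \<open>one'\<close>: the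
  directions \<open>u 1\<close>, \<open>u 2\<close>, \<open>v 3\<close> pair to zero with all fixed
  vectors. So a nonsingular fixed subspace has dimension at most one.\<close>

lemma singular_one_mixed:
  assumes "mixed_form e1 e2 u v \<tau>"
  shows "singular_idempotent s star n one'"
proof -
  have fixd: "\<exists>a p1 p2 q3. x = oct a a p1 p2 0 0 0 q3" if "N x = 0" for x
  proof -
    obtain a b p1 p2 p3 q1 q2 q3 where x: "x = oct a b p1 p2 p3 q1 q2 q3" by (rule oct_cases)
    have "\<tau> x = x" using that by (simp add: N_def)
    hence "p3 = 0 \<and> q1 = 0 \<and> q2 = 0 \<and> b = a"
      unfolding x mixed_form_oct[OF tau_auto assms] by (auto simp: oct_eq_iff)
    thus ?thesis using x by blast
  qed
  have "\<not> centralizer_contains_para_hurwitz s star n one' d" if "2 \<le> d" for d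
  proof
    assume "centralizer_contains_para_hurwitz s star n one' d"
    then obtain A where A: "A \<subseteq> centralizer star one'" "nonsingular_on A" "dim A = d"
      unfolding centralizer_contains_para_hurwitz_def using para_hurwitz_nonsingular_on by blast
    have NA: "N a = 0" if "a \<in> A" for a using A(1) that centralizer_one by blast
    have "card {one'} < dim A" using A(3) that by simp
    then obtain a where a: "a \<in> A" "a \<noteq> 0" "\<langle>a, one'\<rangle> = 0"
      using exists_orthogonal[of "{one'}" A] A(2) by (auto simp: nonsingular_on_def)
    obtain c p1 p2 q3 where "a = oct c c p1 p2 0 0 0 q3" using fixd[OF NA[OF a(1)]] by blast
    moreover from this have "c = 0" using a(3) unfolding oct_one by (simp add: oct_polar add_self)
    ultimately have ac: "a = oct 0 0 p1 p2 0 0 0 q3" by simp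
    have "\<langle>a, y\<rangle> = 0" if "y \<in> A" for y
      using fixd[OF NA[OF that]] by (auto simp: ac oct_polar)
    thus False using a A(2) by (auto simp: nonsingular_on_def)
  qed
  from this[of 2] this[of 4] show ?thesis
    using idempotent_one
    by (simp add: singular_idempotent_def quaternionic_idempotent_def quadratic_idempotent_def)
qed

text \<open>With \<open>g = cnj f\<close> and \<open>y = N g\<close> idempotency reads
  \<open>cnj g = (g + y) \<cdot> (g - y)\<close>. Pairing with \<open>one'\<close> gives
  \<open>(t + 1)\<^sup>2 = 0\<close> for the trace \<open>t\<close> of \<open>g\<close>; what
  remains is \<open>g \<cdot> y = y\<close>, and in coordinates this kills \<open>y\<close>.\<close>

lemma idempotent_long:
  assumes l: "long_root_form u \<tau>" and f: "f \<star> f = f" "f \<noteq> 0"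
  shows "\<exists>m. f = one' - m \<and> N m = 0 \<and> polar n m one' = 0"
proof -
  interpret F: petersson_idempotent s mul one' n \<tau> f by unfold_locales (rule f)+
  have N: "N (oct a b p1 p2 p3 q1 q2 q3) = oct 0 0 0 p3 0 0 0 (- q2)" for a b p1 p2 p3 q1 q2 q3
    by (simp add: N_def long_form_oct[OF tau_auto l] oct_diff)
  have NN: "N (N x) = 0" for x by (cases x rule: oct_cases) (simp add: N oct_zero)
  define g y t where "g = cnj f" and "y = N g" and "t = polar n g one'"
  have ng: "n g = 1" by (simp add: g_def F.f_norm)
  have "cnj g = f" by (simp add: g_def)
  hence fg: "f = s t one' - g" by (simp add: t_def conjugation_def)
  have gy: "polar n g y = 0"
    by (cases g rule: oct_cases) (simp add: y_def N oct_polar algebra_simps)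
  have ny: "n y = 0" using N_norm[of g] by (simp add: y_def NN)
  have ty: "polar n y one' = 0" by (simp add: y_def)
  have tg: "\<tau> g = g + y" "\<tau> (\<tau> g) = g - y"
  proof -
    show 1: "\<tau> g = g + y" by (simp add: y_def tau_eq)
    have "\<tau> (\<tau> g) = g + (y + y)" by (simp add: 1 tau_simps) (simp add: y_def tau_eq NN)
    thus "\<tau> (\<tau> g) = g - y" by (simp only: scale_add_self) simp
  qed
  have "f = \<tau> g \<cdot> \<tau> (\<tau> g)" using f(1) by (simp add: star_eq g_def)
  hence "f = (g + y) \<cdot> (g - y)" unfolding tg(2) unfolding tg(1) .
  moreover have "y \<cdot> y = 0" using square[OF ty] ny by simp
  moreover have gg: "g \<cdot> g = s t g - one'"
    using cnj_mul_mul[of g one'] ng by (simp add: conjugation_def t_def bilin algebra_simps)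
  moreover have "y \<cdot> g = s t y - g \<cdot> y"
  proof -
    have "cnj g \<cdot> (y \<cdot> one') + cnj y \<cdot> (g \<cdot> one') = s (polar n g y) one'" by (rule left_linear)
    thus ?thesis by (simp add: gy ty cnj_traceless[OF ty] conjugation_def t_def[symmetric] bilin algebra_simps)
  qed
  ultimately have "f = s t g - one' - (g \<cdot> y + g \<cdot> y) + s t y" by (simp add: bilin algebra_simps)
  hence "s t one' - g = s t g - one' + g \<cdot> y + s t y" unfolding fg by (simp only: scale_add_self) simp
  hence E: "s t g + g + g \<cdot> y + s t y = s t one' + one'" by (simp add: algebra_simps)
  have "polar n (g \<cdot> y) one' = 0"
    using adjoint_left[of g y one'] gy ty by (simp add: conjugation_def bilin polar_comm[of y g])
  hence "t * t + t = - (t + 1)"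
    using arg_cong[OF E, of "\<lambda>x. polar n x one'"] by (simp add: bilin ty polar_one_one t_def[symmetric])
  hence "(t + 1) * (t + 1) = 0" by (simp add: algebra_simps)
  hence "t + 1 = 0" by simp
  hence t1: "t = - 1" by (simp only: eq_neg_iff_add_eq_0)
  have gy2: "g \<cdot> y = y" using E by (simp add: t1)
  define m where "m = g - one'"
  have fm: "f = one' - m" using scale_add_self[of one'] by (simp add: fg t1 m_def algebra_simps)
  have tm: "polar n m one' = 0" by (simp add: m_def bilin polar_one_one t_def[symmetric] t1)
  have "m \<cdot> N m = 0" using gy2 by (simp add: m_def N_linear bilin flip: y_def)
  moreover obtain a b p1 p2 p3 q1 q2 q3 where m: "m = oct a b p1 p2 p3 q1 q2 q3" by (rule oct_cases)
  ultimately have "p3 = 0 \<and> q2 = 0" by (simp add: N oct_mul oct_zero oct_eq_iff)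
  hence "N m = 0" by (simp add: m N oct_zero)
  thus ?thesis using fm tm by blast
qed

text \<open>The centralizer is the fixed space of \<open>tauf\<close> and contains a nonsingular
  subspace of dimension \<open>4\<close>, so \<open>(tauf - 1)\<^sup>2 = 0\<close> by the result for
  fixed subspaces in the algebra with unit \<open>f\<close>. Written with \<open>star\<close>, this
  is linear in \<open>z\<close> and is tested on a few vectors.\<close>

lemma quaternionic_unique_long:
  assumes l: "long_root_form u \<tau>" and q: "quaternionic_idempotent s star n f"
  shows "f = one'"
proof -
  have f: "f \<star> f = f" "f \<noteq> 0" using q by (auto simp: quaternionic_idempotent_def idempotent_def)
  interpret F: petersson_idempotent s mul one' n \<tau> f by unfold_locales (rule f)+
  obtain m where m: "f = one' - m" "N m = 0" "polar n m one' = 0" using idempotent_long[OF l f] by blast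
  obtain A where A: "A \<subseteq> centralizer star f" "nonsingular_on A" "dim A = 4"
    using q unfolding quaternionic_idempotent_def centralizer_contains_para_hurwitz_def
    using para_hurwitz_nonsingular_on by blast
  have fixA: "F.tauf a = a" if "a \<in> A" for a using A(1) that F.centralizer_iff by blast
  have sq: "F.tauf (F.tauf z) - F.tauf z - (F.tauf z - z) = 0" for z
  proof (cases "F.tauf = id")
    case False
    interpret T: octonion_order3 s F.mulf f n F.tauf
      by unfold_locales (use False F.tauf_auto F.tauf3 in \<open>auto simp: order3_automorphism_def\<close>)
    have "T.N (T.N z) = 0"
    proof (rule T.fixed_subspace_square_zero)
      show "F.O.nonsingular_on A" using A(2) unfolding nonsingular_on_def F.O.nonsingular_on_def .
      show "T.N a = 0" if "a \<in> A" for a using fixA[OF that] by (simp add: T.N_def)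
    qed (use A(3) in simp)
    thus ?thesis by (simp add: T.N_def T.tau_simps)
  qed simp
  \<comment> \<open>Up to multiples of \<open>f\<close>, \<open>tauf\<close> and its square are
    minus right and left multiplication by \<open>f\<close>, so square zero becomes a statement
    about the sum of the two.\<close>
  have star_eq': "f \<star> z + z \<star> f = z - s (polar n z f) f" for z
  proof -
    have tz: "F.tauf z = s (polar n z f) f - z \<star> f" by (rule F.tauf_eq)
    have ttz: "F.tauf (F.tauf z) = s (polar n z f) f - f \<star> z"
    proof -
      have "F.tauf ((z \<star> f) \<star> f) = z" by (simp add: F.tauf_def F.f_flex)
      hence "F.tauf (F.tauf z) = (z \<star> f) \<star> f" using F.tauf3[of "(z \<star> f) \<star> f"] by simp
      thus ?thesis by (simp add: F.f_right)
    qed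
    have "F.tauf (F.tauf z) + z = F.tauf z + F.tauf z" using sq[of z] by (simp add: algebra_simps)
    hence "s (polar n z f) f - f \<star> z + z = (s (polar n z f) f - z \<star> f) + (s (polar n z f) f - z \<star> f)"
      unfolding ttz unfolding tz .
    also have "\<dots> = z \<star> f - s (polar n z f) f" by (simp only: scale_add_self minus_diff_eq)
    finally have "f \<star> z + z \<star> f = (s (polar n z f) f + s (polar n z f) f) + z" by (simp add: algebra_simps)
    thus ?thesis by (simp only: scale_add_self) simp
  qed
  obtain a b p1 p2 p3 q1 q2 q3 where mo: "m = oct a b p1 p2 p3 q1 q2 q3" by (rule oct_cases)
  have "p3 = 0 \<and> q2 = 0"
    using m(2) by (simp add: mo N_def long_form_oct[OF tau_auto l] oct_diff oct_zero oct_eq_iff)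
  moreover have "b = - a" using m(3) unfolding mo oct_one by (simp add: oct_polar eq_neg_iff_add_eq_0 add.commute)
  ultimately have mo: "m = oct a (- a) p1 p2 0 q1 0 q3" using mo by simp
  have fo: "f = oct (1 - a) (1 + a) (- p1) (- p2) 0 (- q1) 0 (- q3)"
    unfolding m(1) mo oct_one by (simp add: oct_diff)
  note E = star_eq'[unfolded star_eq fo]
  note S = oct_cnj long_form_oct[OF tau_auto l] oct_mul oct_polar oct_scale oct_diff oct_add oct_eq_iff
  \<comment> \<open>The identity is tested on \<open>u 1\<close>, \<open>v 1\<close>,
    \<open>e1 - e2\<close>, \<open>v 2\<close> and \<open>u 3\<close>; each kills one of the five
    coordinates in which \<open>f\<close> may still differ from \<open>one'\<close>.\<close>
  have "q1 = 0" using E[of "oct 0 0 1 0 0 0 0 0"] by (simp add: S)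
  have "p1 = 0" using E[of "oct 0 0 0 0 0 1 0 0"] by (simp add: S)
  have "a = 0" using E[of "oct 1 (- 1) 0 0 0 0 0 0"] by (simp add: S \<open>p1 = 0\<close> \<open>q1 = 0\<close> two)
  have "p2 = 0" using E[of "oct 0 0 0 0 0 0 1 0"] by (simp add: S \<open>p1 = 0\<close> \<open>q1 = 0\<close> \<open>a = 0\<close>)
  have "q3 = 0" using E[of "oct 0 0 0 0 1 0 0 0"] by (simp add: S \<open>p1 = 0\<close> \<open>q1 = 0\<close> \<open>a = 0\<close>)
  show ?thesis unfolding fo oct_one by (simp add: \<open>p1 = 0\<close> \<open>q1 = 0\<close> \<open>a = 0\<close> \<open>p2 = 0\<close> \<open>q3 = 0\<close>)
qed

end


section \<open>The classification\<close>

lemma octonion_algebraI: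
  fixes s :: "'f::field \<Rightarrow> 'v::ab_group_add \<Rightarrow> 'v"
  assumes "CHAR('f) = 3" "cayley_algebra s mul one' n"
  shows "octonion_algebra s mul one' n"
  using assms by (simp add: cayley_algebra_def octonion_algebra_def octonion_algebra_axioms_def)

context octonion_algebra
begin

lemma square_zero_canonical:
  assumes "order3_automorphism s mul n \<sigma>" "\<forall>x. \<sigma> (\<sigma> x - x) - (\<sigma> x - x) = 0"
  shows "\<exists>e1 e2 u v. canonical_basis s mul one' e1 e2 u v \<and> long_root_form u \<sigma>"
proof -
  interpret O: octonion_order3 s mul one' n \<sigma> by unfold_locales (rule assms)
  show ?thesis by (rule O.square_zero_long_root_form) (simp only: O.N_def assms)
qed

lemma split_of_isotropic:
  assumes "y \<noteq> 0" "n y = 0" "\<langle>y, one'\<rangle> = 0"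
  shows "\<exists>e1 e2 u v. canonical_basis s mul one' e1 e2 u v"
  using isotropic_traceless_partner[OF assms] extend_hyperbolic_pair assms triad_canonical_basis by metis

end

context octonion_order3
begin

lemma frame:
  assumes "canonical_basis s mul one' e1 e2 u v"
  obtains oct where "octonion_order3_frame s mul one' n \<tau> e1 e2 u v oct"
  using frame_exists[OF assms] octonion_order3_axioms by (auto intro: octonion_order3_frame.intro)

text \<open>If \<open>N\<^sup>2\<close> does not vanish, a nonzero value of it is traceless and
  isotropic, and is completed to a hyperbolic pair.\<close>

lemma split: "split_cayley_algebra s mul one' n"
proof -
  have "\<exists>e1 e2 u v. canonical_basis s mul one' e1 e2 u v"
  proof (cases "\<forall>x. N (N x) = 0")
    case True
    thus ?thesis using square_zero_long_root_form by blast
  next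
    case False
    then obtain x where "N (N x) \<noteq> 0" by blast
    thus ?thesis by (rule split_of_isotropic) simp_all
  qed
  thus ?thesis
    unfolding split_cayley_algebra_def cayley_algebra_def using hurwitz_algebra_axioms dim8 by blast
qed

lemma trichotomy:
  assumes "N (N z) \<noteq> 0"
  shows "(\<exists>K. quadratic_etale_subalgebra s mul one' n K \<and> (\<forall>x\<in>K. \<tau> x = x)) \<or>
    (\<exists>e1 e2 u v. canonical_basis s mul one' e1 e2 u v \<and> short_root_form e1 e2 u v \<tau>) \<or>
    (\<exists>e1 e2 u v. canonical_basis s mul one' e1 e2 u v \<and> mixed_form e1 e2 u v \<tau>)"
proof (cases "\<exists>a. N a = 0 \<and> \<langle>a, one'\<rangle> = 0 \<and> n a \<noteq> 0")
  case True
  thus ?thesis using quadratic_etale_of_fixed by blast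
next
  case False
  thus ?thesis using short_or_mixed_form[OF _ assms] by blast
qed

end

theorem theorem6p3:
  fixes s :: "'f::field \<Rightarrow> 'v::ab_group_add \<Rightarrow> 'v"
    and mul :: "'v \<Rightarrow> 'v \<Rightarrow> 'v" and one' :: 'v and n :: "'v \<Rightarrow> 'f"
    and \<tau> :: "'v \<Rightarrow> 'v"
  defines "N \<equiv> \<lambda>\<sigma> x. \<sigma> x - x"
    and "star \<equiv> petersson s mul one' n \<tau>"
    and "canonical \<equiv> canonical_basis s mul one'"
  defines "cond1 \<equiv> \<lambda>\<sigma>. \<forall>x. N \<sigma> (N \<sigma> x) = 0"
    and "cond2 \<equiv> \<lambda>\<sigma>. \<not> (\<forall>x. N \<sigma> (N \<sigma> x) = 0) \<and>
           (\<exists>K. quadratic_etale_subalgebra s mul one' n K \<and> (\<forall>x\<in>K. \<sigma> x = x))"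
    and "cond3 \<equiv> \<lambda>\<sigma>. \<exists>e1 e2 u v. canonical e1 e2 u v \<and> short_root_form e1 e2 u v \<sigma>"
    and "cond4 \<equiv> \<lambda>\<sigma>. \<exists>e1 e2 u v. canonical e1 e2 u v \<and> mixed_form e1 e2 u v \<sigma>"
  assumes "CHAR('f) = 3"
    and "cayley_algebra s mul one' n"
    and "order3_automorphism s mul n \<tau>"
  shows "split_cayley_algebra s mul one' n \<and>
    (cond1 \<tau> \<or> cond2 \<tau> \<or> cond3 \<tau> \<or> cond4 \<tau>) \<and>
    (cond1 \<tau> \<longrightarrow>
       split_okubo_algebra s star n \<and>
       quaternionic_idempotent s star n one' \<and>
       (\<forall>f. quaternionic_idempotent s star n f \<longrightarrow> f = one') \<and>
       (\<exists>e1 e2 u v. canonical e1 e2 u v \<and> long_root_form u \<tau>) \<and>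
       (\<forall>e1 e2 u v. canonical e1 e2 u v \<longrightarrow>
          (let \<delta> = comm_LR mul (u 2) (v 3)
           in (long_root_form u \<tau> \<longleftrightarrow> \<tau> = exp_nilp s \<delta>) \<and>
              \<delta> \<in> root_space s mul n e1 e2 u v (eps 2 - eps 3))) \<and>
       eps 2 - eps 3 \<in> long_roots \<and>
       unique_up_to_conjugacy s mul n (\<lambda>\<sigma>. order3_automorphism s mul n \<sigma> \<and> cond1 \<sigma>) \<and>
       segre_symbol s (N \<tau>) [2, 2, 1, 1, 1, 1]) \<and>
    (cond2 \<tau> \<longrightarrow>
       okubo_algebra s star n \<and>
       quadratic_idempotent s star n one' \<and>
       segre_symbol s (N \<tau>) [3, 3, 1, 1] \<and>
       (algebraically_closed_field TYPE('f) \<longrightarrow>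
          (\<exists>e1 e2 u v. canonical e1 e2 u v \<and> (\<forall>i. \<tau> (u i) = u (i + 1)) \<and>
             \<tau> e1 = e1 \<and> \<tau> e2 = e2 \<and> \<tau> \<in> torus_normalizer s mul n e1 e2 u v))) \<and>
    (cond3 \<tau> \<longrightarrow>
       (\<forall>e1 e2 u v. canonical e1 e2 u v \<and> short_root_form e1 e2 u v \<tau> \<longrightarrow>
          (let w = one' - v 3; \<delta> = (\<lambda>x. - ad mul (v 3) x)
           in (\<forall>x. \<tau> x = mul (mul w x) (mul w w) \<and> \<tau> x = mul w (mul x (mul w w))) \<and>
              para_unit s star n w \<and>
              \<tau> = exp_nilp s \<delta> \<and>
              \<delta> \<in> root_space s mul n e1 e2 u v (- eps 3))) \<and>
       para_hurwitz s UNIV star n 8 \<and>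
       - eps 3 \<in> short_roots \<and>
       unique_up_to_conjugacy s mul n (\<lambda>\<sigma>. order3_automorphism s mul n \<sigma> \<and> cond3 \<sigma>) \<and>
       segre_symbol s (N \<tau>) [3, 2, 2, 1]) \<and>
    (cond4 \<tau> \<longrightarrow>
       split_okubo_algebra s star n \<and>
       singular_idempotent s star n one' \<and>
       unique_up_to_conjugacy s mul n (\<lambda>\<sigma>. order3_automorphism s mul n \<sigma> \<and> cond4 \<sigma>) \<and>
       (\<forall>e1 e2 u v. canonical e1 e2 u v \<and> mixed_form e1 e2 u v \<tau> \<longrightarrow>
          (\<exists>\<tau>1 \<tau>3. automorphism s mul n \<tau>1 \<and> long_root_form u \<tau>1 \<and>
             automorphism s mul n \<tau>3 \<and> short_root_form e1 e2 u v \<tau>3 \<and>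
             \<tau>1 \<circ> \<tau>3 = \<tau>3 \<circ> \<tau>1 \<and> \<tau> = \<tau>1 \<circ> \<tau>3)) \<and>
       segre_symbol s (N \<tau>) [3, 2, 2, 1])"
proof -
  interpret A: octonion_algebra s mul one' n by (rule octonion_algebraI) fact+
  interpret O: octonion_order3 s mul one' n \<tau> by unfold_locales fact
  have NO: "N \<tau> = O.N" by (simp add: N_def O.N_def fun_eq_iff)
  have star: "star = O.star" by (simp add: star_def)
  have aut: "automorphism s mul n \<sigma>" if "order3_automorphism s mul n \<sigma>" for \<sigma>
    using that by (simp add: order3_automorphism_def)
  have cond1_form: "\<exists>e1 e2 u v. canonical e1 e2 u v \<and> long_root_form u \<sigma>"
    if "order3_automorphism s mul n \<sigma> \<and> cond1 \<sigma>" for \<sigma>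
    using A.square_zero_canonical[of \<sigma>] that unfolding cond1_def N_def canonical_def by simp
  have cond2_fixed: "\<exists>a z. O.N a = 0 \<and> polar n a one' = 0 \<and> n a \<noteq> 0 \<and> O.N (O.N z) \<noteq> 0" if "cond2 \<tau>"
    using that O.fixed_of_quadratic_etale unfolding cond2_def NO by blast
  have 0: "cond1 \<tau> \<or> cond2 \<tau> \<or> cond3 \<tau> \<or> cond4 \<tau>"
    using O.trichotomy unfolding cond1_def cond2_def cond3_def cond4_def NO canonical_def by blast
  have 1: "cond1 \<tau> \<longrightarrow> split_okubo_algebra s star n \<and> quaternionic_idempotent s star n one' \<and>
      (\<forall>f. quaternionic_idempotent s star n f \<longrightarrow> f = one') \<and>
      (\<exists>e1 e2 u v. canonical e1 e2 u v \<and> long_root_form u \<tau>) \<and>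
      (\<forall>e1 e2 u v. canonical e1 e2 u v \<longrightarrow>
        (let \<delta> = comm_LR mul (u 2) (v 3)
         in (long_root_form u \<tau> \<longleftrightarrow> \<tau> = exp_nilp s \<delta>) \<and>
            \<delta> \<in> root_space s mul n e1 e2 u v (eps 2 - eps 3))) \<and>
      eps 2 - eps 3 \<in> long_roots \<and>
      unique_up_to_conjugacy s mul n (\<lambda>\<sigma>. order3_automorphism s mul n \<sigma> \<and> cond1 \<sigma>) \<and>
      segre_symbol s (N \<tau>) [2, 2, 1, 1, 1, 1]"
  proof (intro impI conjI)
    assume c: "cond1 \<tau>"
    obtain e1 e2 u v where can: "canonical e1 e2 u v" and l: "long_root_form u \<tau>"
      using cond1_form[of \<tau>] c O.order3 by blast
    thus "\<exists>e1 e2 u v. canonical e1 e2 u v \<and> long_root_form u \<tau>" by blast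
    obtain oct where "octonion_order3_frame s mul one' n \<tau> e1 e2 u v oct"
      using O.frame can unfolding canonical_def by blast
    then interpret F: octonion_order3_frame s mul one' n \<tau> e1 e2 u v oct .
    show "split_okubo_algebra s star n" unfolding star by (rule F.split_okubo_long[OF l])
    show "quaternionic_idempotent s star n one'" unfolding star by (rule F.quaternionic_one_long[OF l])
    show "\<forall>f. quaternionic_idempotent s star n f \<longrightarrow> f = one'"
      unfolding star using F.quaternionic_unique_long[OF l] by blast
    show "segre_symbol s (N \<tau>) [2, 2, 1, 1, 1, 1]" unfolding NO by (rule F.segre_long[OF l])
    show "eps 2 - eps 3 \<in> long_roots"
      unfolding long_roots_def using index3 by blast
    show "unique_up_to_conjugacy s mul n (\<lambda>\<sigma>. order3_automorphism s mul n \<sigma> \<and> cond1 \<sigma>)"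
      unfolding unique_up_to_conjugacy_def
      using c O.order3 cond1_form A.long_form_conjugate aut unfolding canonical_def by meson
    show "\<forall>e1 e2 u v. canonical e1 e2 u v \<longrightarrow>
        (let \<delta> = comm_LR mul (u 2) (v 3)
         in (long_root_form u \<tau> \<longleftrightarrow> \<tau> = exp_nilp s \<delta>) \<and>
            \<delta> \<in> root_space s mul n e1 e2 u v (eps 2 - eps 3))"
    proof (intro allI impI)
      \<comment> \<open>The canonical basis is now arbitrary; \<open>\<tau>\<close> need not have
        the long form in it.\<close>
      fix e1 e2 u v assume can: "canonical e1 e2 u v"
      obtain oct where "octonion_frame s mul one' n e1 e2 u v oct"
        using A.frame_exists can unfolding canonical_def by blast
      then interpret F: octonion_frame s mul one' n e1 e2 u v oct .
      show "let \<delta> = comm_LR mul (u 2) (v 3)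
         in (long_root_form u \<tau> \<longleftrightarrow> \<tau> = exp_nilp s \<delta>) \<and>
            \<delta> \<in> root_space s mul n e1 e2 u v (eps 2 - eps 3)"
        unfolding Let_def using F.long_form_iff_exp[OF O.tau_auto]
          A.root_space_comm_LR[where u = u and v = v and p = 2 and q = 3, OF F.comm_LR_Der char_value_long] by blast
    qed
  qed
  have 2: "cond2 \<tau> \<longrightarrow> okubo_algebra s star n \<and> quadratic_idempotent s star n one' \<and>
      segre_symbol s (N \<tau>) [3, 3, 1, 1] \<and>
      (algebraically_closed_field TYPE('f) \<longrightarrow>
        (\<exists>e1 e2 u v. canonical e1 e2 u v \<and> (\<forall>i. \<tau> (u i) = u (i + 1)) \<and>
           \<tau> e1 = e1 \<and> \<tau> e2 = e2 \<and> \<tau> \<in> torus_normalizer s mul n e1 e2 u v))"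
  proof (intro impI conjI)
    assume c: "cond2 \<tau>"
    obtain a z where a: "O.N a = 0" "polar n a one' = 0" "n a \<noteq> 0" "O.N (O.N z) \<noteq> 0" using cond2_fixed[OF c] by blast
    obtain x where x: "polar n (O.N (O.N x)) x \<noteq> 0" using O.exists_B_anisotropic[OF a(4)] by blast
    interpret E: octonion_order3_etale s mul one' n \<tau> a x by unfold_locales (use a x in auto)
    show "okubo_algebra s star n" unfolding star by (rule O.etale_okubo[OF a])
    show "quadratic_idempotent s star n one'"
      using c O.etale_quadratic_idempotent a(4) unfolding star cond2_def by blast
    show "segre_symbol s (N \<tau>) [3, 3, 1, 1]" unfolding NO by (rule E.etale_segre)
    show "\<exists>e1 e2 u v. canonical e1 e2 u v \<and> (\<forall>i. \<tau> (u i) = u (i + 1)) \<and>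
        \<tau> e1 = e1 \<and> \<tau> e2 = e2 \<and> \<tau> \<in> torus_normalizer s mul n e1 e2 u v"
      if "algebraically_closed_field TYPE('f)"
      using O.cyclic_canonical_basis[OF that a] O.cyclic_torus_normalizer unfolding canonical_def by meson
  qed
  have 3: "cond3 \<tau> \<longrightarrow>
      (\<forall>e1 e2 u v. canonical e1 e2 u v \<and> short_root_form e1 e2 u v \<tau> \<longrightarrow>
        (let w = one' - v 3; \<delta> = (\<lambda>x. - ad mul (v 3) x)
         in (\<forall>x. \<tau> x = mul (mul w x) (mul w w) \<and> \<tau> x = mul w (mul x (mul w w))) \<and>
            para_unit s star n w \<and> \<tau> = exp_nilp s \<delta> \<and>
            \<delta> \<in> root_space s mul n e1 e2 u v (- eps 3))) \<and>
      para_hurwitz s UNIV star n 8 \<and> - eps 3 \<in> short_roots \<and>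
      unique_up_to_conjugacy s mul n (\<lambda>\<sigma>. order3_automorphism s mul n \<sigma> \<and> cond3 \<sigma>) \<and>
      segre_symbol s (N \<tau>) [3, 2, 2, 1]"
  proof (intro impI conjI)
    assume c: "cond3 \<tau>"
    then obtain e1 e2 u v where can: "canonical e1 e2 u v" and l: "short_root_form e1 e2 u v \<tau>"
      unfolding cond3_def by blast
    obtain oct where "octonion_order3_frame s mul one' n \<tau> e1 e2 u v oct"
      using O.frame can unfolding canonical_def by blast
    then interpret F: octonion_order3_frame s mul one' n \<tau> e1 e2 u v oct .
    show "para_hurwitz s UNIV star n 8" unfolding star by (rule F.para_hurwitz_short[OF l])
    show "segre_symbol s (N \<tau>) [3, 2, 2, 1]" unfolding NO using F.segre_short_or_mixed l by blast
    show "- eps 3 \<in> short_roots" by (simp add: short_roots_def)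
    show "unique_up_to_conjugacy s mul n (\<lambda>\<sigma>. order3_automorphism s mul n \<sigma> \<and> cond3 \<sigma>)"
      unfolding unique_up_to_conjugacy_def
      using c O.order3 A.short_form_conjugate aut unfolding cond3_def canonical_def by meson
    show "\<forall>e1 e2 u v. canonical e1 e2 u v \<and> short_root_form e1 e2 u v \<tau> \<longrightarrow>
        (let w = one' - v 3; \<delta> = (\<lambda>x. - ad mul (v 3) x)
         in (\<forall>x. \<tau> x = mul (mul w x) (mul w w) \<and> \<tau> x = mul w (mul x (mul w w))) \<and>
            para_unit s star n w \<and> \<tau> = exp_nilp s \<delta> \<and>
            \<delta> \<in> root_space s mul n e1 e2 u v (- eps 3))"
    proof (intro allI impI, elim conjE)
      fix e1 e2 u v assume can: "canonical e1 e2 u v" and l: "short_root_form e1 e2 u v \<tau>"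
      obtain oct where "octonion_frame s mul one' n e1 e2 u v oct"
        using A.frame_exists can unfolding canonical_def by blast
      then interpret F: octonion_frame s mul one' n e1 e2 u v oct .
      show "let w = one' - v 3; \<delta> = (\<lambda>x. - ad mul (v 3) x)
         in (\<forall>x. \<tau> x = mul (mul w x) (mul w w) \<and> \<tau> x = mul w (mul x (mul w w))) \<and>
            para_unit s star n w \<and> \<tau> = exp_nilp s \<delta> \<and>
            \<delta> \<in> root_space s mul n e1 e2 u v (- eps 3)"
        unfolding Let_def star
        using F.short_form_facts[OF O.tau_auto l] A.root_space_ad[where v = v and q = 3, OF F.ad_Der char_value_short] by blast
    qed
  qed
  have 4: "cond4 \<tau> \<longrightarrow> split_okubo_algebra s star n \<and> singular_idempotent s star n one' \<and>
      unique_up_to_conjugacy s mul n (\<lambda>\<sigma>. order3_automorphism s mul n \<sigma> \<and> cond4 \<sigma>) \<and>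
      (\<forall>e1 e2 u v. canonical e1 e2 u v \<and> mixed_form e1 e2 u v \<tau> \<longrightarrow>
        (\<exists>\<tau>1 \<tau>3. automorphism s mul n \<tau>1 \<and> long_root_form u \<tau>1 \<and>
           automorphism s mul n \<tau>3 \<and> short_root_form e1 e2 u v \<tau>3 \<and>
           \<tau>1 \<circ> \<tau>3 = \<tau>3 \<circ> \<tau>1 \<and> \<tau> = \<tau>1 \<circ> \<tau>3)) \<and>
      segre_symbol s (N \<tau>) [3, 2, 2, 1]"
  proof (intro impI conjI)
    assume c: "cond4 \<tau>"
    then obtain e1 e2 u v where can: "canonical e1 e2 u v" and l: "mixed_form e1 e2 u v \<tau>"
      unfolding cond4_def by blast
    obtain oct where "octonion_order3_frame s mul one' n \<tau> e1 e2 u v oct"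
      using O.frame can unfolding canonical_def by blast
    then interpret F: octonion_order3_frame s mul one' n \<tau> e1 e2 u v oct .
    show "split_okubo_algebra s star n" unfolding star by (rule F.split_okubo_mixed[OF l])
    show "singular_idempotent s star n one'" unfolding star by (rule F.singular_one_mixed[OF l])
    show "segre_symbol s (N \<tau>) [3, 2, 2, 1]" unfolding NO using F.segre_short_or_mixed l by blast
    show "unique_up_to_conjugacy s mul n (\<lambda>\<sigma>. order3_automorphism s mul n \<sigma> \<and> cond4 \<sigma>)"
      unfolding unique_up_to_conjugacy_def
      using c O.order3 A.mixed_form_conjugate aut unfolding cond4_def canonical_def by meson
    show "\<forall>e1 e2 u v. canonical e1 e2 u v \<and> mixed_form e1 e2 u v \<tau> \<longrightarrow>
        (\<exists>\<tau>1 \<tau>3. automorphism s mul n \<tau>1 \<and> long_root_form u \<tau>1 \<and>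
           automorphism s mul n \<tau>3 \<and> short_root_form e1 e2 u v \<tau>3 \<and>
           \<tau>1 \<circ> \<tau>3 = \<tau>3 \<circ> \<tau>1 \<and> \<tau> = \<tau>1 \<circ> \<tau>3)"
    proof (intro allI impI, elim conjE)
      fix e1 e2 u v assume can: "canonical e1 e2 u v" and l: "mixed_form e1 e2 u v \<tau>"
      obtain oct where "octonion_frame s mul one' n e1 e2 u v oct"
        using A.frame_exists can unfolding canonical_def by blast
      then interpret F: octonion_frame s mul one' n e1 e2 u v oct .
      show "\<exists>\<tau>1 \<tau>3. automorphism s mul n \<tau>1 \<and> long_root_form u \<tau>1 \<and>
           automorphism s mul n \<tau>3 \<and> short_root_form e1 e2 u v \<tau>3 \<and>
           \<tau>1 \<circ> \<tau>3 = \<tau>3 \<circ> \<tau>1 \<and> \<tau> = \<tau>1 \<circ> \<tau>3"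
        by (rule F.mixed_decomposition[OF O.tau_auto l])
    qed
  qed
  show ?thesis using O.split 0 1 2 3 4 by (intro conjI)
qed

end
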